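(* Let $X=(X_1,X_2)$ be a convergent crystal 2-polygraph, $r$ a crystal section, and $\sigma$ a crystal normalization strategy for $r$. Let $\Omega$ be the family of generating confluences obtained from $r$ and $\sigma$. Then $\Omega$ is a crystal cellular extension of $X_2^\top$, and the 2-spheres in $\Omega$ are entirely determined by the critical branchings of highest weight of $X$.
   Context: Crystals. Fix a complex symmetrizable Kac–Moody algebra $\mathfrak g$ with weight lattice $P$, dominant weights $P^+$, simple roots $\alpha_i$ and simple coroots $\alpha_i^\vee$ ($i\in I$). A (normal) crystal is a set $\Gamma$ with maps $\mathrm{wt}:\Gamma\to P$, $\varepsilon_i,\varphi_i:\Gamma\to\mathbb Z$, $e_i,f_i:\Gamma\to\Gamma\sqcup\{0\}$ such that for all $x\in\Gamma$, $i\in I$: $\varphi_i(x)-\varepsilon_i(x)=\langle\mathrm{wt}(x),\alpha_i^\vee\rangle$; $\varepsilon_i(x)=\max\{n:e_i^n.x\ne0\}$ and $\varphi_i(x)=\max\{n:f_i^n.x\neq0\}$; $\mathrm{wt}(e_i.x)=\mathrm{wt}(x)+\alpha_i$ if $e_i.x\ne0$, and $\mathrm{wt}(f_i.x)=\mathrm{wt}(x)-\alpha_i$ if $f_i.x\neq0$; and $e_i.x=x'$ iff $f_i.x'=x$. The maps $e_i,f_i$ are the Kashiwara operators; $k$ denotes any one of them. The connected component $\mathbf B_\Gamma(x)$ is the set of elements obtained from $x$ by successively applying Kashiwara operators. A morphism of crystals is a map commuting with $\mathrm{wt},\varepsilon_i,\varphi_i,e_i,f_i$ (with $0\mapsto0$).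 $B(\lambda)$, $\lambda\in P^+$, is the highest weight crystal of highest weight $\lambda$ (the crystal of the irreducible highest weight module of highest weight $\lambda$): it has a unique element killed by all $e_i$, and all its elements are obtained from that one by applying $f_i$'s. Throughout, "crystal" means a normal crystal each of whose connected components is isomorphic to some $B(\lambda)$, $\lambda\in P^+$. An element is of highest weight if it is killed by all $e_i$. The tensor product $\Gamma_1\otimes\Gamma_2$ is $\Gamma_1\times\Gamma_2$ with additive weight, $e_i.(u\otimes v)=(e_i.u)\otimes v$ if $\varphi_i(u)\ge\varepsilon_i(v)$ and $u\otimes(e_i.v)$ otherwise, $f_i.(u\otimes v)=(f_i.u)\otimes v$ if $\varphi_i(u)>\varepsilon_i(v)$ and $u\otimes(f_i.v)$ otherwise (a tensor with a $0$ entry is $0$). The free monoid $\Gamma^*=\bigsqcup_{n\ge0}\Gamma^{\otimes n}$ is a crystal (the empty word has weight $0$ and is killed by all operators). Polygraphs. A 2-polygraph is a pair of sets $X=(X_1,X_2)$ with maps $s_1,t_1:X_2\to X_1^*$; $\alpha\in X_2$ is written $\alpha:s_1(\alpha)\Rightarrow t_1(\alpha)$. It presents the monoid $\overline X=X_1^*/\sim_{X_2}$, where $\sim_{X_2}$ is the congruence generated by $s_1(\alpha)\sim t_1(\alpha)$; $\pi:X_1^*\to\overline X$ is the projection. $X$ is a crystal 2-polygraph if $X_1,X_2$ are crystals and $s_1,t_1$ are crystal morphisms. Then $\overline X$ is a crystal via $\mathrm{wt}([w])=\mathrm{wt}(w)$, $k.[w]=[k.w]$ if $k.w\ne0$ and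 $k.[w]=0$ otherwise. A rewriting step is $t\alpha v:ts_1(\alpha)v\Rightarrow tt_1(\alpha)v$ with $t,v\in X_1^*$, $\alpha\in X_2$; a rewriting sequence is a sequence of composable steps. $X$ is terminating if there is no infinite rewriting sequence; a branching is a pair of finite rewriting sequences with the same source; it is confluent if the two targets can be rewritten (by finite, possibly empty, sequences) to a common word; $X$ is confluent if all its branchings are, and convergent if terminating and confluent. A local branching is a branching consisting of two steps. It is aspherical if of the form $(f,f)$, Peiffer if (up to exchanging entries) of the form $(fv,ug)$ with $f$ a step of source $u$ and $g$ a step of source $v$, and overlapping otherwise. Order local branchings by the relation generated by $(f,g)\sqsubseteq(ufv,ugv)$, $u,v\in X_1^*$; a critical branching is an overlapping local branching that is $\sqsubseteq$-minimal; their set is $\mathrm{Crit}(X)$. Free (2,1)-monoid. A 2-monoid is a 2-category with one 0-cell; $\star_0$ is composition of 1-cells (and horizontal composition of 2-cells), and $\alpha\star_1\beta$ is vertical composition (first $\alpha$, then $\beta$); a (2,1)-monoid is one with all 2-cells invertible. Let $X_2^-=\{\alpha^-:t_1(\alpha)\Rightarrow s_1(\alpha)\mid\alpha\in X_2\}$. $X_2^\top$ is the (2,1)-monoid with 1-cells $X_1^*$ (with $\star_0$ concatenation), whose 2-cells are identities and finite $\star_1$-composites of elements $t\alpha v$ with $\alpha\in X_2\sqcup X_2^-$, $t,v\in X_1^*$, modulo the congruence generated by $\alpha wv\star_1u'w\beta\equiv uw\beta\star_1\alpha wv'$ (for $\alpha:u\Rightarrow u'$, $\beta:v\Rightarrow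 v'$ in $X_2\sqcup X_2^-$, $w\in X_1^*$), $u\alpha v\star_1u\alpha^-v\equiv1$ and $u\alpha^-v\star_1u\alpha v\equiv1$. Crystal structure. $X_2^-$ is a crystal via $\mathrm{wt}(\alpha^-)=\mathrm{wt}(\alpha)$, $k.\alpha^-=(k.\alpha)^-$. For a 2-cell $\gamma$ of $X_2^\top$, $\mathrm{wt}(\gamma)=\mathrm{wt}(s_1(\gamma))$; $k.\gamma=0$ if $k.s_1(\gamma)=0$; otherwise $k.1_u=1_{k.u}$, $k.(t\alpha v)$ is $(k.t)\alpha v$, $t(k.\alpha)v$ or $t\alpha(k.v)$ according to whether $k.(ts_1(\alpha)v)$ is $(k.t)s_1(\alpha)v$, $t(k.s_1(\alpha))v$ or $ts_1(\alpha)(k.v)$, and $k.(\gamma_1\star_1\gamma_2)=(k.\gamma_1)\star_1(k.\gamma_2)$. Likewise rewriting steps form a crystal, and branchings form a crystal via $\mathrm{wt}(f,g)=\mathrm{wt}(s_1(f))$, $k.(f,g)=(k.f,k.g)$ if $k.s_1(f)\ne0$ and $0$ otherwise; $\mathrm{Crit}(X)$ is stable under nonzero Kashiwara operators and carries the restricted structure. Spheres. A 2-sphere of a 2-monoid $\mathcal C$ is a pair $(f,g)$ of 2-cells with the same source and the same target; for $\mathcal C=X_2^\top$, the set $\mathrm{Sph}(\mathcal C)$ of 2-spheres is a crystal via $\mathrm{wt}(f,g)=\mathrm{wt}(s_1(f))$, $k.(f,g)=(k.f,k.g)$ if $k.s_1(f)\neq0$ and $0$ otherwise. A cellular extension of $X_2^\top$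 is a collection of 2-spheres of $X_2^\top$; it is a crystal cellular extension if it is a subcrystal of $\mathrm{Sph}(X_2^\top)$. Strategies. A section is a map $r:\overline X\to X_1^*$ with $\pi\circ r=\mathrm{id}$ and $r(1)=1$; write $\widehat w=r(\pi(w))$ for $w\in X_1^*$. It is a crystal section if it is a crystal morphism. A normalization strategy for $r$ is a map $\sigma$ assigning to each $u\in X_1^*$ a 2-cell $\sigma_u:u\Rightarrow\widehat u$ of $X_2^\top$ with $\sigma_{\widehat u}=1_{\widehat u}$. Crystal normalization strategies are introduced as follows: for a normalization strategy $\sigma$ for a crystal section $r$, $w\in X_1^*$ and a Kashiwara operator $k$ with $k.w\neq0$, one writes $\sigma(k.w)=(k.w\Rightarrow\widehat{k.w})=k.(w\Rightarrow\widehat w)=k.\sigma(w)$, and such a $\sigma$ is called a crystal normalization strategy. The family of generating confluences obtained from $r$ and $\sigma$ consists of the 2-spheres $(f\star_1\sigma_{t_1(f)},\ g\star_1\sigma_{t_1(g)})$ of $X_2^\top$, one for each critical branching $(f,g)$ of $X$. *)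

theory Defs
  imports
    "HOL-Analysis.Finite_Cartesian_Product"
    "HOL-Computational_Algebra.Polynomial"
    "HOL-Computational_Algebra.Fraction_Field"
begin

text \<open>
  The weight lattice \<open>P\<close>, free abelian of finite rank, is coordinatised as \<open>int ^ 'd\<close>, its dual
  lattice as \<open>int ^ 'd\<close> too, through the standard pairing. The index set \<open>I\<close> is the finite type
  \<open>'i\<close>. The symmetrizer \<open>d\<close> satisfies \<open>d i * a i j = d j * a j i\<close>. The rank of \<open>P\<close> is not
  required to be minimal, so that realizations such as that of \<open>gl\<^sub>n\<close> are covered.
\<close>

record ('i, 'd) km_datum =
  cartan :: "'i \<Rightarrow> 'i \<Rightarrow> int"
  symmetrizer :: "'i \<Rightarrow> nat"
  root :: "'i \<Rightarrow> int ^ ('d::finite)"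
  coroot :: "'i \<Rightarrow> int ^ 'd"

definition pairing :: "int ^ 'd::finite \<Rightarrow> int ^ 'd \<Rightarrow> int" where
  "pairing \<mu> h = (\<Sum>k\<in>UNIV. \<mu> $ k * h $ k)"

definition km_datum :: "('i::finite, 'd::finite) km_datum \<Rightarrow> bool" where
  "km_datum D \<longleftrightarrow>
     (\<forall>i. cartan D i i = 2) \<and>
     (\<forall>i j. i \<noteq> j \<longrightarrow> cartan D i j \<le> 0) \<and>
     (\<forall>i j. cartan D i j = 0 \<longleftrightarrow> cartan D j i = 0) \<and>
     (\<forall>i. symmetrizer D i > 0) \<and>
     (\<forall>i j. int (symmetrizer D i) * cartan D i j = int (symmetrizer D j) * cartan D j i) \<and>
     (\<forall>i j. pairing (root D j) (coroot D i) = cartan D i j) \<and>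
     (\<forall>c. (\<Sum>i\<in>UNIV. c i *s root D i) = 0 \<longrightarrow> (\<forall>i. c i = 0)) \<and>
     (\<forall>c. (\<Sum>i\<in>UNIV. c i *s coroot D i) = 0 \<longrightarrow> (\<forall>i. c i = 0))"

definition dominant :: "('i::finite, 'd::finite) km_datum \<Rightarrow> int ^ 'd \<Rightarrow> bool" where
  "dominant D \<mu> \<longleftrightarrow> (\<forall>i. pairing \<mu> (coroot D i) \<ge> 0)"

datatype 'i kop = E 'i | F 'i

text \<open>The element \<open>0\<close> adjoined to a crystal is \<^const>\<open>None\<close>.\<close>

record ('x, 'i, 'd) crystal =
  elems :: "'x set"
  wt :: "'x \<Rightarrow> int ^ ('d::finite)"
  eps :: "'i \<Rightarrow> 'x \<Rightarrow> int"
  phi :: "'i \<Rightarrow> 'x \<Rightarrow> int"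
  kash :: "'i kop \<Rightarrow> 'x \<Rightarrow> 'x option"

definition iter :: "('x \<Rightarrow> 'x option) \<Rightarrow> nat \<Rightarrow> 'x \<Rightarrow> 'x option" where
  "iter g n x = ((\<lambda>z. Option.bind z g) ^^ n) (Some x)"

definition live_powers :: "('x \<Rightarrow> 'x option) \<Rightarrow> 'x \<Rightarrow> nat set" where
  "live_powers g x = {n. iter g n x \<noteq> None}"

definition normal_crystal ::
  "('i::finite, 'd::finite) km_datum \<Rightarrow> ('x, 'i, 'd) crystal \<Rightarrow> bool" where
  "normal_crystal D \<Gamma> \<longleftrightarrow>
     (\<forall>x\<in>elems \<Gamma>.
        (\<forall>k y. kash \<Gamma> k x = Some y \<longrightarrow> y \<in> elems \<Gamma>) \<and>
        (\<forall>i. phi \<Gamma> i x - eps \<Gamma> i x = pairing (wt \<Gamma> x) (coroot D i)) \<and>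
        (\<forall>i. finite (live_powers (kash \<Gamma> (E i)) x) \<and>
             eps \<Gamma> i x = int (Max (live_powers (kash \<Gamma> (E i)) x))) \<and>
        (\<forall>i. finite (live_powers (kash \<Gamma> (F i)) x) \<and>
             phi \<Gamma> i x = int (Max (live_powers (kash \<Gamma> (F i)) x))) \<and>
        (\<forall>i y. kash \<Gamma> (E i) x = Some y \<longrightarrow> wt \<Gamma> y = wt \<Gamma> x + root D i) \<and>
        (\<forall>i y. kash \<Gamma> (F i) x = Some y \<longrightarrow> wt \<Gamma> y = wt \<Gamma> x - root D i) \<and>
        (\<forall>i. \<forall>x'\<in>elems \<Gamma>. kash \<Gamma> (E i) x = Some x' \<longleftrightarrow> kash \<Gamma> (F i) x' = Some x))"

text \<open>
  The crystal with given elements, weights and operators, the values of \<open>\<epsilon>\<^sub>i\<close> and \<open>\<phi>\<^sub>i\<close> being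
  those forced by normality.
\<close>

definition mk_crystal ::
  "'x set \<Rightarrow> ('x \<Rightarrow> int ^ 'd::finite) \<Rightarrow> ('i kop \<Rightarrow> 'x \<Rightarrow> 'x option) \<Rightarrow> ('x, 'i, 'd) crystal" where
  "mk_crystal S w g =
     \<lparr>elems = S, wt = w,
      eps = (\<lambda>i x. int (Max (live_powers (g (E i)) x))),
      phi = (\<lambda>i x. int (Max (live_powers (g (F i)) x))),
      kash = g\<rparr>"

definition restrict_to :: "('x, 'i, 'd::finite) crystal \<Rightarrow> 'x set \<Rightarrow> ('x, 'i, 'd) crystal" where
  "restrict_to \<Gamma> S = \<Gamma>\<lparr>elems := S\<rparr>"

inductive_set component :: "('x, 'i, 'd::finite) crystal \<Rightarrow> 'x \<Rightarrow> 'x set"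
  for \<Gamma> :: "('x, 'i, 'd) crystal" and x :: 'x where
  base: "x \<in> component \<Gamma> x"
| step: "y \<in> component \<Gamma> x \<Longrightarrow> kash \<Gamma> k y = Some z \<Longrightarrow> z \<in> component \<Gamma> x"

definition morphism ::
  "('x, 'i, 'd::finite) crystal \<Rightarrow> ('y, 'i, 'd) crystal \<Rightarrow> ('x \<Rightarrow> 'y) \<Rightarrow> bool" where
  "morphism \<Gamma> \<Delta> m \<longleftrightarrow>
     (\<forall>x\<in>elems \<Gamma>.
        m x \<in> elems \<Delta> \<and> wt \<Delta> (m x) = wt \<Gamma> x \<and>
        (\<forall>i. eps \<Delta> i (m x) = eps \<Gamma> i x \<and> phi \<Delta> i (m x) = phi \<Gamma> i x) \<and>
        (\<forall>k. kash \<Delta> k (m x) = map_option m (kash \<Gamma> k x)))"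

definition isomorphic ::
  "('x, 'i, 'd::finite) crystal \<Rightarrow> ('y, 'i, 'd) crystal \<Rightarrow> bool" where
  "isomorphic \<Gamma> \<Delta> \<longleftrightarrow> (\<exists>m. morphism \<Gamma> \<Delta> m \<and> bij_betw m (elems \<Gamma>) (elems \<Delta>))"

definition highest_weight :: "('x, 'i, 'd::finite) crystal \<Rightarrow> 'x \<Rightarrow> bool" where
  "highest_weight \<Gamma> x \<longleftrightarrow> x \<in> elems \<Gamma> \<and> (\<forall>i. kash \<Gamma> (E i) x = None)"

definition kash_seq :: "('x, 'i, 'd::finite) crystal \<Rightarrow> 'i kop list \<Rightarrow> 'x \<Rightarrow> 'x option" where
  "kash_seq \<Gamma> ks x = fold (\<lambda>k z. Option.bind z (kash \<Gamma> k)) ks (Some x)"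

text \<open>
  \<open>B(\<lambda>)\<close> is the crystal of the irreducible highest weight module of highest weight \<open>\<lambda>\<close> over the
  quantized enveloping algebra with base field the rational functions in \<open>q\<close> over the rationals.
  Such a module has countable dimension, so it is realised as a subspace of one fixed space of
  countable dimension, for which the additive group of polynomials over the base field serves; the
  multiplication of these polynomials plays no role.
\<close>

type_synonym qfield = "rat poly fract"
type_synonym vect = "qfield poly"

definition q_var :: qfield where
  "q_var = Fract [:0, 1:] 1"

definition q_root :: "('i::finite, 'd::finite) km_datum \<Rightarrow> 'i \<Rightarrow> qfield" where
  "q_root D i = q_var ^ symmetrizer D i"

definition q_int :: "('i::finite, 'd::finite) km_datum \<Rightarrow> 'i \<Rightarrow> nat \<Rightarrow> qfield" where
  "q_int D i n = (q_root D i powi int n - q_root D i powi (- int n))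
                   / (q_root D i - inverse (q_root D i))"

definition divided_power ::
  "('i::finite, 'd::finite) km_datum \<Rightarrow> 'i \<Rightarrow> (vect \<Rightarrow> vect) \<Rightarrow> nat \<Rightarrow> vect \<Rightarrow> vect" where
  "divided_power D i g n x = smult (inverse (\<Prod>m=1..n. q_int D i m)) ((g ^^ n) x)"

record ('i, 'd) qmodule =
  space :: "vect set"
  act_e :: "'i \<Rightarrow> vect \<Rightarrow> vect"
  act_f :: "'i \<Rightarrow> vect \<Rightarrow> vect"
  act_q :: "int ^ ('d::finite) \<Rightarrow> vect \<Rightarrow> vect"

definition is_subspace :: "vect set \<Rightarrow> bool" where
  "is_subspace V \<longleftrightarrow> 0 \<in> V \<and> (\<forall>x\<in>V. \<forall>y\<in>V. x + y \<in> V) \<and> (\<forall>c. \<forall>x\<in>V. smult c x \<in> V)"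

definition endo_on :: "vect set \<Rightarrow> (vect \<Rightarrow> vect) \<Rightarrow> bool" where
  "endo_on V g \<longleftrightarrow> (\<forall>x\<in>V. g x \<in> V) \<and> (\<forall>x\<in>V. \<forall>y\<in>V. g (x + y) = g x + g y) \<and>
                    (\<forall>c. \<forall>x\<in>V. g (smult c x) = smult c (g x))"

definition q_serre ::
  "('i::finite, 'd::finite) km_datum \<Rightarrow> vect set \<Rightarrow> ('i \<Rightarrow> vect \<Rightarrow> vect) \<Rightarrow> bool" where
  "q_serre D V g \<longleftrightarrow>
     (\<forall>i j. i \<noteq> j \<longrightarrow> (\<forall>x\<in>V.
        (let b = nat (1 - cartan D i j) in
         (\<Sum>n\<le>b. smult ((- 1) ^ n)
            (divided_power D i (g i) n (g j (divided_power D i (g i) (b - n) x))))) = 0))"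

definition is_qmodule :: "('i::finite, 'd::finite) km_datum \<Rightarrow> ('i, 'd) qmodule \<Rightarrow> bool" where
  "is_qmodule D M \<longleftrightarrow>
     (let V = space M; e = act_e M; f = act_f M; K = act_q M in
       is_subspace V \<and>
       (\<forall>i. endo_on V (e i) \<and> endo_on V (f i)) \<and> (\<forall>h. endo_on V (K h)) \<and>
       (\<forall>x\<in>V. K 0 x = x) \<and>
       (\<forall>h h'. \<forall>x\<in>V. K (h + h') x = K h (K h' x)) \<and>
       (\<forall>h i. \<forall>x\<in>V. K h (e i x) = smult (q_var powi pairing (root D i) h) (e i (K h x))) \<and>
       (\<forall>h i. \<forall>x\<in>V. K h (f i x) = smult (q_var powi (- pairing (root D i) h)) (f i (K h x))) \<and>
       (\<forall>i j. \<forall>x\<in>V. e i (f j x) - f j (e i x) =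
          (if i = j
           then smult (inverse (q_root D i - inverse (q_root D i)))
                  (K (int (symmetrizer D i) *s coroot D i) x
                   - K (- (int (symmetrizer D i) *s coroot D i)) x)
           else 0)) \<and>
       q_serre D V e \<and> q_serre D V f)"

definition irreducible_qmodule ::
  "('i::finite, 'd::finite) km_datum \<Rightarrow> ('i, 'd) qmodule \<Rightarrow> bool" where
  "irreducible_qmodule D M \<longleftrightarrow>
     is_qmodule D M \<and> space M \<noteq> {0} \<and>
     (\<forall>N. is_subspace N \<and> N \<subseteq> space M \<and>
          (\<forall>x\<in>N. (\<forall>i. act_e M i x \<in> N \<and> act_f M i x \<in> N) \<and> (\<forall>h. act_q M h x \<in> N))
          \<longrightarrow> N = {0} \<or> N = space M)"

definition weight_space :: "('i, 'd::finite) qmodule \<Rightarrow> int ^ 'd \<Rightarrow> vect set" where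
  "weight_space M \<mu> = {x \<in> space M. \<forall>h. act_q M h x = smult (q_var powi pairing \<mu> h) x}"

definition highest_weight_vector ::
  "('i, 'd::finite) qmodule \<Rightarrow> int ^ 'd \<Rightarrow> vect \<Rightarrow> bool" where
  "highest_weight_vector M \<mu> v \<longleftrightarrow>
     v \<noteq> 0 \<and> v \<in> weight_space M \<mu> \<and> (\<forall>i. act_e M i v = 0)"

text \<open>
  \<open>string_decomp D M i x us\<close> says that \<open>x\<close> is a weight vector and that
  \<open>x = (\<Sum>n. f\<^sub>i\<^sup>(\<^sup>n\<^sup>) (us n))\<close> with \<open>us n\<close> a weight vector killed by \<open>e\<^sub>i\<close>. The last requirement on
  \<open>us n\<close> excludes the \<open>n\<close> for which \<open>f\<^sub>i\<^sup>(\<^sup>n\<^sup>) (us n)\<close> would vanish; it makes \<open>us\<close> unique.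
\<close>

definition string_decomp ::
  "('i::finite, 'd::finite) km_datum \<Rightarrow> ('i, 'd) qmodule \<Rightarrow> 'i \<Rightarrow> vect \<Rightarrow> (nat \<Rightarrow> vect) \<Rightarrow> bool" where
  "string_decomp D M i x us \<longleftrightarrow>
     (\<exists>\<mu>. x \<in> weight_space M \<mu> \<and>
       (\<forall>n. us n \<in> weight_space M (\<mu> + int n *s root D i) \<and> act_e M i (us n) = 0 \<and>
            (us n \<noteq> 0 \<longrightarrow> int n \<le> pairing (\<mu> + int n *s root D i) (coroot D i))) \<and>
       finite {n. us n \<noteq> 0} \<and>
       x = (\<Sum>n | us n \<noteq> 0. divided_power D i (act_f M i) n (us n)))"

text \<open>
  \<open>tilde_op D M k\<close> is the graph of the Kashiwara operator \<open>k\<close> on weight vectors of the module.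
\<close>

fun tilde_op ::
  "('i::finite, 'd::finite) km_datum \<Rightarrow> ('i, 'd) qmodule \<Rightarrow> 'i kop \<Rightarrow> vect \<Rightarrow> vect \<Rightarrow> bool" where
  "tilde_op D M (E i) x y \<longleftrightarrow>
     (\<exists>us. string_decomp D M i x us \<and>
        y = (\<Sum>n | us n \<noteq> 0 \<and> n \<ge> 1. divided_power D i (act_f M i) (n - 1) (us n)))"
| "tilde_op D M (F i) x y \<longleftrightarrow>
     (\<exists>us. string_decomp D M i x us \<and>
        y = (\<Sum>n | us n \<noteq> 0. divided_power D i (act_f M i) (n + 1) (us n)))"

inductive_set f_monomials ::
  "('i::finite, 'd::finite) km_datum \<Rightarrow> ('i, 'd) qmodule \<Rightarrow> vect \<Rightarrow> vect set"
  for D :: "('i, 'd) km_datum" and M :: "('i, 'd) qmodule" and v :: vect where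
  base: "v \<in> f_monomials D M v"
| step: "x \<in> f_monomials D M v \<Longrightarrow> tilde_op D M (F i) x y \<Longrightarrow> y \<in> f_monomials D M v"

text \<open>Rational functions without pole at \<open>q = 0\<close>.\<close>

definition regular_at_0 :: "qfield set" where
  "regular_at_0 = {Fract a b | a b. coeff b 0 \<noteq> 0}"

definition crystal_lattice ::
  "('i::finite, 'd::finite) km_datum \<Rightarrow> ('i, 'd) qmodule \<Rightarrow> vect \<Rightarrow> vect set" where
  "crystal_lattice D M v =
     {\<Sum>x\<in>T. smult (c x) x | T c. finite T \<and> T \<subseteq> f_monomials D M v \<and> (\<forall>x\<in>T. c x \<in> regular_at_0)}"

definition residue :: "vect set \<Rightarrow> vect \<Rightarrow> vect set" where
  "residue L x = {x + smult q_var y | y. y \<in> L}"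

text \<open>
  \<open>\<Gamma>\<close> is the crystal formed by the nonzero residue classes, modulo \<open>q L\<close>, of the vectors
  \<open>f\<^sub>i\<^sub>1 \<dots> f\<^sub>i\<^sub>m v\<close> (Kashiwara operators), with the operators induced on \<open>L / q L\<close> by those of the
  module. By Kashiwara's theorem the lattice \<open>L\<close> is stable, and the induced operators are well
  defined; the clauses quantifying over all representatives say just this.
\<close>

definition crystal_of_qmodule ::
  "('i::finite, 'd::finite) km_datum \<Rightarrow> ('i, 'd) qmodule \<Rightarrow> vect \<Rightarrow> (vect set, 'i, 'd) crystal \<Rightarrow> bool"
  where
  "crystal_of_qmodule D M v \<Gamma> \<longleftrightarrow>
     (let L = crystal_lattice D M v in
       (\<forall>x\<in>L. \<forall>k y. tilde_op D M k x y \<longrightarrow> y \<in> L) \<and>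
       elems \<Gamma> = {residue L x | x. x \<in> f_monomials D M v \<and> residue L x \<noteq> residue L 0} \<and>
       (\<forall>b\<in>elems \<Gamma>. \<forall>x\<in>b. \<forall>\<mu>. x \<in> weight_space M \<mu> \<longrightarrow> wt \<Gamma> b = \<mu>) \<and>
       (\<forall>b\<in>elems \<Gamma>. \<forall>x\<in>b. \<forall>k y. tilde_op D M k x y \<longrightarrow>
          kash \<Gamma> k b = (if residue L y = residue L 0 then None else Some (residue L y))) \<and>
       (\<forall>b\<in>elems \<Gamma>. \<forall>i. eps \<Gamma> i b = int (Max (live_powers (kash \<Gamma> (E i)) b)) \<and>
                           phi \<Gamma> i b = int (Max (live_powers (kash \<Gamma> (F i)) b))))"

definition is_B :: 
  "('i::finite, 'd::finite) km_datum \<Rightarrow> int ^ 'd \<Rightarrow> (vect set, 'i, 'd) crystal \<Rightarrow> bool" where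
  "is_B D \<mu> B \<longleftrightarrow>
     (\<exists>M v. irreducible_qmodule D M \<and> highest_weight_vector M \<mu> v \<and> crystal_of_qmodule D M v B)"

definition crystal :: "('i::finite, 'd::finite) km_datum \<Rightarrow> ('x, 'i, 'd) crystal \<Rightarrow> bool" where
  "crystal D \<Gamma> \<longleftrightarrow>
     normal_crystal D \<Gamma> \<and>
     (\<forall>x\<in>elems \<Gamma>. \<exists>\<mu> B. dominant D \<mu> \<and> is_B D \<mu> B \<and> isomorphic (restrict_to \<Gamma> (component \<Gamma> x)) B)"

definition subcrystal ::
  "('i::finite, 'd::finite) km_datum \<Rightarrow> ('x, 'i, 'd) crystal \<Rightarrow> 'x set \<Rightarrow> bool" where
  "subcrystal D \<Gamma> S \<longleftrightarrow> S \<subseteq> elems \<Gamma> \<and> normal_crystal D (restrict_to \<Gamma> S)"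

text \<open>
  A subset stable under the operators is a union of connected components, so that the subcrystals
  of a crystal are crystals, including the condition on the type of the components.
\<close>

lemma component_restrict_to: "component (restrict_to \<Gamma> S) x = component \<Gamma> x"
proof (intro set_eqI iffI)
  fix y assume "y \<in> component (restrict_to \<Gamma> S) x"
  then show "y \<in> component \<Gamma> x"
    by induction (auto simp: restrict_to_def intro: component.intros)
next
  fix y assume "y \<in> component \<Gamma> x"
  then show "y \<in> component (restrict_to \<Gamma> S) x"
  proof induction
    case (step y k z)
    then show ?case by (auto simp: restrict_to_def intro: component.step[where k = k])
  qed (rule component.base)
qed

lemma crystal_subcrystal:
  assumes "crystal D \<Gamma>" "subcrystal D \<Gamma> S"
  shows "crystal D (restrict_to \<Gamma> S)"
proof -
  have "restrict_to (restrict_to \<Gamma> S) T = restrict_to \<Gamma> T" for T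
    by (simp add: restrict_to_def)
  with assms show ?thesis
    by (auto simp: crystal_def subcrystal_def component_restrict_to) (auto simp: restrict_to_def)
qed

definition tensor_op ::
  "('x, 'i, 'd::finite) crystal \<Rightarrow> ('y, 'i, 'd) crystal \<Rightarrow> 'i kop \<Rightarrow> 'x \<times> 'y \<Rightarrow> ('x \<times> 'y) option"
  where
  "tensor_op \<Gamma> \<Delta> k = (\<lambda>(u, v).
     if (case k of E i \<Rightarrow> phi \<Gamma> i u \<ge> eps \<Delta> i v | F i \<Rightarrow> phi \<Gamma> i u > eps \<Delta> i v)
     then map_option (\<lambda>u'. (u', v)) (kash \<Gamma> k u)
     else map_option (\<lambda>v'. (u, v')) (kash \<Delta> k v))"

definition tensor ::
  "('x, 'i, 'd::finite) crystal \<Rightarrow> ('y, 'i, 'd) crystal \<Rightarrow> ('x \<times> 'y, 'i, 'd) crystal" where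
  "tensor \<Gamma> \<Delta> =
     mk_crystal (elems \<Gamma> \<times> elems \<Delta>) (\<lambda>(u, v). wt \<Gamma> u + wt \<Delta> v) (tensor_op \<Gamma> \<Delta>)"

text \<open>The pair \<open>(x, w)\<close> of \<open>\<Gamma> \<otimes> \<Gamma>\<^sup>\<otimes>\<^sup>n\<close> is written as the word \<open>x # w\<close>.\<close>

primrec tensor_power ::
  "('x, 'i, 'd::finite) crystal \<Rightarrow> nat \<Rightarrow> ('x list, 'i, 'd) crystal" where
  "tensor_power \<Gamma> 0 = mk_crystal {[]} (\<lambda>_. 0) (\<lambda>_ _. None)"
| "tensor_power \<Gamma> (Suc n) =
     (let T = tensor \<Gamma> (tensor_power \<Gamma> n) in
      mk_crystal ((\<lambda>(x, w). x # w) ` elems T)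
        (\<lambda>w. wt T (hd w, tl w))
        (\<lambda>k w. map_option (\<lambda>(x, w'). x # w') (kash T k (hd w, tl w))))"

definition words :: "('x, 'i, 'd::finite) crystal \<Rightarrow> ('x list, 'i, 'd) crystal" where
  "words \<Gamma> = mk_crystal (\<Union>n. elems (tensor_power \<Gamma> n))
     (\<lambda>w. wt (tensor_power \<Gamma> (length w)) w)
     (\<lambda>k w. kash (tensor_power \<Gamma> (length w)) k w)"

record ('a, 'b, 'i, 'd) polygraph =
  gen1 :: "('a, 'i, 'd::finite) crystal"
  gen2 :: "('b, 'i, 'd) crystal"
  src :: "'b \<Rightarrow> 'a list"
  tgt :: "'b \<Rightarrow> 'a list"

definition free_words :: "('a, 'b, 'i, 'd::finite) polygraph \<Rightarrow> 'a list set" where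
  "free_words X = elems (words (gen1 X))"

definition crystal_polygraph ::
  "('i::finite, 'd::finite) km_datum \<Rightarrow> ('a, 'b, 'i, 'd) polygraph \<Rightarrow> bool" where
  "crystal_polygraph D X \<longleftrightarrow>
     crystal D (gen1 X) \<and> crystal D (gen2 X) \<and>
     morphism (gen2 X) (words (gen1 X)) (src X) \<and>
     morphism (gen2 X) (words (gen1 X)) (tgt X)"

inductive presented_eq :: "('a, 'b, 'i, 'd::finite) polygraph \<Rightarrow> 'a list \<Rightarrow> 'a list \<Rightarrow> bool"
  for X :: "('a, 'b, 'i, 'd) polygraph" where
  gen: "\<alpha> \<in> elems (gen2 X) \<Longrightarrow> presented_eq X (src X \<alpha>) (tgt X \<alpha>)"
| refl: "u \<in> free_words X \<Longrightarrow> presented_eq X u u"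
| sym: "presented_eq X u v \<Longrightarrow> presented_eq X v u"
| trans: "presented_eq X u v \<Longrightarrow> presented_eq X v w \<Longrightarrow> presented_eq X u w"
| mult: "presented_eq X u u' \<Longrightarrow> presented_eq X v v' \<Longrightarrow> presented_eq X (u @ v) (u' @ v')"

definition word_class :: "('a, 'b, 'i, 'd::finite) polygraph \<Rightarrow> 'a list \<Rightarrow> 'a list set" where
  "word_class X w = {w'. presented_eq X w w'}"

text \<open>
  Here and for 2-cells below, the structure of a set of classes is defined on a representative
  obtained by choice; it does not depend on that choice.
\<close>

definition presented_monoid ::
  "('a, 'b, 'i, 'd::finite) polygraph \<Rightarrow> ('a list set, 'i, 'd) crystal" where
  "presented_monoid X =
     mk_crystal (word_class X ` free_words X)
       (\<lambda>C. wt (words (gen1 X)) (SOME w. w \<in> C))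
       (\<lambda>k C. map_option (word_class X) (kash (words (gen1 X)) k (SOME w. w \<in> C)))"

text \<open>The step \<open>t \<alpha> v\<close> is the triple \<open>(t, \<alpha>, v)\<close>.\<close>

type_synonym ('a, 'b) step = "'a list \<times> 'b \<times> 'a list"

definition steps :: "('a, 'b, 'i, 'd::finite) polygraph \<Rightarrow> ('a, 'b) step set" where
  "steps X = free_words X \<times> elems (gen2 X) \<times> free_words X"

fun step_src :: "('a, 'b, 'i, 'd::finite) polygraph \<Rightarrow> ('a, 'b) step \<Rightarrow> 'a list" where
  "step_src X (t, \<alpha>, v) = t @ src X \<alpha> @ v"

fun step_tgt :: "('a, 'b, 'i, 'd::finite) polygraph \<Rightarrow> ('a, 'b) step \<Rightarrow> 'a list" where
  "step_tgt X (t, \<alpha>, v) = t @ tgt X \<alpha> @ v"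

fun whisker_step :: "'a list \<Rightarrow> ('a, 'b) step \<Rightarrow> 'a list \<Rightarrow> ('a, 'b) step" where
  "whisker_step u (t, \<alpha>, v) w = (u @ t, \<alpha>, v @ w)"

fun step_op ::
  "('a, 'b, 'i, 'd::finite) polygraph \<Rightarrow> 'i kop \<Rightarrow> ('a, 'b) step \<Rightarrow> ('a, 'b) step option" where
  "step_op X k (t, \<alpha>, v) =
     (let g = kash (words (gen1 X)) k; s = src X \<alpha> in
      case g (t @ s @ v) of
        None \<Rightarrow> None
      | Some w \<Rightarrow>
          if map_option (\<lambda>t'. t' @ s @ v) (g t) = Some w
          then map_option (\<lambda>t'. (t', \<alpha>, v)) (g t)
          else if map_option (\<lambda>s'. t @ s' @ v) (g s) = Some w
          then map_option (\<lambda>\<alpha>'. (t, \<alpha>', v)) (kash (gen2 X) k \<alpha>)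
          else map_option (\<lambda>v'. (t, \<alpha>, v')) (g v))"

definition rewrite_rel :: "('a, 'b, 'i, 'd::finite) polygraph \<Rightarrow> 'a list rel" where
  "rewrite_rel X = {(step_src X f, step_tgt X f) | f. f \<in> steps X}"

definition terminating :: "('a, 'b, 'i, 'd::finite) polygraph \<Rightarrow> bool" where
  "terminating X \<longleftrightarrow>
     \<not> (\<exists>f :: nat \<Rightarrow> ('a, 'b) step. \<forall>n. f n \<in> steps X \<and> step_tgt X (f n) = step_src X (f (Suc n)))"

definition confluent :: "('a, 'b, 'i, 'd::finite) polygraph \<Rightarrow> bool" where
  "confluent X \<longleftrightarrow>
     (\<forall>u v w. (u, v) \<in> (rewrite_rel X)\<^sup>* \<and> (u, w) \<in> (rewrite_rel X)\<^sup>* \<longrightarrow>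
        (\<exists>z. (v, z) \<in> (rewrite_rel X)\<^sup>* \<and> (w, z) \<in> (rewrite_rel X)\<^sup>*))"

definition convergent_polygraph :: "('a, 'b, 'i, 'd::finite) polygraph \<Rightarrow> bool" where
  "convergent_polygraph X \<longleftrightarrow> terminating X \<and> confluent X"

type_synonym ('a, 'b) branching = "('a, 'b) step \<times> ('a, 'b) step"

definition local_branchings :: "('a, 'b, 'i, 'd::finite) polygraph \<Rightarrow> ('a, 'b) branching set" where
  "local_branchings X = {(f, g). f \<in> steps X \<and> g \<in> steps X \<and> step_src X f = step_src X g}"

definition aspherical :: "('a, 'b) branching \<Rightarrow> bool" where
  "aspherical b \<longleftrightarrow> fst b = snd b"

definition peiffer :: "('a, 'b, 'i, 'd::finite) polygraph \<Rightarrow> ('a, 'b) branching \<Rightarrow> bool" where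
  "peiffer X b \<longleftrightarrow>
     (\<exists>f\<in>steps X. \<exists>g\<in>steps X.
        let f' = whisker_step [] f (step_src X g); g' = whisker_step (step_src X f) g []
        in b = (f', g') \<or> b = (g', f'))"

definition overlapping :: "('a, 'b, 'i, 'd::finite) polygraph \<Rightarrow> ('a, 'b) branching \<Rightarrow> bool" where
  "overlapping X b \<longleftrightarrow> b \<in> local_branchings X \<and> \<not> aspherical b \<and> \<not> peiffer X b"

definition branching_le ::
  "('a, 'b, 'i, 'd::finite) polygraph \<Rightarrow> ('a, 'b) branching \<Rightarrow> ('a, 'b) branching \<Rightarrow> bool" where
  "branching_le X b b' \<longleftrightarrow>
     (\<exists>u\<in>free_words X. \<exists>v\<in>free_words X.
        b' = (whisker_step u (fst b) v, whisker_step u (snd b) v))"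

definition Crit :: "('a, 'b, 'i, 'd::finite) polygraph \<Rightarrow> ('a, 'b) branching set" where
  "Crit X = {b. overlapping X b \<and> (\<forall>b'\<in>local_branchings X. branching_le X b' b \<longrightarrow> b' = b)}"

fun branching_op ::
  "('a, 'b, 'i, 'd::finite) polygraph \<Rightarrow> 'i kop \<Rightarrow> ('a, 'b) branching \<Rightarrow> ('a, 'b) branching option"
  where
  "branching_op X k (f, g) =
     (if kash (words (gen1 X)) k (step_src X f) = None then None
      else Some (the (step_op X k f), the (step_op X k g)))"

definition crit_crystal ::
  "('a, 'b, 'i, 'd::finite) polygraph \<Rightarrow> (('a, 'b) branching, 'i, 'd) crystal" where
  "crit_crystal X =
     mk_crystal (Crit X) (\<lambda>(f, g). wt (words (gen1 X)) (step_src X f)) (branching_op X)"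

datatype 'b signed = Fwd 'b | Bwd 'b

fun inv_signed :: "'b signed \<Rightarrow> 'b signed" where
  "inv_signed (Fwd \<alpha>) = Bwd \<alpha>"
| "inv_signed (Bwd \<alpha>) = Fwd \<alpha>"

fun unsigned :: "'b signed \<Rightarrow> 'b" where
  "unsigned (Fwd \<alpha>) = \<alpha>"
| "unsigned (Bwd \<alpha>) = \<alpha>"

fun signed_op :: "('b \<Rightarrow> 'b option) \<Rightarrow> 'b signed \<Rightarrow> 'b signed option" where
  "signed_op g (Fwd \<alpha>) = map_option Fwd (g \<alpha>)"
| "signed_op g (Bwd \<alpha>) = map_option Bwd (g \<alpha>)"

definition signed_crystal ::
  "('b, 'i, 'd::finite) crystal \<Rightarrow> ('b signed, 'i, 'd) crystal" where
  "signed_crystal \<Gamma> =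
     \<lparr>elems = Fwd ` elems \<Gamma> \<union> Bwd ` elems \<Gamma>,
      wt = (\<lambda>a. wt \<Gamma> (unsigned a)),
      eps = (\<lambda>i a. eps \<Gamma> i (unsigned a)),
      phi = (\<lambda>i a. phi \<Gamma> i (unsigned a)),
      kash = (\<lambda>k. signed_op (kash \<Gamma> k))\<rparr>"

text \<open>The polygraph with 2-generators \<open>X\<^sub>2 \<squnion> X\<^sub>2\<^sup>-\<close>.\<close>

definition with_inverses ::
  "('a, 'b, 'i, 'd::finite) polygraph \<Rightarrow> ('a, 'b signed, 'i, 'd) polygraph" where
  "with_inverses X =
     \<lparr>gen1 = gen1 X, gen2 = signed_crystal (gen2 X),
      src = (\<lambda>a. case a of Fwd \<alpha> \<Rightarrow> src X \<alpha> | Bwd \<alpha> \<Rightarrow> tgt X \<alpha>),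
      tgt = (\<lambda>a. case a of Fwd \<alpha> \<Rightarrow> tgt X \<alpha> | Bwd \<alpha> \<Rightarrow> src X \<alpha>)\<rparr>"

text \<open>
  A formal composite of whiskered generators and inverses of generators is given by its source word
  and its list of steps, so that the empty list represents an identity.
\<close>

type_synonym ('a, 'b) path = "'a list \<times> ('a, 'b signed) step list"

fun composable ::
  "('a, 'b, 'i, 'd::finite) polygraph \<Rightarrow> 'a list \<Rightarrow> ('a, 'b) step list \<Rightarrow> bool" where
  "composable Y u [] \<longleftrightarrow> u \<in> free_words Y"
| "composable Y u (f # fs) \<longleftrightarrow>
     f \<in> steps Y \<and> step_src Y f = u \<and> composable Y (step_tgt Y f) fs"

definition paths :: "('a, 'b, 'i, 'd::finite) polygraph \<Rightarrow> ('a, 'b) path set" where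
  "paths X = {(u, fs). composable (with_inverses X) u fs}"

definition path_src :: "('a, 'b) path \<Rightarrow> 'a list" where
  "path_src p = fst p"

definition path_tgt :: "('a, 'b, 'i, 'd::finite) polygraph \<Rightarrow> ('a, 'b) path \<Rightarrow> 'a list" where
  "path_tgt X p = (if snd p = [] then fst p else step_tgt (with_inverses X) (last (snd p)))"

definition path_comp :: "('a, 'b) path \<Rightarrow> ('a, 'b) path \<Rightarrow> ('a, 'b) path" where
  "path_comp p p' = (fst p, snd p @ snd p')"

definition whisker_path :: "'a list \<Rightarrow> ('a, 'b) path \<Rightarrow> 'a list \<Rightarrow> ('a, 'b) path" where
  "whisker_path u p v = (u @ fst p @ v, map (\<lambda>f. whisker_step u f v) (snd p))"

inductive path_eq ::
  "('a, 'b, 'i, 'd::finite) polygraph \<Rightarrow> ('a, 'b) path \<Rightarrow> ('a, 'b) path \<Rightarrow> bool"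
  for X :: "('a, 'b, 'i, 'd) polygraph" where
  exchange:
    "a \<in> elems (gen2 (with_inverses X)) \<Longrightarrow> b \<in> elems (gen2 (with_inverses X)) \<Longrightarrow>
     w \<in> free_words X \<Longrightarrow>
     u = src (with_inverses X) a \<Longrightarrow> u' = tgt (with_inverses X) a \<Longrightarrow>
     v = src (with_inverses X) b \<Longrightarrow> v' = tgt (with_inverses X) b \<Longrightarrow>
     path_eq X (u @ w @ v, [([], a, w @ v), (u' @ w, b, [])])
               (u @ w @ v, [(u @ w, b, []), ([], a, w @ v')])"
| inverse:
    "a \<in> elems (gen2 (with_inverses X)) \<Longrightarrow> u \<in> free_words X \<Longrightarrow> v \<in> free_words X \<Longrightarrow>
     path_eq X (u @ src (with_inverses X) a @ v, [(u, a, v), (u, inv_signed a, v)])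
               (u @ src (with_inverses X) a @ v, [])"
| refl: "p \<in> paths X \<Longrightarrow> path_eq X p p"
| sym: "path_eq X p p' \<Longrightarrow> path_eq X p' p"
| trans: "path_eq X p p' \<Longrightarrow> path_eq X p' p'' \<Longrightarrow> path_eq X p p''"
| vcomp: "path_eq X p p' \<Longrightarrow> path_eq X r r' \<Longrightarrow> path_tgt X p = path_src r \<Longrightarrow>
     path_eq X (path_comp p r) (path_comp p' r')"
| whisker: "path_eq X p p' \<Longrightarrow> u \<in> free_words X \<Longrightarrow> v \<in> free_words X \<Longrightarrow>
     path_eq X (whisker_path u p v) (whisker_path u p' v)"

type_synonym ('a, 'b) cell = "('a, 'b) path set"

definition cell_of :: "('a, 'b, 'i, 'd::finite) polygraph \<Rightarrow> ('a, 'b) path \<Rightarrow> ('a, 'b) cell" where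
  "cell_of X p = {p'. path_eq X p p'}"

definition cells :: "('a, 'b, 'i, 'd::finite) polygraph \<Rightarrow> ('a, 'b) cell set" where
  "cells X = cell_of X ` paths X"

definition rep :: "('a, 'b) cell \<Rightarrow> ('a, 'b) path" where
  "rep c = (SOME p. p \<in> c)"

definition cell_src :: "('a, 'b) cell \<Rightarrow> 'a list" where
  "cell_src c = path_src (rep c)"

definition cell_tgt :: "('a, 'b, 'i, 'd::finite) polygraph \<Rightarrow> ('a, 'b) cell \<Rightarrow> 'a list" where
  "cell_tgt X c = path_tgt X (rep c)"

definition id_cell :: "('a, 'b, 'i, 'd::finite) polygraph \<Rightarrow> 'a list \<Rightarrow> ('a, 'b) cell" where
  "id_cell X u = cell_of X (u, [])"

definition cell_comp ::
  "('a, 'b, 'i, 'd::finite) polygraph \<Rightarrow> ('a, 'b) cell \<Rightarrow> ('a, 'b) cell \<Rightarrow> ('a, 'b) cell" where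
  "cell_comp X c c' = cell_of X (path_comp (rep c) (rep c'))"

fun step_cell :: "('a, 'b, 'i, 'd::finite) polygraph \<Rightarrow> ('a, 'b) step \<Rightarrow> ('a, 'b) cell" where
  "step_cell X (t, \<alpha>, v) = cell_of X (t @ src X \<alpha> @ v, [(t, Fwd \<alpha>, v)])"

fun path_op ::
  "('a, 'b, 'i, 'd::finite) polygraph \<Rightarrow> 'i kop \<Rightarrow> ('a, 'b) path \<Rightarrow> ('a, 'b) path option" where
  "path_op X k (u, fs) =
     map_option (\<lambda>u'. (u', map (\<lambda>f. the (step_op (with_inverses X) k f)) fs))
       (kash (words (gen1 X)) k u)"

definition cell_op ::
  "('a, 'b, 'i, 'd::finite) polygraph \<Rightarrow> 'i kop \<Rightarrow> ('a, 'b) cell \<Rightarrow> ('a, 'b) cell option" where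
  "cell_op X k c = map_option (cell_of X) (path_op X k (rep c))"

type_synonym ('a, 'b) sphere = "('a, 'b) cell \<times> ('a, 'b) cell"

fun sphere_op ::
  "('a, 'b, 'i, 'd::finite) polygraph \<Rightarrow> 'i kop \<Rightarrow> ('a, 'b) sphere \<Rightarrow> ('a, 'b) sphere option" where
  "sphere_op X k (c, c') =
     (if kash (words (gen1 X)) k (cell_src c) = None then None
      else Some (the (cell_op X k c), the (cell_op X k c')))"

definition Sph ::
  "('a, 'b, 'i, 'd::finite) polygraph \<Rightarrow> (('a, 'b) sphere, 'i, 'd) crystal" where
  "Sph X =
     mk_crystal
       {(c, c'). c \<in> cells X \<and> c' \<in> cells X \<and>
                 cell_src c = cell_src c' \<and> cell_tgt X c = cell_tgt X c'}
       (\<lambda>(c, c'). wt (words (gen1 X)) (cell_src c))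
       (sphere_op X)"

definition crystal_cellular_extension ::
  "('i::finite, 'd::finite) km_datum \<Rightarrow> ('a, 'b, 'i, 'd) polygraph \<Rightarrow> ('a, 'b) sphere set \<Rightarrow> bool"
  where
  "crystal_cellular_extension D X \<Omega> \<longleftrightarrow> subcrystal D (Sph X) \<Omega>"

definition is_section ::
  "('a, 'b, 'i, 'd::finite) polygraph \<Rightarrow> ('a list set \<Rightarrow> 'a list) \<Rightarrow> bool" where
  "is_section X r \<longleftrightarrow>
     (\<forall>C\<in>elems (presented_monoid X). r C \<in> free_words X \<and> word_class X (r C) = C) \<and>
     r (word_class X []) = []"

definition crystal_section ::
  "('a, 'b, 'i, 'd::finite) polygraph \<Rightarrow> ('a list set \<Rightarrow> 'a list) \<Rightarrow> bool" where
  "crystal_section X r \<longleftrightarrow> is_section X r \<and> morphism (presented_monoid X) (words (gen1 X)) r"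

definition nform ::
  "('a, 'b, 'i, 'd::finite) polygraph \<Rightarrow> ('a list set \<Rightarrow> 'a list) \<Rightarrow> 'a list \<Rightarrow> 'a list" where
  "nform X r w = r (word_class X w)"

definition normalization_strategy ::
  "('a, 'b, 'i, 'd::finite) polygraph \<Rightarrow> ('a list set \<Rightarrow> 'a list) \<Rightarrow> ('a list \<Rightarrow> ('a, 'b) cell) \<Rightarrow> bool"
  where
  "normalization_strategy X r \<sigma> \<longleftrightarrow>
     (\<forall>u\<in>free_words X.
        \<sigma> u \<in> cells X \<and> cell_src (\<sigma> u) = u \<and> cell_tgt X (\<sigma> u) = nform X r u \<and>
        \<sigma> (nform X r u) = id_cell X (nform X r u))"

definition crystal_normalization_strategy ::
  "('a, 'b, 'i, 'd::finite) polygraph \<Rightarrow> ('a list set \<Rightarrow> 'a list) \<Rightarrow> ('a list \<Rightarrow> ('a, 'b) cell) \<Rightarrow> bool"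
  where
  "crystal_normalization_strategy X r \<sigma> \<longleftrightarrow>
     normalization_strategy X r \<sigma> \<and>
     (\<forall>w\<in>free_words X. \<forall>k w'. kash (words (gen1 X)) k w = Some w' \<longrightarrow>
        cell_op X k (\<sigma> w) = Some (\<sigma> w'))"

fun generating_confluence ::
  "('a, 'b, 'i, 'd::finite) polygraph \<Rightarrow> ('a list \<Rightarrow> ('a, 'b) cell) \<Rightarrow> ('a, 'b) branching \<Rightarrow>
   ('a, 'b) sphere" where
  "generating_confluence X \<sigma> (f, g) =
     (cell_comp X (step_cell X f) (\<sigma> (step_tgt X f)),
      cell_comp X (step_cell X g) (\<sigma> (step_tgt X g)))"

definition generating_confluences ::
  "('a, 'b, 'i, 'd::finite) polygraph \<Rightarrow> ('a list \<Rightarrow> ('a, 'b) cell) \<Rightarrow> ('a, 'b) sphere set" where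
  "generating_confluences X \<sigma> = generating_confluence X \<sigma> ` Crit X"

end

(*
  A Kashiwara operator changes a single letter of a word, and the factor of a concatenation in
  which this letter lies depends only on the string lengths of the factors. As the source and the
  target of a generator have the same string lengths, an operator hits corresponding factors of
  the source and of the target of every whiskered step. It is thus compatible with whiskering, with
  the exchange and inverse relations, and with Peiffer branchings, so that it acts on cells and
  preserves critical branchings; forming generating confluences commutes with it.

  Every critical branching is reached from one of highest weight because the raising operators
  terminate. In B(lambda) every element arises from a single one by lowering operators, so, the
  simple roots being linearly independent, the weight bounds the number of raising operators that
  can be applied in succession to a letter. The sum of these bounds over the letters of a word
  decreases whenever the word is raised.
*)

theory Submission
  imports Defs
begin

section \<open>Strings of Kashiwara operators\<close>

text \<open>All crystals built on words, branchings and spheres come from \<open>mk_crystal\<close>,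
  where string lengths are maxima of sets of live powers and awkward to compute. The predicate
  \<open>strings\<close> replaces them by candidate functions constrained along single operators
  only. It is equivalent to normality and passes to tensor products, images, pullbacks and unions. A
  rewriting step thus inherits its string lengths from a tensor product of words, generators and
  words; a branching or a sphere inherits them from its source word.

  A 2-cell is a congruence class of lists of signed steps, and \<open>cell_op\<close> acts on a
  chosen representative. Adjoining formal inverses to X gives another polygraph of the same kind, so
  one development of steps and composable lists, the locale \<open>kash_polygraph\<close>, serves
  both X and its signed version. What is specific to cells is that the congruence is respected.

  The construction of B(lambda) from a crystal lattice enters through a single fact: lowering
  operators reach every element from the residue of the highest weight vector.\<close>

text \<open>The local form of normality: the string lengths are constrained along single steps only.\<close>

definition strings ::
  "('i::finite, 'd::finite) km_datum \<Rightarrow> 'x set \<Rightarrow> ('x \<Rightarrow> int ^ 'd) \<Rightarrow> ('i kop \<Rightarrow> 'x \<Rightarrow> 'x option) \<Rightarrow>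
   ('i \<Rightarrow> 'x \<Rightarrow> int) \<Rightarrow> ('i \<Rightarrow> 'x \<Rightarrow> int) \<Rightarrow> bool" where
  "strings D S w g e p \<longleftrightarrow>
     (\<forall>x\<in>S. \<forall>i.
        0 \<le> e i x \<and> 0 \<le> p i x \<and> p i x - e i x = pairing (w x) (coroot D i) \<and>
        (g (E i) x = None \<longleftrightarrow> e i x = 0) \<and> (g (F i) x = None \<longleftrightarrow> p i x = 0) \<and>
        (\<forall>y. g (E i) x = Some y \<longrightarrow> y \<in> S \<and> w y = w x + root D i \<and>
           e i y = e i x - 1 \<and> p i y = p i x + 1 \<and> g (F i) y = Some x) \<and>
        (\<forall>y. g (F i) x = Some y \<longrightarrow> y \<in> S \<and> w y = w x - root D i \<and>
           e i y = e i x + 1 \<and> p i y = p i x - 1 \<and> g (E i) y = Some x))"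

lemma bind_funpow_None: "((\<lambda>z. Option.bind z (g :: 'a \<Rightarrow> 'a option)) ^^ n) None = None"
  by (induction n) auto

lemma live_powers_unfold:
  "live_powers g x = insert 0 (case g x of None \<Rightarrow> {} | Some y \<Rightarrow> Suc ` live_powers g y)"
proof -
  have 1: "iter g 0 x = Some x"
    by (simp add: iter_def)
  have 2: "iter g (Suc n) x = (case g x of None \<Rightarrow> None | Some y \<Rightarrow> iter g n y)" for n
    by (auto simp: iter_def funpow_Suc_right bind_funpow_None simp del: funpow.simps split: option.split)
  have "n \<in> live_powers g x \<longleftrightarrow>
      n \<in> insert 0 (case g x of None \<Rightarrow> {} | Some y \<Rightarrow> Suc ` live_powers g y)" for n
    by (cases n) (auto simp: live_powers_def 1 2 split: option.split)
  then show ?thesis by blast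
qed

text \<open>A nonnegative \<open>e\<close> that vanishes exactly where \<open>g\<close> is undefined
  and drops by one along \<open>g\<close> counts the remaining applications of \<open>g\<close>, by
  induction on its value. Local data thus determine the string length.\<close>

lemma live_powers_eq:
  assumes "\<And>x. x \<in> S \<Longrightarrow> 0 \<le> e x"
    and "\<And>x. x \<in> S \<Longrightarrow> g x = None \<longleftrightarrow> e x = (0::int)"
    and "\<And>x y. x \<in> S \<Longrightarrow> g x = Some y \<Longrightarrow> y \<in> S \<and> e y = e x - 1"
    and "x \<in> S"
  shows "live_powers g x = {..nat (e x)}"
  using \<open>x \<in> S\<close>
proof (induction "nat (e x)" arbitrary: x)
  case 0
  then have "g x = None" using assms(1,2)[of x] by auto
  then show ?case using 0 by (subst live_powers_unfold) auto
next
  case (Suc n)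
  then obtain y where y: "g x = Some y" using assms(2)[of x] by fastforce
  then have "y \<in> S" "e y = e x - 1" using assms(3) Suc.prems by auto
  moreover from this have "live_powers g y = {..nat (e y)}"
    using Suc.hyps by (intro Suc.hyps(1)) auto
  moreover have "n = nat (e y)" using calculation Suc.hyps(2) by auto
  ultimately show ?case
    using y Suc.hyps(2) by (subst live_powers_unfold) (simp flip: Suc.hyps(2) add: atMost_Suc_eq_insert_0)
qed

text \<open>Live exponents shift by one along \<open>g\<close>, and \<open>Max\<close> commutes with
  the monotone \<open>Suc\<close>. This recursion turns the global maxima of a normal crystal into
  the local constraints of \<open>strings\<close>.\<close>

lemma Max_live_powers:
  assumes "finite (live_powers g x)"
  shows "Max (live_powers g x) = (case g x of None \<Rightarrow> 0 | Some y \<Rightarrow> Suc (Max (live_powers g y)))"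
proof (cases "g x")
  case None
  then show ?thesis by (subst live_powers_unfold) simp
next
  case (Some y)
  then have eq: "live_powers g x = insert 0 (Suc ` live_powers g y)"
    by (subst live_powers_unfold) simp
  then have fin: "finite (live_powers g y)"
    using assms by (simp add: finite_image_iff)
  have ne: "live_powers g y \<noteq> {}"
    by (subst live_powers_unfold) simp
  have "Max (Suc ` live_powers g y) = Suc (Max (live_powers g y))"
    using fin ne by (intro mono_Max_commute[symmetric]) (auto simp: mono_def)
  then show ?thesis using Some eq fin ne by simp
qed

lemma Max_atMost_nat: "Max {..n::nat} = n"
  by (rule Max_eqI) auto

lemma stringsD:
  assumes "strings D S w g e p" "x \<in> S"
  shows "0 \<le> e i x" "0 \<le> p i x" "p i x - e i x = pairing (w x) (coroot D i)"
    and "g (E i) x = None \<longleftrightarrow> e i x = 0" "g (F i) x = None \<longleftrightarrow> p i x = 0"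
    and "g (E i) x = Some y \<Longrightarrow> y \<in> S \<and> w y = w x + root D i \<and>
           e i y = e i x - 1 \<and> p i y = p i x + 1 \<and> g (F i) y = Some x"
    and "g (F i) x = Some y \<Longrightarrow> y \<in> S \<and> w y = w x - root D i \<and>
           e i y = e i x + 1 \<and> p i y = p i x - 1 \<and> g (E i) y = Some x"
  using assms unfolding strings_def by blast+

lemma strings_live_powers:
  assumes "strings D S w g e p" "x \<in> S"
  shows "live_powers (g (E i)) x = {..nat (e i x)}" "live_powers (g (F i)) x = {..nat (p i x)}"
proof -
  note s = stringsD[OF assms(1)]
  show "live_powers (g (E i)) x = {..nat (e i x)}"
    by (rule live_powers_eq[where S = S]) (use s assms(2) in blast)+
  show "live_powers (g (F i)) x = {..nat (p i x)}"
    by (rule live_powers_eq[where S = S]) (use s assms(2) in blast)+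
qed

text \<open>All data at \<open>m x\<close> are images of the data at \<open>x\<close>, so
  \<open>m\<close> may identify elements. This matters for generating confluences, where different
  critical branchings may yield the same sphere.\<close>

lemma strings_image:
  assumes "strings D S w g e p"
    and "\<And>x. x \<in> S \<Longrightarrow> w' (m x) = w x" "\<And>x k. x \<in> S \<Longrightarrow> g' k (m x) = map_option m (g k x)"
    and "\<And>x i. x \<in> S \<Longrightarrow> e' i (m x) = e i x" "\<And>x i. x \<in> S \<Longrightarrow> p' i (m x) = p i x"
  shows "strings D (m ` S) w' g' e' p'"
  unfolding strings_def
proof (intro ballI allI)
  fix z i assume "z \<in> m ` S"
  then obtain x where x: "x \<in> S" and z: "z = m x" by blast
  note s = stringsD[OF assms(1) x, of i]
  show "0 \<le> e' i z \<and> 0 \<le> p' i z \<and> p' i z - e' i z = pairing (w' z) (coroot D i) \<and>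
        (g' (E i) z = None \<longleftrightarrow> e' i z = 0) \<and> (g' (F i) z = None \<longleftrightarrow> p' i z = 0) \<and>
        (\<forall>y. g' (E i) z = Some y \<longrightarrow> y \<in> m ` S \<and> w' y = w' z + root D i \<and>
           e' i y = e' i z - 1 \<and> p' i y = p' i z + 1 \<and> g' (F i) y = Some z) \<and>
        (\<forall>y. g' (F i) z = Some y \<longrightarrow> y \<in> m ` S \<and> w' y = w' z - root D i \<and>
           e' i y = e' i z + 1 \<and> p' i y = p' i z - 1 \<and> g' (E i) y = Some z)"
    unfolding z assms(2-5)[OF x]
  proof (intro conjI allI impI)
    fix y
    { assume "map_option m (g (E i) x) = Some y"
      then obtain x' where x': "g (E i) x = Some x'" and y: "y = m x'" by auto
      note sx = s(6)[OF x']
      then show "y \<in> m ` S" "w' y = w x + root D i" "e' i y = e i x - 1" "p' i y = p i x + 1"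
        "g' (F i) y = Some (m x)"
        using assms(2-5)[of x'] y by simp_all }
    { assume "map_option m (g (F i) x) = Some y"
      then obtain x' where x': "g (F i) x = Some x'" and y: "y = m x'" by auto
      note sx = s(7)[OF x']
      then show "y \<in> m ` S" "w' y = w x - root D i" "e' i y = e i x + 1" "p' i y = p i x - 1"
        "g' (E i) y = Some (m x)"
        using assms(2-5)[of x'] y by simp_all }
  qed (use s in simp_all)
qed

lemma strings_cong:
  assumes "strings D S w g e p"
    and "\<And>x. x \<in> S \<Longrightarrow> w' x = w x" "\<And>x k. x \<in> S \<Longrightarrow> g' k x = g k x"
    and "\<And>x i. x \<in> S \<Longrightarrow> e' i x = e i x" "\<And>x i. x \<in> S \<Longrightarrow> p' i x = p i x"
  shows "strings D S w' g' e' p'"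
  using strings_image[OF assms(1), where m = "\<lambda>x. x"] assms(2-5) by (simp add: option.map_ident)

text \<open>Each constraint concerns one element and its neighbours, and these lie in the same
  member of \<open>A\<close>.\<close>

lemma strings_Union:
  assumes "\<And>T. T \<in> A \<Longrightarrow> strings D T w g e p"
  shows "strings D (\<Union>A) w g e p"
  unfolding strings_def
proof (intro ballI allI)
  fix x i assume "x \<in> \<Union>A"
  then obtain T where T: "T \<in> A" "x \<in> T" by blast
  note s = stringsD[OF assms[OF T(1)] T(2), of i]
  have "y \<in> \<Union>A" if "y \<in> T" for y using that T(1) by blast
  with s show "0 \<le> e i x \<and> 0 \<le> p i x \<and> p i x - e i x = pairing (w x) (coroot D i) \<and>
        (g (E i) x = None \<longleftrightarrow> e i x = 0) \<and> (g (F i) x = None \<longleftrightarrow> p i x = 0) \<and>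
        (\<forall>y. g (E i) x = Some y \<longrightarrow> y \<in> \<Union>A \<and> w y = w x + root D i \<and>
           e i y = e i x - 1 \<and> p i y = p i x + 1 \<and> g (F i) y = Some x) \<and>
        (\<forall>y. g (F i) x = Some y \<longrightarrow> y \<in> \<Union>A \<and> w y = w x - root D i \<and>
           e i y = e i x + 1 \<and> p i y = p i x - 1 \<and> g (E i) y = Some x)"
    by presburger
qed

lemma strings_mk_crystal:
  assumes "strings D S w g e p" "x \<in> S"
  shows "eps (mk_crystal S w g) i x = e i x" "phi (mk_crystal S w g) i x = p i x"
  using strings_live_powers[OF assms] stringsD(1,2)[OF assms] by (auto simp: mk_crystal_def Max_atMost_nat)

lemma strings_normal:
  assumes "strings D (elems \<Gamma>) (wt \<Gamma>) (kash \<Gamma>) (eps \<Gamma>) (phi \<Gamma>)"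
  shows "normal_crystal D \<Gamma>"
  unfolding normal_crystal_def
proof (intro ballI conjI)
  fix x assume x: "x \<in> elems \<Gamma>"
  note a = stringsD[OF assms x]
  show "\<forall>k y. kash \<Gamma> k x = Some y \<longrightarrow> y \<in> elems \<Gamma>"
  proof (intro allI impI)
    fix k y assume "kash \<Gamma> k x = Some y"
    then show "y \<in> elems \<Gamma>" using a by (cases k) auto
  qed
  show "\<forall>i. phi \<Gamma> i x - eps \<Gamma> i x = pairing (wt \<Gamma> x) (coroot D i)" using a by blast
  show "\<forall>i. finite (live_powers (kash \<Gamma> (E i)) x) \<and>
             eps \<Gamma> i x = int (Max (live_powers (kash \<Gamma> (E i)) x))"
    using a by (simp add: strings_live_powers[OF assms x] Max_atMost_nat)
  show "\<forall>i. finite (live_powers (kash \<Gamma> (F i)) x) \<and>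
             phi \<Gamma> i x = int (Max (live_powers (kash \<Gamma> (F i)) x))"
    using a by (simp add: strings_live_powers[OF assms x] Max_atMost_nat)
  show "\<forall>i y. kash \<Gamma> (E i) x = Some y \<longrightarrow> wt \<Gamma> y = wt \<Gamma> x + root D i" using a by blast
  show "\<forall>i y. kash \<Gamma> (F i) x = Some y \<longrightarrow> wt \<Gamma> y = wt \<Gamma> x - root D i" using a by blast
  show "\<forall>i. \<forall>x'\<in>elems \<Gamma>. kash \<Gamma> (E i) x = Some x' \<longleftrightarrow> kash \<Gamma> (F i) x' = Some x"
    using stringsD(6,7)[OF assms] x by blast
qed

lemma strings_mk_crystal_normal:
  assumes "strings D S w g e p"
  shows "normal_crystal D (mk_crystal S w g)"
proof (rule strings_normal)
  have "strings D S w g (eps (mk_crystal S w g)) (phi (mk_crystal S w g))"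
    by (rule strings_cong[OF assms]) (auto simp: strings_mk_crystal[OF assms])
  then show "strings D (elems (mk_crystal S w g)) (wt (mk_crystal S w g)) (kash (mk_crystal S w g))
      (eps (mk_crystal S w g)) (phi (mk_crystal S w g))"
    by (simp add: mk_crystal_def)
qed

text \<open>The recursion for maxima gives the change of \<epsilon> along \<open>E i\<close> and of
  \<phi> along \<open>F i\<close> directly. The change of the other length is read from the
  recursion at the new element \<open>y\<close>, where the opposite operator leads back to
  \<open>x\<close>.\<close>

lemma normal_strings:
  assumes "normal_crystal D \<Gamma>"
  shows "strings D (elems \<Gamma>) (wt \<Gamma>) (kash \<Gamma>) (eps \<Gamma>) (phi \<Gamma>)"
proof -
  have eps: "eps \<Gamma> i x = (case kash \<Gamma> (E i) x of None \<Rightarrow> 0 | Some y \<Rightarrow> eps \<Gamma> i y + 1)"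
    and phi: "phi \<Gamma> i x = (case kash \<Gamma> (F i) x of None \<Rightarrow> 0 | Some y \<Rightarrow> phi \<Gamma> i y + 1)"
    and inv: "\<And>y. kash \<Gamma> (E i) x = Some y \<Longrightarrow> kash \<Gamma> (F i) y = Some x"
      "\<And>y. kash \<Gamma> (F i) x = Some y \<Longrightarrow> kash \<Gamma> (E i) y = Some x"
    and closed: "\<And>k y. kash \<Gamma> k x = Some y \<Longrightarrow> y \<in> elems \<Gamma>"
    and nonneg: "0 \<le> eps \<Gamma> i x" "0 \<le> phi \<Gamma> i x"
    if x: "x \<in> elems \<Gamma>" for i x
  proof -
    note a = assms[unfolded normal_crystal_def, rule_format]
    show closed: "\<And>k y. kash \<Gamma> k x = Some y \<Longrightarrow> y \<in> elems \<Gamma>" using a x by blast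
    have e: "finite (live_powers (kash \<Gamma> (E i)) y)"
        "eps \<Gamma> i y = int (Max (live_powers (kash \<Gamma> (E i)) y))"
      and p: "finite (live_powers (kash \<Gamma> (F i)) y)"
        "phi \<Gamma> i y = int (Max (live_powers (kash \<Gamma> (F i)) y))" if "y \<in> elems \<Gamma>" for y
      using a that by blast+
    show "0 \<le> eps \<Gamma> i x" "0 \<le> phi \<Gamma> i x" using e p x by auto
    show "eps \<Gamma> i x = (case kash \<Gamma> (E i) x of None \<Rightarrow> 0 | Some y \<Rightarrow> eps \<Gamma> i y + 1)"
      using e(2)[OF x] Max_live_powers[OF e(1)[OF x]] e(2)[OF closed] by (auto split: option.split)
    show "phi \<Gamma> i x = (case kash \<Gamma> (F i) x of None \<Rightarrow> 0 | Some y \<Rightarrow> phi \<Gamma> i y + 1)"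
      using p(2)[OF x] Max_live_powers[OF p(1)[OF x]] p(2)[OF closed] by (auto split: option.split)
    show "kash \<Gamma> (F i) y = Some x" if "kash \<Gamma> (E i) x = Some y" for y
      using a x closed that by blast
    show "kash \<Gamma> (E i) y = Some x" if "kash \<Gamma> (F i) x = Some y" for y
      using a x closed that by blast
  qed
  show ?thesis
    unfolding strings_def
  proof (intro ballI allI conjI impI)
    fix x i assume x: "x \<in> elems \<Gamma>"
    show "phi \<Gamma> i x - eps \<Gamma> i x = pairing (wt \<Gamma> x) (coroot D i)"
      using assms x by (auto simp: normal_crystal_def)
    show "0 \<le> eps \<Gamma> i x" "0 \<le> phi \<Gamma> i x" using nonneg[OF x] by auto
    show "kash \<Gamma> (E i) x = None \<longleftrightarrow> eps \<Gamma> i x = 0"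
      using eps[OF x, of i] closed[OF x] nonneg(1)[where i = i] by (fastforce split: option.splits)
    show "kash \<Gamma> (F i) x = None \<longleftrightarrow> phi \<Gamma> i x = 0"
      using phi[OF x, of i] closed[OF x] nonneg(2)[where i = i] by (fastforce split: option.splits)
    { fix y assume y: "kash \<Gamma> (E i) x = Some y"
      show y': "y \<in> elems \<Gamma>" using closed x y by blast
      show yx: "kash \<Gamma> (F i) y = Some x" using inv(1) x y by blast
      show "wt \<Gamma> y = wt \<Gamma> x + root D i" using assms x y by (auto simp: normal_crystal_def)
      show "eps \<Gamma> i y = eps \<Gamma> i x - 1" using eps[OF x, of i] y by simp
      show "phi \<Gamma> i y = phi \<Gamma> i x + 1" using phi[OF y', of i] yx by simp }
    { fix y assume y: "kash \<Gamma> (F i) x = Some y"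
      show y': "y \<in> elems \<Gamma>" using closed x y by blast
      show yx: "kash \<Gamma> (E i) y = Some x" using inv(2) x y by blast
      show "wt \<Gamma> y = wt \<Gamma> x - root D i" using assms x y by (auto simp: normal_crystal_def)
      show "phi \<Gamma> i y = phi \<Gamma> i x - 1" using phi[OF x, of i] y by simp
      show "eps \<Gamma> i y = eps \<Gamma> i x + 1" using eps[OF y', of i] yx by simp }
  qed
qed

fun inv_kop :: "'i kop \<Rightarrow> 'i kop" where
  "inv_kop (E i) = F i"
| "inv_kop (F i) = E i"

section \<open>Words\<close>

text \<open>\<open>lands k m n\<close> says that \<open>k\<close> acts on the left factor of a tensor whose left and right factors
  have string lengths \<open>\<phi> = m\<close> and \<open>\<epsilon> = n\<close>.\<close>

primrec kop_index :: "'i kop \<Rightarrow> 'i" where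
  "kop_index (E i) = i"
| "kop_index (F i) = i"

fun lands :: "'i kop \<Rightarrow> int \<Rightarrow> int \<Rightarrow> bool" where
  "lands (E i) m n \<longleftrightarrow> m \<ge> n"
| "lands (F i) m n \<longleftrightarrow> m > n"

context
  fixes G :: "('x, 'i::finite, 'd::finite) crystal"
begin

primrec word_wt :: "'x list \<Rightarrow> int ^ 'd" where
  "word_wt [] = 0"
| "word_wt (x # w) = wt G x + word_wt w"

text \<open>In a normal crystal, \<phi> minus \<epsilon> of the letter \<open>x\<close> is the
  pairing of its weight with the coroot, so this is the usual tensor product formula: the maximum of
  \<epsilon> of \<open>x\<close> and of \<epsilon> of \<open>w\<close> minus that pairing.\<close>

primrec word_eps :: "'i \<Rightarrow> 'x list \<Rightarrow> int" where
  "word_eps i [] = 0"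
| "word_eps i (x # w) = eps G i x + max 0 (word_eps i w - phi G i x)"

primrec word_phi :: "'i \<Rightarrow> 'x list \<Rightarrow> int" where
  "word_phi i [] = 0"
| "word_phi i (x # w) = word_phi i w + max 0 (phi G i x - word_eps i w)"

primrec word_op :: "'i kop \<Rightarrow> 'x list \<Rightarrow> 'x list option" where
  "word_op k [] = None"
| "word_op k (x # w) =
     (if lands k (phi G (kop_index k) x) (word_eps (kop_index k) w)
      then map_option (\<lambda>x'. x' # w) (kash G k x)
      else map_option (\<lambda>w'. x # w') (word_op k w))"

end

lemma pairing_add: "pairing (a + b) h = pairing a h + pairing b h"
  by (simp add: pairing_def algebra_simps sum.distrib)

text \<open>The raising rule uses a weak and the lowering rule a strict inequality, and this makes
  them inverse to each other. Raising the left factor increases its \<phi>, so the weak inequality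
  becomes strict and the lowering operator returns to the left. Raising the right factor decreases
  its \<epsilon> by one, which stays at least \<phi> of the left factor, so the lowering operator
  returns to the right. Lowering is symmetric.\<close>

lemma strings_tensor:
  assumes "strings D S w g e p" "strings D T w' g' e' p'"
  shows "strings D (S \<times> T) (\<lambda>(u, v). w u + w' v)
    (\<lambda>k (u, v). if lands k (p (kop_index k) u) (e' (kop_index k) v)
       then map_option (\<lambda>u'. (u', v)) (g k u) else map_option (\<lambda>v'. (u, v')) (g' k v))
    (\<lambda>i (u, v). e i u + max 0 (e' i v - p i u)) (\<lambda>i (u, v). p' i v + max 0 (p i u - e' i v))"
  (is "strings D _ _ ?g _ _")
  unfolding strings_def
proof (intro ballI allI conjI impI)
  fix x i assume "x \<in> S \<times> T"
  then obtain u v where x: "x = (u, v)" "u \<in> S" "v \<in> T" by blast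
  note a = stringsD[OF assms(1) x(2), of i] stringsD[OF assms(2) x(3), of i]
  let ?e = "\<lambda>i (u, v). e i u + max 0 (e' i v - p i u)"
  let ?p = "\<lambda>i (u, v). p' i v + max 0 (p i u - e' i v)"
  show "0 \<le> ?e i x" "0 \<le> ?p i x"
    using a(1,2,8,9) x by auto
  show "?p i x - ?e i x = pairing (case x of (u, v) \<Rightarrow> w u + w' v) (coroot D i)"
    using a(3,10) x by (simp add: pairing_add max_def)
  show "?g (E i) x = None \<longleftrightarrow> ?e i x = 0"
    using a(1,2,4,8,9,11) x by (cases "e' i v \<le> p i u") auto
  show "?g (F i) x = None \<longleftrightarrow> ?p i x = 0"
    using a(1,2,5,8,9,12) x by (cases "e' i v < p i u") auto
  { fix y assume y: "?g (E i) x = Some y"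
    have "y \<in> S \<times> T \<and> (case y of (u, v) \<Rightarrow> w u + w' v) = (case x of (u, v) \<Rightarrow> w u + w' v) + root D i \<and>
        ?e i y = ?e i x - 1 \<and> ?p i y = ?p i x + 1 \<and> ?g (F i) y = Some x"
    proof (cases "e' i v \<le> p i u")
      case True
      then obtain u' where z: "g (E i) u = Some u'" "y = (u', v)" using x y by auto
      then show ?thesis using a(6)[OF z(1)] x True by simp
    next
      case False
      then obtain v' where z: "g' (E i) v = Some v'" "y = (u, v')" using x y by auto
      then show ?thesis using a(13)[OF z(1)] x False by simp
    qed
    then show "y \<in> S \<times> T" "(case y of (u, v) \<Rightarrow> w u + w' v) = (case x of (u, v) \<Rightarrow> w u + w' v) + root D i"
      "?e i y = ?e i x - 1" "?p i y = ?p i x + 1" "?g (F i) y = Some x"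
      by blast+ }
  { fix y assume y: "?g (F i) x = Some y"
    have "y \<in> S \<times> T \<and> (case y of (u, v) \<Rightarrow> w u + w' v) = (case x of (u, v) \<Rightarrow> w u + w' v) - root D i \<and>
        ?e i y = ?e i x + 1 \<and> ?p i y = ?p i x - 1 \<and> ?g (E i) y = Some x"
    proof (cases "e' i v < p i u")
      case True
      then obtain u' where z: "g (F i) u = Some u'" "y = (u', v)" using x y by auto
      then show ?thesis using a(7)[OF z(1)] x True by simp
    next
      case False
      then obtain v' where z: "g' (F i) v = Some v'" "y = (u, v')" using x y by auto
      then show ?thesis using a(14)[OF z(1)] x False by simp
    qed
    then show "y \<in> S \<times> T" "(case y of (u, v) \<Rightarrow> w u + w' v) = (case x of (u, v) \<Rightarrow> w u + w' v) - root D i"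
      "?e i y = ?e i x + 1" "?p i y = ?p i x - 1" "?g (E i) y = Some x"
      by blast+ }
qed


lemma strings_op:
  assumes "strings D S w g e p" "x \<in> S" "g k x = Some y"
  shows "y \<in> S" "g (inv_kop k) y = Some x"
  using stringsD(6,7)[OF assms(1,2)] assms(3) by (cases k; simp)+

lemma strings_len:
  assumes "strings D S w g e p" "x \<in> S" "g k x = Some y"
  shows "e (kop_index k) y = (case k of E i \<Rightarrow> e i x - 1 | F i \<Rightarrow> e i x + 1)"
    "p (kop_index k) y = (case k of E i \<Rightarrow> p i x + 1 | F i \<Rightarrow> p i x - 1)"
  using stringsD(6,7)[OF assms(1,2)] assms(3) by (cases k; simp)+

definition words_of_len :: "('x, 'i, 'd::finite) crystal \<Rightarrow> nat \<Rightarrow> 'x list set" where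
  "words_of_len G n = {w. set w \<subseteq> elems G \<and> length w = n}"

lemma words_of_len_Suc: "words_of_len G (Suc n) = (\<lambda>(x, w). x # w) ` (elems G \<times> words_of_len G n)"
  by (force simp: words_of_len_def length_Suc_conv)

lemma strings_words_of_len:
  assumes "normal_crystal D G"
  shows "strings D (words_of_len G n) (word_wt G) (word_op G) (word_eps G) (word_phi G)"
proof (induction n)
  case 0
  then show ?case by (simp add: strings_def words_of_len_def pairing_def)
next
  case (Suc n)
  show ?case
    unfolding words_of_len_Suc
    by (rule strings_image[OF strings_tensor[OF normal_strings[OF assms] Suc.IH]])
      (auto simp: option.map_comp o_def)
qed

lemma strings_words:
  assumes "normal_crystal D G"
  shows "strings D (lists (elems G)) (word_wt G) (word_op G) (word_eps G) (word_phi G)"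
proof -
  have "lists (elems G) = (\<Union>n. words_of_len G n)"
    by (auto simp: words_of_len_def)
  then show ?thesis
    by (auto intro!: strings_Union strings_words_of_len[OF assms])
qed

text \<open>The four claims are proved together: the operators on the next tensor power consult
  \<open>eps\<close> of the present one, which is a maximum of live powers. It is identified with
  the closed form \<open>word_eps\<close> once the operators are known, since words of a fixed
  length satisfy \<open>strings\<close>.\<close>

lemma tensor_power_eq:
  assumes "normal_crystal D G"
  shows "elems (tensor_power G n) = words_of_len G n"
    and "w \<in> words_of_len G n \<Longrightarrow> wt (tensor_power G n) w = word_wt G w"
    and "w \<in> words_of_len G n \<Longrightarrow> kash (tensor_power G n) k w = word_op G k w"
    and "w \<in> words_of_len G n \<Longrightarrow> eps (tensor_power G n) i w = word_eps G i w"
proof (induction n arbitrary: w k i)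
  case 0
  have s: "strings D {[]} (\<lambda>_. 0) (\<lambda>_ _. None) (word_eps G) (word_phi G)"
    by (simp add: strings_def pairing_def)
  { case 1 show ?case by (auto simp: mk_crystal_def words_of_len_def) }
  { case 2 then show ?case by (simp add: mk_crystal_def words_of_len_def) }
  { case 3 then show ?case by (simp add: mk_crystal_def words_of_len_def) }
  { case 4 then show ?case using strings_mk_crystal(1)[OF s, of w i] by (simp add: words_of_len_def) }
next
  case (Suc n)
  { case 1
    show ?case
      by (simp add: words_of_len_Suc Let_def tensor_def mk_crystal_def Suc.IH(1)) }
  { case (2 w)
    then show ?case
      by (auto simp: words_of_len_Suc Let_def tensor_def mk_crystal_def Suc.IH(2)) }
  have kash: "kash (tensor_power G (Suc n)) k w = word_op G k w" if "w \<in> words_of_len G (Suc n)" for k w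
  proof -
    from that obtain x v where w: "w = x # v" "v \<in> words_of_len G n"
      by (auto simp: words_of_len_Suc)
    then show ?thesis
      by (cases k) (simp_all add: Let_def tensor_def mk_crystal_def tensor_op_def Suc.IH(3,4)
          option.map_comp o_def)
  qed
  { case (3 w k) then show ?case by (rule kash) }
  { case (4 w i)
    have "strings D (words_of_len G (Suc n)) (word_wt G) (\<lambda>k w. kash (tensor_power G (Suc n)) k w)
        (word_eps G) (word_phi G)"
      by (rule strings_cong[OF strings_words_of_len[OF assms]]) (simp_all add: kash del: tensor_power.simps)
    from strings_live_powers(1)[OF this 4, of i] stringsD(1)[OF this 4, of i]
    have "int (Max (live_powers (kash (tensor_power G (Suc n)) (E i)) w)) = word_eps G i w"
      by (simp add: Max_atMost_nat del: tensor_power.simps)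
    then show ?case by (simp add: Let_def mk_crystal_def) }
qed

lemma words_eq:
  assumes "normal_crystal D G"
  shows "elems (words G) = lists (elems G)"
    and "w \<in> lists (elems G) \<Longrightarrow> wt (words G) w = word_wt G w"
    and "w \<in> lists (elems G) \<Longrightarrow> kash (words G) k w = word_op G k w"
    and "w \<in> lists (elems G) \<Longrightarrow> eps (words G) i w = word_eps G i w"
    and "w \<in> lists (elems G) \<Longrightarrow> phi (words G) i w = word_phi G i w"
proof -
  have len: "w \<in> words_of_len G (length w)" if "w \<in> lists (elems G)" for w
    using that by (auto simp: words_of_len_def)
  have el: "(\<Union>n. elems (tensor_power G n)) = lists (elems G)"
    by (auto simp: tensor_power_eq[OF assms] words_of_len_def)
  have s: "strings D (lists (elems G)) (\<lambda>w. wt (tensor_power G (length w)) w)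
      (\<lambda>k w. kash (tensor_power G (length w)) k w) (word_eps G) (word_phi G)"
    by (rule strings_cong[OF strings_words[OF assms]]) (simp_all add: tensor_power_eq[OF assms] len)
  show "elems (words G) = lists (elems G)"
    by (simp add: words_def mk_crystal_def el)
  assume w: "w \<in> lists (elems G)"
  show "wt (words G) w = word_wt G w" "kash (words G) k w = word_op G k w"
    using tensor_power_eq(2,3)[OF assms len[OF w]] by (simp_all add: words_def mk_crystal_def)
  show "eps (words G) i w = word_eps G i w" "phi (words G) i w = word_phi G i w"
    unfolding words_def el by (rule strings_mk_crystal[OF s w])+
qed

text \<open>This is associativity of the tensor product: \<open>word_op\<close> cuts a word after
  its first letter, and the same rule is obtained for a cut at any place. Induction on
  \<open>u\<close> compares the two bracketings, and the nonnegativity of the lengths settles the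
  inequalities between maxima.\<close>

lemma word_append:
  fixes u v :: "'a list"
  assumes "normal_crystal D G" "set u \<subseteq> elems G" "set v \<subseteq> elems G"
  shows "word_eps G i (u @ v) = word_eps G i u + max 0 (word_eps G i v - word_phi G i u)"
    and "word_phi G i (u @ v) = word_phi G i v + max 0 (word_phi G i u - word_eps G i v)"
    and "word_wt G (u @ v) = word_wt G u + word_wt G v"
    and "word_op G k (u @ v) =
      (if lands k (word_phi G (kop_index k) u) (word_eps G (kop_index k) v)
       then map_option (\<lambda>u'. u' @ v) (word_op G k u) else map_option (\<lambda>v'. u @ v') (word_op G k v))"
proof -
  note s = strings_words[OF assms(1)]
  have v: "v \<in> lists (elems G)" using assms(3) by auto
  have nonneg: "0 \<le> word_eps G i v" "0 \<le> word_phi G i v" for i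
    using stringsD(1,2)[OF s v] .
  have main: "(\<forall>i. word_eps G i (u @ v) = word_eps G i u + max 0 (word_eps G i v - word_phi G i u) \<and>
      word_phi G i (u @ v) = word_phi G i v + max 0 (word_phi G i u - word_eps G i v)) \<and>
    word_wt G (u @ v) = word_wt G u + word_wt G v \<and>
    (\<forall>k. word_op G k (u @ v) =
      (if lands k (word_phi G (kop_index k) u) (word_eps G (kop_index k) v)
       then map_option (\<lambda>u'. u' @ v) (word_op G k u) else map_option (\<lambda>v'. u @ v') (word_op G k v)))"
    using assms(2)
  proof (induction u)
    case Nil
    \<comment> \<open>An empty left factor has both lengths 0. If a raising operator lands on it,
      then \<epsilon> of \<open>v\<close> is 0 and \<open>v\<close> is killed as well; a lowering
      operator cannot land on it.\<close>
    have "word_op G k v = None" if "lands k 0 (word_eps G (kop_index k) v)" for k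
    proof (cases k)
      case (E i)
      then show ?thesis using that nonneg(1)[of i] stringsD(4)[OF s v, of i] by simp
    next
      case (F i)
      then show ?thesis using that nonneg(1)[of i] by simp
    qed
    moreover have "(@) [] = (\<lambda>v'. v' :: 'a list)" by auto
    ultimately show ?case using nonneg by (simp add: max_def antisym option.map_ident)
  next
    case (Cons x u)
    then have IH: "word_eps G i (u @ v) = word_eps G i u + max 0 (word_eps G i v - word_phi G i u)"
      "word_phi G i (u @ v) = word_phi G i v + max 0 (word_phi G i u - word_eps G i v)"
      "word_wt G (u @ v) = word_wt G u + word_wt G v"
      "word_op G k (u @ v) =
        (if lands k (word_phi G (kop_index k) u) (word_eps G (kop_index k) v)
         then map_option (\<lambda>u'. u' @ v) (word_op G k u)
         else map_option (\<lambda>v'. u @ v') (word_op G k v))" for i k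
      by auto
    have x: "x \<in> elems G" and u: "u \<in> lists (elems G)" using Cons.prems by auto
    have nx: "0 \<le> eps G i x" "0 \<le> phi G i x" "0 \<le> word_eps G i u" "0 \<le> word_phi G i u" for i
      using stringsD(1,2)[OF normal_strings[OF assms(1)] x] stringsD(1,2)[OF s u] by auto
    have op: "word_op G k ((x # u) @ v) =
      (if lands k (word_phi G (kop_index k) (x # u)) (word_eps G (kop_index k) v)
       then map_option (\<lambda>u'. u' @ v) (word_op G k (x # u))
       else map_option (\<lambda>v'. (x # u) @ v') (word_op G k v))" for k
    proof (cases k)
      case (E i)
      then show ?thesis using nx[of i] nonneg[of i]
        by (auto simp: IH option.map_comp o_def max_def split: if_splits)
    next
      case (F i)
      then show ?thesis using nx[of i] nonneg[of i]
        by (auto simp: IH option.map_comp o_def max_def split: if_splits)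
    qed
    have ep: "word_eps G i ((x # u) @ v) = word_eps G i (x # u) + max 0 (word_eps G i v - word_phi G i (x # u))"
      "word_phi G i ((x # u) @ v) = word_phi G i v + max 0 (word_phi G i (x # u) - word_eps G i v)" for i
      using nx[of i] nonneg[of i] by (simp_all add: IH max_def)
    show ?case using op ep by (simp add: IH(3) add.assoc)
  qed
  then show "word_eps G i (u @ v) = word_eps G i u + max 0 (word_eps G i v - word_phi G i u)"
    "word_phi G i (u @ v) = word_phi G i v + max 0 (word_phi G i u - word_eps G i v)"
    "word_wt G (u @ v) = word_wt G u + word_wt G v"
    "word_op G k (u @ v) =
      (if lands k (word_phi G (kop_index k) u) (word_eps G (kop_index k) v)
       then map_option (\<lambda>u'. u' @ v) (word_op G k u) else map_option (\<lambda>v'. u @ v') (word_op G k v))"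
    by blast+
qed

section \<open>Rewriting steps\<close>

lemma word_op_length: "word_op G k u = Some u' \<Longrightarrow> length u' = length u"
  by (induction u arbitrary: u') (auto split: if_splits)

text \<open>The assumptions are exactly those inherited by the polygraph with formal inverses, so
  that every result on steps and composable lists can be instantiated a second time with signed
  generators.\<close>

locale kash_polygraph =
  fixes D :: "('i::finite, 'd::finite) km_datum" and X :: "('a, 'b, 'i, 'd) polygraph"
  assumes normal1: "normal_crystal D (gen1 X)" and normal2: "normal_crystal D (gen2 X)"
    and src_morphism: "morphism (gen2 X) (words (gen1 X)) (src X)"
    and tgt_morphism: "morphism (gen2 X) (words (gen1 X)) (tgt X)"
begin

definition "W = lists (elems (gen1 X))"
abbreviation "op \<equiv> word_op (gen1 X)"
abbreviation "A \<equiv> elems (gen2 X)"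

section \<open>Where an operator lands in a concatenation\<close>

definition left :: "'i kop \<Rightarrow> 'a list \<Rightarrow> 'a list \<Rightarrow> bool" where
  "left k u v \<longleftrightarrow> lands k (word_phi (gen1 X) (kop_index k) u) (word_eps (gen1 X) (kop_index k) v)"

definition same_len :: "'a list \<Rightarrow> 'a list \<Rightarrow> bool" where
  "same_len u u' \<longleftrightarrow> (\<forall>i. word_eps (gen1 X) i u = word_eps (gen1 X) i u' \<and>
     word_phi (gen1 X) i u = word_phi (gen1 X) i u')"

lemma Nil_W [simp]: "[] \<in> W"
  and append_W [simp]: "u @ v \<in> W \<longleftrightarrow> u \<in> W \<and> v \<in> W"
  and W_subset: "u \<in> W \<longleftrightarrow> set u \<subseteq> elems (gen1 X)"
  by (auto simp: W_def)

lemmas word_strings = strings_words[OF normal1, folded W_def]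
lemmas words_eq_W = words_eq[OF normal1, folded W_def]
lemmas gen2_strings = normal_strings[OF normal2]

lemma free_words_eq: "free_words X = W"
  by (simp add: free_words_def words_eq_W)

lemma words_op: "u \<in> W \<Longrightarrow> kash (words (gen1 X)) k u = op k u"
  by (rule words_eq_W(3))

lemma op_closed: "u \<in> W \<Longrightarrow> op k u = Some u' \<Longrightarrow> u' \<in> W"
  by (rule strings_op(1)[OF word_strings])

lemma word_nonneg:
  assumes "u \<in> W" shows "0 \<le> word_eps (gen1 X) i u" "0 \<le> word_phi (gen1 X) i u"
  using stringsD(1,2)[OF word_strings assms] .

lemma word_lengths_append:
  assumes "u \<in> W" "v \<in> W"
  shows "word_eps (gen1 X) i (u @ v) =
      word_eps (gen1 X) i u + max 0 (word_eps (gen1 X) i v - word_phi (gen1 X) i u)"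
    and "word_phi (gen1 X) i (u @ v) =
      word_phi (gen1 X) i v + max 0 (word_phi (gen1 X) i u - word_eps (gen1 X) i v)"
    and "word_wt (gen1 X) (u @ v) = word_wt (gen1 X) u + word_wt (gen1 X) v"
  using word_append(1-3)[OF normal1] assms by (auto simp: W_subset)

lemma op_append:
  assumes "u \<in> W" "v \<in> W"
  shows "op k (u @ v) = (if left k u v then map_option (\<lambda>u'. u' @ v) (op k u)
    else map_option (\<lambda>v'. u @ v') (op k v))"
  using word_append(4)[OF normal1] assms by (auto simp: left_def W_subset)

text \<open>Together with the next lemma, this compares the two bracketings of a word with three
  factors: the factor on which \<open>k\<close> lands does not depend on the bracketing. Both reduce
  to inequalities between maxima of nonnegative lengths.\<close>

lemma left_append_right:
  assumes "u \<in> W" "v \<in> W" "w \<in> W"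
  shows "left k u (v @ w) \<longleftrightarrow> left k (u @ v) w \<and> left k u v"
proof -
  define i where "i = kop_index k"
  show ?thesis
    using assms word_nonneg[OF assms(1), of i] word_nonneg[OF assms(2), of i] word_nonneg[OF assms(3), of i]
    by (cases k) (auto simp: left_def i_def word_lengths_append max_def)
qed

lemma left_append_left:
  assumes "u \<in> W" "v \<in> W" "w \<in> W"
  shows "left k (u @ v) w \<longleftrightarrow> left k u (v @ w) \<or> left k v w"
proof -
  define i where "i = kop_index k"
  show ?thesis
    using assms word_nonneg[OF assms(1), of i] word_nonneg[OF assms(2), of i] word_nonneg[OF assms(3), of i]
    by (cases k) (auto simp: left_def i_def word_lengths_append max_def)
qed

text \<open>Both lengths of the empty word are 0, so an operator can land there only if the length
  that controls it on the other factor is 0 too. Empty whiskers can therefore be ignored whenever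
  the operator does not vanish.\<close>

lemma left_Nil:
  assumes "u \<in> W"
  shows "left k [] u \<Longrightarrow> op k u = None" "\<not> left k u [] \<Longrightarrow> op k u = None"
  using word_nonneg[OF assms, of "kop_index k"] stringsD(4,5)[OF word_strings assms, of "kop_index k"]
  by (cases k; simp add: left_def)+

lemma same_len_refl [simp]: "same_len u u"
  by (simp add: same_len_def)

lemma same_len_append:
  assumes "same_len u u'" "same_len v v'" "u \<in> W" "u' \<in> W" "v \<in> W" "v' \<in> W"
  shows "same_len (u @ v) (u' @ v')"
  using assms by (simp add: same_len_def word_lengths_append)

lemma same_len_left: "same_len u u' \<Longrightarrow> same_len v v' \<Longrightarrow> left k u v \<longleftrightarrow> left k u' v'"
  by (simp add: same_len_def left_def)

lemma same_len_op:
  assumes "same_len u u'" "u \<in> W" "u' \<in> W"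
  shows "op k u = None \<longleftrightarrow> op k u' = None"
  using stringsD(4,5)[OF word_strings assms(2), of "kop_index k"]
    stringsD(4,5)[OF word_strings assms(3), of "kop_index k"] assms(1)
  by (cases k) (simp_all add: same_len_def)

lemma src_tgt:
  assumes "\<alpha> \<in> A"
  shows "src X \<alpha> \<in> W" "tgt X \<alpha> \<in> W"
    and "op k (src X \<alpha>) = map_option (src X) (kash (gen2 X) k \<alpha>)"
    and "op k (tgt X \<alpha>) = map_option (tgt X) (kash (gen2 X) k \<alpha>)"
    and "same_len (src X \<alpha>) (tgt X \<alpha>)"
    and "word_eps (gen1 X) i (src X \<alpha>) = eps (gen2 X) i \<alpha>"
    and "word_phi (gen1 X) i (src X \<alpha>) = phi (gen2 X) i \<alpha>"
    and "word_wt (gen1 X) (src X \<alpha>) = wt (gen2 X) \<alpha>"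
proof -
  have s: "src X \<alpha> \<in> W" and t: "tgt X \<alpha> \<in> W"
    using assms src_morphism tgt_morphism by (auto simp: morphism_def words_eq_W(1))
  show "src X \<alpha> \<in> W" "tgt X \<alpha> \<in> W" by (fact s t)+
  show "op k (src X \<alpha>) = map_option (src X) (kash (gen2 X) k \<alpha>)"
    "op k (tgt X \<alpha>) = map_option (tgt X) (kash (gen2 X) k \<alpha>)"
    using assms src_morphism tgt_morphism words_op[OF s] words_op[OF t] by (auto simp: morphism_def)
  have se: "word_eps (gen1 X) i (src X \<alpha>) = eps (gen2 X) i \<alpha>"
    "word_phi (gen1 X) i (src X \<alpha>) = phi (gen2 X) i \<alpha>"
    "word_eps (gen1 X) i (tgt X \<alpha>) = eps (gen2 X) i \<alpha>"
    "word_phi (gen1 X) i (tgt X \<alpha>) = phi (gen2 X) i \<alpha>" for i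
    using assms src_morphism tgt_morphism words_eq_W(4,5)[OF s] words_eq_W(4,5)[OF t]
    by (auto simp: morphism_def)
  then show "word_eps (gen1 X) i (src X \<alpha>) = eps (gen2 X) i \<alpha>"
    "word_phi (gen1 X) i (src X \<alpha>) = phi (gen2 X) i \<alpha>" by auto
  show "same_len (src X \<alpha>) (tgt X \<alpha>)" by (simp add: same_len_def se)
  show "word_wt (gen1 X) (src X \<alpha>) = wt (gen2 X) \<alpha>"
    using assms src_morphism words_eq_W(2)[OF s] by (auto simp: morphism_def)
qed

lemma kash_closed: "\<alpha> \<in> A \<Longrightarrow> kash (gen2 X) k \<alpha> = Some \<beta> \<Longrightarrow> \<beta> \<in> A"
  by (rule strings_op(1)[OF gen2_strings])

section \<open>Operators on whiskered generators\<close>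

lemma steps_iff: "(t, \<alpha>, v) \<in> steps X \<longleftrightarrow> t \<in> W \<and> \<alpha> \<in> A \<and> v \<in> W"
  by (simp add: steps_def free_words_eq)

lemma step_src_W: "f \<in> steps X \<Longrightarrow> step_src X f \<in> W"
  and step_tgt_W: "f \<in> steps X \<Longrightarrow> step_tgt X f \<in> W"
  by (cases f; simp add: steps_iff src_tgt)+

lemma step_same_len:
  assumes "f \<in> steps X"
  shows "same_len (step_src X f) (step_tgt X f)"
  using assms by (cases f) (simp add: steps_iff src_tgt same_len_append)

text \<open>A nonvanishing operator changes \<epsilon> by one and hence has no fixed word. This
  excludes ambiguity in the comparison of words by which \<open>step_op\<close> finds the factor
  that was hit.\<close>

lemma op_neq: "u \<in> W \<Longrightarrow> op k u \<noteq> Some u"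
proof
  assume "u \<in> W" "op k u = Some u"
  then show False using strings_len(1)[OF word_strings, of u k u] by (cases k) auto
qed

text \<open>\<open>step_op\<close> tests which factor reproduces the transformed word, whereas this
  form decides it by string lengths. The two could differ only if changing one factor gave the same
  word as changing another; since operators preserve lengths of words, such a coincidence would make
  an operator fix a factor.\<close>

lemma step_op_eq:
  assumes "(t, \<alpha>, v) \<in> steps X"
  shows "step_op X k (t, \<alpha>, v) =
    (if left k t (src X \<alpha> @ v) then map_option (\<lambda>t'. (t', \<alpha>, v)) (op k t)
     else if left k (src X \<alpha>) v then map_option (\<lambda>\<alpha>'. (t, \<alpha>', v)) (kash (gen2 X) k \<alpha>)
     else map_option (\<lambda>v'. (t, \<alpha>, v')) (op k v))"
proof -
  have a: "t \<in> W" "v \<in> W" "src X \<alpha> \<in> W" "src X \<alpha> @ v \<in> W" "t @ src X \<alpha> @ v \<in> W" "\<alpha> \<in> A"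
    using assms by (simp_all add: steps_iff src_tgt)
  note o = op_append[OF a(1,4), of k] op_append[OF a(3,2), of k]
  \<comment> \<open>Prefixes of equal length would have to agree, which makes \<open>t\<close> a
    fixed word of \<open>k\<close>.\<close>
  have n1: "t' @ s \<noteq> t @ s'" if "length s = length s'" "op k t = Some t'" for t' s s'
    using that op_neq[OF a(1), of k] word_op_length[of "gen1 X" k t t'] by auto
  have n2: "op k (src X \<alpha>) = Some s' \<Longrightarrow> s' @ v \<noteq> src X \<alpha> @ v'" if "op k v = Some v'" for s' v'
    using that op_neq[OF a(3), of k] word_op_length[of "gen1 X" k]
    by (metis append_eq_append_conv)
  show ?thesis
  proof (cases "left k t (src X \<alpha> @ v)")
    case True
    then show ?thesis using o by (auto simp: words_op a Let_def split: option.split)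
  next
    case L1: False
    show ?thesis
    proof (cases "left k (src X \<alpha>) v")
      case True
      then have e: "op k (t @ src X \<alpha> @ v) = map_option (\<lambda>s'. t @ s' @ v) (op k (src X \<alpha>))"
        using o L1 by (simp add: option.map_comp o_def)
      show ?thesis
      proof (cases "op k (src X \<alpha>)")
        case None
        then show ?thesis
          using e L1 True src_tgt(3)[OF a(6), of k] by (simp add: words_op a Let_def)
      next
        case (Some s')
        have "t' @ src X \<alpha> \<noteq> t @ s'" if "op k t = Some t'" for t'
          using n1[OF _ that, of "src X \<alpha>" s'] word_op_length[OF Some] by simp
        then show ?thesis
          using e L1 True Some src_tgt(3)[OF a(6), of k] by (auto simp: words_op a Let_def)
      qed
    next
      case False
      then have e: "op k (t @ src X \<alpha> @ v) = map_option (\<lambda>v'. t @ src X \<alpha> @ v') (op k v)"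
        using o L1 by (simp add: option.map_comp o_def)
      show ?thesis
      proof (cases "op k v")
        case None
        then show ?thesis
          using e L1 False by (simp add: words_op a Let_def)
      next
        case (Some v')
        have "map_option (\<lambda>t'. t' @ src X \<alpha> @ v) (op k t) \<noteq> Some (t @ src X \<alpha> @ v')"
          using n1[of "src X \<alpha> @ v" "src X \<alpha> @ v'"] word_op_length[OF Some] by fastforce
        moreover have "map_option (\<lambda>s'. t @ s' @ v) (op k (src X \<alpha>)) \<noteq> Some (t @ src X \<alpha> @ v')"
          using n2[OF Some] by auto
        ultimately show ?thesis using e L1 False Some by (auto simp: words_op a Let_def)
      qed
    qed
  qed
qed

lemma step_op_src:
  assumes "f \<in> steps X"
  shows "op k (step_src X f) = map_option (step_src X) (step_op X k f)"
proof -
  obtain t \<alpha> v where f: "f = (t, \<alpha>, v)" by (cases f)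
  have a: "(t, \<alpha>, v) \<in> steps X" "t \<in> W" "\<alpha> \<in> A" "v \<in> W" using assms f by (auto simp: steps_iff)
  show ?thesis
    using a by (simp add: f step_op_eq op_append src_tgt option.map_comp o_def del: step_op.simps)
qed

lemma step_op_tgt:
  assumes "f \<in> steps X"
  shows "op k (step_tgt X f) = map_option (step_tgt X) (step_op X k f)"
proof -
  obtain t \<alpha> v where f: "f = (t, \<alpha>, v)" by (cases f)
  have a: "(t, \<alpha>, v) \<in> steps X" "t \<in> W" "\<alpha> \<in> A" "v \<in> W" using assms f by (auto simp: steps_iff)
  have "left k t (tgt X \<alpha> @ v) \<longleftrightarrow> left k t (src X \<alpha> @ v)" "left k (tgt X \<alpha>) v \<longleftrightarrow> left k (src X \<alpha>) v"
    using a src_tgt(1,2,5)[OF a(3)]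
    by (auto simp: same_len_def intro!: same_len_left same_len_append)
  then show ?thesis
    using a by (simp add: f step_op_eq op_append src_tgt option.map_comp o_def del: step_op.simps)
qed

lemma step_op_closed:
  assumes "f \<in> steps X" "step_op X k f = Some f'"
  shows "f' \<in> steps X"
proof -
  obtain t \<alpha> v where f: "f = (t, \<alpha>, v)" by (cases f)
  have a: "(t, \<alpha>, v) \<in> steps X" "t \<in> W" "\<alpha> \<in> A" "v \<in> W" using assms f by (auto simp: steps_iff)
  show ?thesis
    using assms(2) a op_closed kash_closed
    by (auto simp: f step_op_eq steps_iff simp del: step_op.simps split: if_splits)
qed

text \<open>A step is a tensor of a word, a generator and a word. A generator has the string lengths
  and the weight of its source, so those of the step are the ones of its source word.\<close>

lemma step_strings:
  "strings D (steps X) (\<lambda>f. word_wt (gen1 X) (step_src X f)) (step_op X)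
     (\<lambda>i f. word_eps (gen1 X) i (step_src X f)) (\<lambda>i f. word_phi (gen1 X) i (step_src X f))"
proof -
  have eq: "steps X = W \<times> (A \<times> W)"
    by (simp add: steps_def free_words_eq)
  show ?thesis
    unfolding eq
    by (rule strings_cong[OF strings_tensor[OF word_strings strings_tensor[OF gen2_strings word_strings]]])
      (auto simp: steps_iff step_op_eq src_tgt word_lengths_append left_def option.map_comp o_def
        simp del: step_op.simps)
qed

lemma step_op_inverse:
  assumes "f \<in> steps X" "step_op X k f = Some f'"
  shows "step_op X (inv_kop k) f' = Some f"
  by (rule strings_op(2)[OF step_strings assms])

lemma whisker_step_in:
  "f \<in> steps X \<Longrightarrow> u \<in> W \<Longrightarrow> v \<in> W \<Longrightarrow> whisker_step u f v \<in> steps X"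
  by (cases f) (simp add: steps_iff)

lemma whisker_step_src: "step_src X (whisker_step u f v) = u @ step_src X f @ v"
  and whisker_step_tgt: "step_tgt X (whisker_step u f v) = u @ step_tgt X f @ v"
  by (cases f; simp)+

text \<open>A whiskered step has five factors: the outer whiskers \<open>u\<close> and
  \<open>v\<close>, and the inner \<open>t\<close>, source and \<open>w\<close> of \<open>f\<close>.
  The left side groups the inner and outer whiskers together, the right side groups the factors of
  \<open>f\<close>; the rebracketing lemmas show that both find the same factor.\<close>

lemma step_op_whisker:
  assumes "f \<in> steps X" "u \<in> W" "v \<in> W"
  shows "step_op X k (whisker_step u f v) =
    (if left k u (step_src X f @ v) then map_option (\<lambda>u'. whisker_step u' f v) (op k u)
     else if left k (step_src X f) v then map_option (\<lambda>f'. whisker_step u f' v) (step_op X k f)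
     else map_option (\<lambda>v'. whisker_step u f v') (op k v))"
proof -
  obtain t \<alpha> w where f: "f = (t, \<alpha>, w)" by (cases f)
  have a: "t \<in> W" "\<alpha> \<in> A" "w \<in> W" "src X \<alpha> \<in> W" using assms f by (auto simp: steps_iff src_tgt)
  have in1: "(t, \<alpha>, w) \<in> steps X" "(u @ t, \<alpha>, w @ v) \<in> steps X"
    using a assms by (auto simp: steps_iff)
  have L1: "left k (u @ t) (src X \<alpha> @ w @ v) \<longleftrightarrow> left k u (t @ src X \<alpha> @ w @ v) \<or> left k t (src X \<alpha> @ w @ v)"
    using a assms by (simp add: left_append_left)
  have L2: "left k u (t @ src X \<alpha> @ w @ v) \<longleftrightarrow> left k (u @ t) (src X \<alpha> @ w @ v) \<and> left k u t"
    using a assms by (simp add: left_append_right)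
  have L3: "left k (t @ src X \<alpha> @ w) v \<longleftrightarrow> left k t (src X \<alpha> @ w @ v) \<or> left k (src X \<alpha> @ w) v"
    using a assms by (simp add: left_append_left)
  have L4: "left k (src X \<alpha> @ w) v \<longleftrightarrow> left k (src X \<alpha>) (w @ v) \<or> left k w v"
    using a assms by (simp add: left_append_left)
  have L5: "left k (src X \<alpha>) (w @ v) \<longleftrightarrow> left k (src X \<alpha> @ w) v \<and> left k (src X \<alpha>) w"
    using a assms by (simp add: left_append_right)
  have L6: "left k t ((src X \<alpha> @ w) @ v) \<longleftrightarrow> left k (t @ src X \<alpha> @ w) v \<and> left k t (src X \<alpha> @ w)"
    using left_append_right[of t "src X \<alpha> @ w" v k] a assms by simp
  define s where "s = src X \<alpha>"
  have lhs: "step_op X k (whisker_step u f v) =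
    (if left k (u @ t) (s @ w @ v)
     then if left k u t then map_option (\<lambda>u'. (u' @ t, \<alpha>, w @ v)) (op k u)
          else map_option (\<lambda>t'. (u @ t', \<alpha>, w @ v)) (op k t)
     else if left k s (w @ v) then map_option (\<lambda>\<alpha>'. (u @ t, \<alpha>', w @ v)) (kash (gen2 X) k \<alpha>)
     else if left k w v then map_option (\<lambda>w'. (u @ t, \<alpha>, w' @ v)) (op k w)
          else map_option (\<lambda>v'. (u @ t, \<alpha>, w @ v')) (op k v))"
    using a assms by (simp add: f step_op_eq[OF in1(2)] op_append option.map_comp o_def s_def
        del: step_op.simps)
  have rhs: "step_op X k f =
    (if left k t (s @ w) then map_option (\<lambda>t'. (t', \<alpha>, w)) (op k t)
     else if left k s w then map_option (\<lambda>\<alpha>'. (t, \<alpha>', w)) (kash (gen2 X) k \<alpha>)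
     else map_option (\<lambda>w'. (t, \<alpha>, w')) (op k w))"
    unfolding s_def f by (rule step_op_eq[OF in1(1)])
  note L = L1[folded s_def] L2[folded s_def] L3[folded s_def] L4[folded s_def] L5[folded s_def]
    L6[folded s_def, unfolded append_assoc]
  have src_f: "step_src X f = t @ s @ w" by (simp add: f s_def)
  have wh: "whisker_step u' f v' = (u' @ t, \<alpha>, w @ v')" for u' v' by (simp add: f)
  \<comment> \<open>One case for each of the five factors, from left to right.\<close>
  consider "left k u (t @ s @ w @ v)"
    | "\<not> left k u (t @ s @ w @ v)" "left k t (s @ w @ v)"
    | "\<not> left k u (t @ s @ w @ v)" "\<not> left k t (s @ w @ v)" "left k s (w @ v)"
    | "\<not> left k u (t @ s @ w @ v)" "\<not> left k t (s @ w @ v)" "\<not> left k s (w @ v)" "left k w v"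
    | "\<not> left k u (t @ s @ w @ v)" "\<not> left k t (s @ w @ v)" "\<not> left k s (w @ v)" "\<not> left k w v"
    by blast
  then show ?thesis
  proof cases
    case 1
    then have "left k (u @ t) (s @ w @ v)" "left k u t" using L(1,2) by blast+
    with 1 show ?thesis unfolding lhs unfolding src_f wh by simp
  next
    case 2
    then have "left k (u @ t) (s @ w @ v)" "\<not> left k u t" "left k (t @ s @ w) v" "left k t (s @ w)"
      using L by blast+
    with 2 show ?thesis unfolding lhs unfolding src_f wh rhs by (simp add: option.map_comp o_def)
  next
    case 3
    then have "\<not> left k (u @ t) (s @ w @ v)" "left k (t @ s @ w) v" "\<not> left k t (s @ w)" "left k s w"
      using L by blast+
    with 3 show ?thesis unfolding lhs unfolding src_f wh rhs by (simp add: option.map_comp o_def)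
  next
    case 4
    then have "\<not> left k (u @ t) (s @ w @ v)" "left k (t @ s @ w) v" "\<not> left k t (s @ w)" "\<not> left k s w"
      using L by blast+
    with 4 show ?thesis unfolding lhs unfolding src_f wh rhs by (simp add: option.map_comp o_def)
  next
    case 5
    then have "\<not> left k (u @ t) (s @ w @ v)" "\<not> left k (t @ s @ w) v"
      using L by blast+
    with 5 show ?thesis unfolding lhs unfolding src_f wh rhs by simp
  qed
qed

end

section \<open>Critical branchings\<close>

text \<open>Weights and lengths are read off through \<open>m\<close>, but the inverse law cannot
  be: \<open>m\<close> may identify elements, as when many branchings share a source. It is
  therefore required of \<open>g'\<close> itself.\<close>

lemma strings_pullback:
  assumes "strings D T w g e p"
    and "\<And>x. x \<in> S \<Longrightarrow> m x \<in> T"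
    and "\<And>x k. x \<in> S \<Longrightarrow> g' k x = None \<longleftrightarrow> g k (m x) = None"
    and "\<And>x y k. x \<in> S \<Longrightarrow> g' k x = Some y \<Longrightarrow> y \<in> S \<and> g k (m x) = Some (m y) \<and> g' (inv_kop k) y = Some x"
  shows "strings D S (\<lambda>x. w (m x)) g' (\<lambda>i x. e i (m x)) (\<lambda>i x. p i (m x))"
  unfolding strings_def
proof (intro ballI allI conjI impI)
  fix x i assume x: "x \<in> S"
  note s = stringsD[OF assms(1) assms(2)[OF x], of i]
  show "0 \<le> e i (m x)" "0 \<le> p i (m x)" "p i (m x) - e i (m x) = pairing (w (m x)) (coroot D i)"
    "g' (E i) x = None \<longleftrightarrow> e i (m x) = 0" "g' (F i) x = None \<longleftrightarrow> p i (m x) = 0"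
    using s(1-5) assms(3)[OF x] by simp_all
  fix y
  { assume y: "g' (E i) x = Some y"
    note a = assms(4)[OF x y]
    then show "y \<in> S" "w (m y) = w (m x) + root D i" "e i (m y) = e i (m x) - 1"
      "p i (m y) = p i (m x) + 1" "g' (F i) y = Some x"
      using s(6)[of "m y"] by simp_all }
  { assume y: "g' (F i) x = Some y"
    note a = assms(4)[OF x y]
    then show "y \<in> S" "w (m y) = w (m x) - root D i" "e i (m y) = e i (m x) + 1"
      "p i (m y) = p i (m x) - 1" "g' (E i) y = Some x"
      using s(7)[of "m y"] by simp_all }
qed

declare step_op.simps [simp del] step_src.simps [simp del] step_tgt.simps [simp del]
  whisker_step.simps [simp del] branching_op.simps [simp del]
  split_paired_All [simp del] split_paired_Ex [simp del]

context kash_polygraph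
begin

lemma step_op_defined:
  assumes "f \<in> steps X" "op k (step_src X f) = Some w"
  obtains f' where "step_op X k f = Some f'" "f' \<in> steps X" "step_src X f' = w"
  using assms step_op_src[OF assms(1), of k] step_op_closed[OF assms(1)] by auto

lemma local_branchings_iff:
  "(f, g) \<in> local_branchings X \<longleftrightarrow> f \<in> steps X \<and> g \<in> steps X \<and> step_src X f = step_src X g"
  by (simp add: local_branchings_def)

text \<open>Both steps have the same source and survive an operator exactly when it does, so the two
  occurrences of \<open>the\<close> in \<open>branching_op\<close> are harmless.\<close>

lemma branching_op_Some:
  assumes "(f, g) \<in> local_branchings X"
  shows "branching_op X k (f, g) = Some b \<longleftrightarrow>
    (\<exists>f' g'. step_op X k f = Some f' \<and> step_op X k g = Some g' \<and> b = (f', g'))"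
proof -
  have fg: "f \<in> steps X" "g \<in> steps X" "step_src X f = step_src X g"
    using assms by (auto simp: local_branchings_iff)
  show ?thesis
    using step_op_src[OF fg(1), of k] step_op_src[OF fg(2), of k] step_src_W[OF fg(1)] fg(3)
    by (auto simp: words_op branching_op.simps)
qed

lemma branching_op_None:
  assumes "b \<in> local_branchings X"
  shows "branching_op X k b = None \<longleftrightarrow> op k (step_src X (fst b)) = None"
proof -
  have "fst b \<in> steps X" using assms by (metis local_branchings_iff prod.collapse)
  from words_op[OF step_src_W[OF this]] show ?thesis by (metis branching_op.simps option.distinct(1) prod.collapse)
qed

lemma branching_op_local:
  assumes "b \<in> local_branchings X" "branching_op X k b = Some b'"
  shows "b' \<in> local_branchings X" "branching_op X (inv_kop k) b' = Some b"
    and "op k (step_src X (fst b)) = Some (step_src X (fst b'))"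
proof -
  obtain f g where b: "b = (f, g)" by (cases b)
  then have fg: "f \<in> steps X" "g \<in> steps X" "step_src X f = step_src X g"
    using assms by (auto simp: local_branchings_iff)
  obtain f' g' where s: "step_op X k f = Some f'" "step_op X k g = Some g'" "b' = (f', g')"
    using assms branching_op_Some[of f g k b'] b by blast
  show "b' \<in> local_branchings X"
    using s fg step_op_closed step_op_src[OF fg(1), of k] step_op_src[OF fg(2), of k]
    by (auto simp: local_branchings_iff)
  then show "branching_op X (inv_kop k) b' = Some b"
    using branching_op_Some[of f' g' "inv_kop k" b] s step_op_inverse fg b by auto
  show "op k (step_src X (fst b)) = Some (step_src X (fst b'))"
    using step_op_src[OF fg(1), of k] s b by simp
qed

section \<open>Whiskered and Peiffer branchings under the operators\<close>

definition whisker_branching ::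
  "'a list \<Rightarrow> ('a, 'b) branching \<Rightarrow> 'a list \<Rightarrow> ('a, 'b) branching" where
  "whisker_branching u b v = (whisker_step u (fst b) v, whisker_step u (snd b) v)"

lemma whisker_branching_local:
  "b \<in> local_branchings X \<Longrightarrow> u \<in> W \<Longrightarrow> v \<in> W \<Longrightarrow> whisker_branching u b v \<in> local_branchings X"
  by (metis whisker_branching_def local_branchings_iff whisker_step_in whisker_step_src prod.collapse)

text \<open>The two steps share their source, so the operator hits the same one of the three factors
  in both. The lengths of the whiskers are recorded because they show that a nonempty whisker never
  becomes empty, which is what minimality requires.\<close>

lemma branching_op_whisker:
  assumes "b \<in> local_branchings X" "u \<in> W" "v \<in> W"
    and "branching_op X k (whisker_branching u b v) = Some c"
  obtains u' b' v' where "c = whisker_branching u' b' v'" "b' \<in> local_branchings X"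
    "u' \<in> W" "v' \<in> W" "length u' = length u" "length v' = length v"
proof -
  obtain f g where b: "b = (f, g)" by (cases b)
  then have fg: "f \<in> steps X" "g \<in> steps X" "step_src X f = step_src X g"
    using assms by (auto simp: local_branchings_iff)
  have loc: "(whisker_step u f v, whisker_step u g v) \<in> local_branchings X"
    using whisker_branching_local[OF assms(1-3)] by (simp add: whisker_branching_def b)
  obtain f' g' where s: "step_op X k (whisker_step u f v) = Some f'"
      "step_op X k (whisker_step u g v) = Some g'" "c = (f', g')"
    using assms(4) branching_op_Some[OF loc] by (auto simp: whisker_branching_def b)
  note f' = s(1)[unfolded step_op_whisker[OF fg(1) assms(2,3)]]
    and g' = s(2)[unfolded step_op_whisker[OF fg(2) assms(2,3)]]
  consider "left k u (step_src X f @ v)"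
    | "\<not> left k u (step_src X f @ v)" "left k (step_src X f) v"
    | "\<not> left k u (step_src X f @ v)" "\<not> left k (step_src X f) v"
    by blast
  then show thesis
  proof cases
    case 1
    then obtain u' where "op k u = Some u'" "c = whisker_branching u' b v"
      using f' g' fg s(3) by (auto simp: whisker_branching_def b)
    then show thesis using that assms(1-3) op_closed word_op_length[of "gen1 X" k u] by blast
  next
    case 2
    then obtain f1 g1 where 3: "step_op X k f = Some f1" "step_op X k g = Some g1"
        "c = whisker_branching u (f1, g1) v"
      using f' g' fg s(3) by (auto simp: whisker_branching_def)
    then have "branching_op X k b = Some (f1, g1)"
      using branching_op_Some[of f g k] assms(1) b by auto
    then have "(f1, g1) \<in> local_branchings X"
      by (rule branching_op_local(1)[OF assms(1)])
    then show thesis using that 3(3) assms(2,3) by blast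
  next
    case 3
    then obtain v' where "op k v = Some v'" "c = whisker_branching u b v'"
      using f' g' fg s(3) by (auto simp: whisker_branching_def b)
    then show thesis using that assms(1-3) op_closed word_op_length[of "gen1 X" k v] by blast
  qed
qed

text \<open>The common source is the concatenation of the two sources, and the operator lands on one
  half. The step acting there is transformed by \<open>k\<close>; for the other step only the
  whisker changes, into the new source of the first, so the pair keeps its Peiffer form.\<close>

lemma peiffer_pair_op:
  assumes fg: "f \<in> steps X" "g \<in> steps X"
    and "step_op X k (whisker_step [] f (step_src X g)) = Some f'"
    and "step_op X k (whisker_step (step_src X f) g []) = Some g'"
  obtains f1 g1 where "f1 \<in> steps X" "g1 \<in> steps X"
    "f' = whisker_step [] f1 (step_src X g1)" "g' = whisker_step (step_src X f1) g1 []"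
proof -
  let ?u = "step_src X f" and ?v = "step_src X g"
  have W: "?u \<in> W" "?v \<in> W" using fg step_src_W by auto
  have "op k (?u @ ?v) \<noteq> None"
    using step_op_src[OF whisker_step_in[OF fg(1) Nil_W W(2)], of k] assms(3)
    by (simp add: whisker_step_src)
  \<comment> \<open>The outer empty whisker is not hit, since the operator does not vanish on the
    source.\<close>
  then have 1: "\<not> left k [] (?u @ ?v)"
    using left_Nil(1)[of "?u @ ?v" k] W by auto
  note f' = assms(3)[unfolded step_op_whisker[OF fg(1) Nil_W W(2)]]
    and g' = assms(4)[unfolded step_op_whisker[OF fg(2) W(1) Nil_W]]
  show thesis
  proof (cases "left k ?u ?v")
    case True
    then obtain f1 where f1: "step_op X k f = Some f1" "f' = whisker_step [] f1 ?v"
      using f' 1 by auto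
    moreover have "g' = whisker_step (step_src X f1) g []"
      using g' True step_op_src[OF fg(1), of k] f1 by auto
    ultimately show thesis using that step_op_closed[OF fg(1)] fg(2) by blast
  next
    case False
    then obtain v' where v': "op k ?v = Some v'" "f' = whisker_step [] f v'"
      using f' 1 by auto
    then have "left k ?v []" using left_Nil(2)[OF W(2), of k] by auto
    then obtain g1 where g1: "step_op X k g = Some g1" "g' = whisker_step ?u g1 []"
      using g' False by auto
    moreover have "step_src X g1 = v'"
      using step_op_src[OF fg(2), of k] g1 v' by auto
    ultimately show thesis using that step_op_closed[OF fg(2)] fg(1) v'(2) by blast
  qed
qed

lemma peiffer_op:
  assumes "b \<in> local_branchings X" "branching_op X k b = Some b'" "peiffer X b"
  shows "peiffer X b'"
proof -
  obtain f g where fg: "f \<in> steps X" "g \<in> steps X"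
    and b: "b = (whisker_step [] f (step_src X g), whisker_step (step_src X f) g []) \<or>
      b = (whisker_step (step_src X f) g [], whisker_step [] f (step_src X g))"
    using assms(3) by (auto simp: peiffer_def Let_def)
  from b show ?thesis
  proof
    assume b: "b = (whisker_step [] f (step_src X g), whisker_step (step_src X f) g [])"
    obtain f' g' where s: "step_op X k (whisker_step [] f (step_src X g)) = Some f'"
        "step_op X k (whisker_step (step_src X f) g []) = Some g'" "b' = (f', g')"
      using assms(1,2) branching_op_Some b by blast
    show ?thesis
      unfolding peiffer_def Let_def s(3) by (rule peiffer_pair_op[OF fg s(1,2)]) blast
  next
    assume b: "b = (whisker_step (step_src X f) g [], whisker_step [] f (step_src X g))"
    obtain f' g' where s: "step_op X k (whisker_step [] f (step_src X g)) = Some f'"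
        "step_op X k (whisker_step (step_src X f) g []) = Some g'" "b' = (g', f')"
      using assms(1,2) branching_op_Some b by blast
    show ?thesis
      unfolding peiffer_def Let_def s(3) by (rule peiffer_pair_op[OF fg s(1,2)]) blast
  qed
qed

lemma branching_le_iff:
  "branching_le X b b' \<longleftrightarrow> (\<exists>u\<in>W. \<exists>v\<in>W. b' = whisker_branching u b v)"
  by (simp add: branching_le_def free_words_eq whisker_branching_def)

lemma whisker_branching_eq_self:
  assumes "b = whisker_branching u b v"
  shows "u = []" "v = []"
proof -
  obtain t \<alpha> w where "fst b = (t, \<alpha>, w)" by (cases "fst b")
  then show "u = []" "v = []"
    using assms by (metis fst_conv whisker_branching_def whisker_step.simps append_self_conv2 prod.inject)
      (metis \<open>fst b = (t, \<alpha>, w)\<close> assms fst_conv whisker_branching_def whisker_step.simps append_self_conv prod.inject)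
qed

lemma whisker_branching_Nil: "whisker_branching [] b [] = b"
  by (cases b; cases "fst b"; cases "snd b") (auto simp: whisker_branching_def whisker_step.simps)

lemma Crit_local: "b \<in> Crit X \<Longrightarrow> b \<in> local_branchings X"
  by (simp add: Crit_def overlapping_def)

text \<open>Operators preserve each clause in the definition of critical branchings because their
  inverses do not create aspherical, Peiffer or properly whiskered branchings.\<close>

lemma Crit_op:
  assumes "b \<in> Crit X" "branching_op X k b = Some b'"
  shows "b' \<in> Crit X"
proof -
  have loc: "b \<in> local_branchings X" using assms(1) by (rule Crit_local)
  note b' = branching_op_local(1,2)[OF loc assms(2)]
  have "\<not> aspherical b'"
  proof
    assume "aspherical b'"
    then obtain f where f: "b' = (f, f)" by (cases b') (auto simp: aspherical_def)
    then have "aspherical b"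
      using b' branching_op_Some[of f f "inv_kop k" b] by (auto simp: aspherical_def)
    then show False using assms(1) by (simp add: Crit_def overlapping_def)
  qed
  moreover have "\<not> peiffer X b'"
    using peiffer_op[OF b'] assms(1) by (auto simp: Crit_def overlapping_def)
  moreover have "c = b'" if c: "c \<in> local_branchings X" "branching_le X c b'" for c
  proof -
    obtain u v where uv: "u \<in> W" "v \<in> W" "b' = whisker_branching u c v"
      using c(2) by (auto simp: branching_le_iff)
    obtain u' c' v' where c': "b = whisker_branching u' c' v'" "c' \<in> local_branchings X"
        "u' \<in> W" "v' \<in> W" "length u' = length u" "length v' = length v"
      using branching_op_whisker[OF c(1) uv(1,2)] b'(2) uv(3) by metis
    \<comment> \<open>Minimality of \<open>b\<close> leaves only empty whiskers \<open>u'\<close>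
      and \<open>v'\<close>; having the same lengths, \<open>u\<close> and \<open>v\<close> are
      empty too, so \<open>c\<close> is \<open>b'\<close> itself.\<close>
    then have "c' = b" using assms(1) by (auto simp: Crit_def branching_le_iff)
    then have "u' = []" "v' = []" using c'(1) whisker_branching_eq_self by metis+
    then show ?thesis using c' uv(3) by (simp add: whisker_branching_Nil)
  qed
  ultimately show ?thesis using b'(1) by (simp add: Crit_def overlapping_def)
qed

lemma Crit_strings:
  "strings D (Crit X) (\<lambda>b. word_wt (gen1 X) (step_src X (fst b))) (branching_op X)
     (\<lambda>i b. word_eps (gen1 X) i (step_src X (fst b))) (\<lambda>i b. word_phi (gen1 X) i (step_src X (fst b)))"
proof (rule strings_pullback[OF word_strings])
  fix b assume b: "b \<in> Crit X"
  then show "step_src X (fst b) \<in> W"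
    using Crit_local[OF b] by (metis local_branchings_iff step_src_W prod.collapse)
  show "branching_op X k b = None \<longleftrightarrow> op k (step_src X (fst b)) = None" for k
    by (rule branching_op_None[OF Crit_local[OF b]])
  show "b' \<in> Crit X \<and> op k (step_src X (fst b)) = Some (step_src X (fst b')) \<and>
      branching_op X (inv_kop k) b' = Some b" if "branching_op X k b = Some b'" for b' k
    using Crit_op[OF b that] branching_op_local[OF Crit_local[OF b] that] by blast
qed

section \<open>Paths and 2-cells\<close>

definition end_word :: "'a list \<Rightarrow> ('a, 'b) step list \<Rightarrow> 'a list" where
  "end_word u fs = (if fs = [] then u else step_tgt X (last fs))"

text \<open>On a composable list whose source is not killed by \<open>k\<close>, no step is killed,
  so \<open>the\<close> is applied to defined values only.\<close>

definition steps_op :: "'i kop \<Rightarrow> ('a, 'b) step list \<Rightarrow> ('a, 'b) step list" where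
  "steps_op k fs = map (\<lambda>f. the (step_op X k f)) fs"

lemma end_word_Cons: "end_word u (f # fs) = end_word (step_tgt X f) fs"
  by (simp add: end_word_def)

lemma end_word_append: "end_word u (fs @ gs) = end_word (end_word u fs) gs"
  by (simp add: end_word_def)

lemma composable_W: "composable X u fs \<Longrightarrow> u \<in> W"
  using step_src_W by (cases fs) (auto simp: free_words_eq simp del: step_src.simps)

lemma composable_append:
  "composable X u (fs @ gs) \<longleftrightarrow> composable X u fs \<and> composable X (end_word u fs) gs"
proof (induction fs arbitrary: u)
  case Nil
  then show ?case using composable_W by (auto simp: end_word_def free_words_eq)
qed (auto simp: end_word_Cons)

lemma same_len_trans: "same_len u v \<Longrightarrow> same_len v w \<Longrightarrow> same_len u w"
  by (simp add: same_len_def)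

lemma same_len_sym: "same_len u v \<Longrightarrow> same_len v u"
  by (simp add: same_len_def)

lemma composable_same_len:
  assumes "composable X u fs"
  shows "same_len u (end_word u fs)" "end_word u fs \<in> W"
    and "f \<in> set fs \<Longrightarrow> f \<in> steps X \<and> same_len u (step_src X f)"
  using assms
proof (induction fs arbitrary: u)
  case Nil
  { case 1 then show ?case by (simp add: end_word_def) }
  { case 2 then show ?case by (simp add: end_word_def free_words_eq) }
  { case 3 then show ?case by simp }
next
  case (Cons g fs)
  { case 1 then show ?case
      using Cons.IH(1)[of "step_tgt X g"] step_same_len[of g] same_len_trans by (auto simp: end_word_Cons) }
  { case 2 then show ?case using Cons.IH(2)[of "step_tgt X g"] by (simp add: end_word_Cons) }
  { case 3 then show ?case
      using Cons.IH(3)[of "step_tgt X g"] step_same_len[of g] same_len_trans by auto }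
qed

lemma composable_steps_op:
  assumes "composable X u fs" "op k u = Some u'"
  shows "composable X u' (steps_op k fs)"
    "op k (end_word u fs) = Some (end_word u' (steps_op k fs))"
  using assms
proof (induction fs arbitrary: u u')
  case Nil
  { case 1 then show ?case using op_closed by (auto simp: steps_op_def free_words_eq) }
  { case 2 then show ?case by (simp add: end_word_def steps_op_def) }
next
  case (Cons f fs)
  have *: "\<exists>f'. step_op X k f = Some f' \<and> f' \<in> steps X \<and> step_src X f' = u' \<and>
      op k (step_tgt X f) = Some (step_tgt X f') \<and> steps_op k (f # fs) = f' # steps_op k fs"
    if c: "composable X u (f # fs)" "op k u = Some u'" for u u'
  proof -
    from c have f: "f \<in> steps X" "op k (step_src X f) = Some u'" by auto
    obtain f' where f': "step_op X k f = Some f'" "f' \<in> steps X" "step_src X f' = u'"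
      using step_op_defined[OF f] .
    moreover have "op k (step_tgt X f) = Some (step_tgt X f')"
      using step_op_tgt[OF f(1), of k] f' by simp
    ultimately show ?thesis by (simp add: steps_op_def)
  qed
  { case 1 then show ?case using *[OF 1] Cons.IH(1) by auto }
  { case 2 then show ?case using *[OF 2] Cons.IH(2) by (auto simp: end_word_Cons) }
qed

lemma composable_whisker:
  assumes "composable X w fs" "u \<in> W" "v \<in> W"
  shows "composable X (u @ w @ v) (map (\<lambda>f. whisker_step u f v) fs)"
    "end_word (u @ w @ v) (map (\<lambda>f. whisker_step u f v) fs) = u @ end_word w fs @ v"
  using assms
proof (induction fs arbitrary: w)
  case Nil
  { case 1 then show ?case by (auto simp: free_words_eq) }
  { case 2 then show ?case by (simp add: end_word_def) }
next
  case (Cons f fs)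
  { case 1 then show ?case
      using Cons.IH(1)[of "step_tgt X f"] by (auto simp: whisker_step_in whisker_step_src whisker_step_tgt) }
  { case 2 then show ?case
      using Cons.IH(2)[of "step_tgt X f"] by (auto simp: end_word_Cons whisker_step_tgt) }
qed

text \<open>All words visited by a composable list have the same string lengths. Which of the three
  factors is hit is thus decided once, at the source \<open>w\<close>, for all steps of the
  list.\<close>

lemma steps_op_whisker:
  assumes "composable X w fs" "u \<in> W" "v \<in> W" "op k (u @ w @ v) \<noteq> None"
  shows "left k u (w @ v) \<Longrightarrow> steps_op k (map (\<lambda>f. whisker_step u f v) fs) =
      map (\<lambda>f. whisker_step (the (op k u)) f v) fs"
    and "\<not> left k u (w @ v) \<Longrightarrow> left k w v \<Longrightarrow>
      steps_op k (map (\<lambda>f. whisker_step u f v) fs) = map (\<lambda>f. whisker_step u f v) (steps_op k fs)"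
    and "\<not> left k u (w @ v) \<Longrightarrow> \<not> left k w v \<Longrightarrow>
      steps_op k (map (\<lambda>f. whisker_step u f v) fs) = map (\<lambda>f. whisker_step u f (the (op k v))) fs"
proof -
  have w: "w \<in> W" by (rule composable_W[OF assms(1)])
  have f: "f \<in> steps X" "left k u (step_src X f @ v) \<longleftrightarrow> left k u (w @ v)"
    "left k (step_src X f) v \<longleftrightarrow> left k w v" "op k (step_src X f) = None \<longleftrightarrow> op k w = None"
    if "f \<in> set fs" for f
  proof -
    show f: "f \<in> steps X" using composable_same_len(3)[OF assms(1) that] by blast
    have s: "same_len w (step_src X f)" using composable_same_len(3)[OF assms(1) that] by blast
    have W: "step_src X f \<in> W" by (rule step_src_W[OF f])
    show "left k u (step_src X f @ v) \<longleftrightarrow> left k u (w @ v)"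
      by (intro same_len_left same_len_append same_len_refl same_len_sym[OF s] W w assms)
    show "left k (step_src X f) v \<longleftrightarrow> left k w v"
      by (intro same_len_left same_len_refl same_len_sym[OF s])
    show "op k (step_src X f) = None \<longleftrightarrow> op k w = None"
      by (intro same_len_op same_len_sym[OF s] W w)
  qed
  note o = assms(4)[unfolded op_append[OF assms(2), of "w @ v", simplified, OF conjI[OF w assms(3)]]
      op_append[OF w assms(3)]]
  { assume "left k u (w @ v)"
    then show "steps_op k (map (\<lambda>f. whisker_step u f v) fs) =
        map (\<lambda>f. whisker_step (the (op k u)) f v) fs"
      using o f by (auto simp: steps_op_def step_op_whisker assms) }
  { assume 2: "\<not> left k u (w @ v)" "left k w v"
    have "the (step_op X k (whisker_step u g v)) = whisker_step u (the (step_op X k g)) v"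
      if "g \<in> set fs" for g
      using 2 o f[OF that] step_op_src[OF f(1)[OF that], of k] by (auto simp: step_op_whisker assms)
    then show "steps_op k (map (\<lambda>f. whisker_step u f v) fs) = map (\<lambda>f. whisker_step u f v) (steps_op k fs)"
      by (simp add: steps_op_def) }
  { assume "\<not> left k u (w @ v)" "\<not> left k w v"
    then show "steps_op k (map (\<lambda>f. whisker_step u f v) fs) = map (\<lambda>f. whisker_step u f (the (op k v))) fs"
      using o f by (auto simp: steps_op_def step_op_whisker assms) }
qed

end

context kash_polygraph
begin

section \<open>Formal inverses of the generators\<close>

lemma with_inverses_simps [simp]:
  "gen1 (with_inverses X) = gen1 X"
  "gen2 (with_inverses X) = signed_crystal (gen2 X)"
  "src (with_inverses X) (Fwd \<alpha>) = src X \<alpha>" "src (with_inverses X) (Bwd \<alpha>) = tgt X \<alpha>"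
  "tgt (with_inverses X) (Fwd \<alpha>) = tgt X \<alpha>" "tgt (with_inverses X) (Bwd \<alpha>) = src X \<alpha>"
  by (simp_all add: with_inverses_def)

lemma signed_crystal_simps [simp]:
  "elems (signed_crystal \<Gamma>) = Fwd ` elems \<Gamma> \<union> Bwd ` elems \<Gamma>"
  "wt (signed_crystal \<Gamma>) a = wt \<Gamma> (unsigned a)"
  "eps (signed_crystal \<Gamma>) i a = eps \<Gamma> i (unsigned a)"
  "phi (signed_crystal \<Gamma>) i a = phi \<Gamma> i (unsigned a)"
  "kash (signed_crystal \<Gamma>) k a = signed_op (kash \<Gamma> k) a"
  by (simp_all add: signed_crystal_def)

text \<open>The signed generators are two copies of the original ones, with source and target
  exchanged in the second. Normality passes to each copy as an image and to both by union.\<close>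

lemma with_inverses: "kash_polygraph D (with_inverses X)"
proof
  show "normal_crystal D (gen1 (with_inverses X))" using normal1 by simp
  show "normal_crystal D (gen2 (with_inverses X))"
  proof (rule strings_normal)
    let ?S = "signed_crystal (gen2 X)"
    have F: "strings D (Fwd ` A) (wt ?S) (kash ?S) (eps ?S) (phi ?S)"
      by (rule strings_image[OF gen2_strings]) simp_all
    have B: "strings D (Bwd ` A) (wt ?S) (kash ?S) (eps ?S) (phi ?S)"
      by (rule strings_image[OF gen2_strings]) simp_all
    have "strings D (\<Union>{Fwd ` A, Bwd ` A}) (wt ?S) (kash ?S) (eps ?S) (phi ?S)"
      using F B by (intro strings_Union) auto
    then show "strings D (elems (gen2 (with_inverses X))) (wt (gen2 (with_inverses X)))
        (kash (gen2 (with_inverses X))) (eps (gen2 (with_inverses X))) (phi (gen2 (with_inverses X)))"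
      by simp
  qed
  show "morphism (gen2 (with_inverses X)) (words (gen1 (with_inverses X))) (src (with_inverses X))"
    "morphism (gen2 (with_inverses X)) (words (gen1 (with_inverses X))) (tgt (with_inverses X))"
    using src_morphism tgt_morphism by (auto simp: morphism_def option.map_comp o_def)
qed

interpretation Y: kash_polygraph D "with_inverses X"
  by (rule with_inverses)

lemma W_with_inverses [simp]: "Y.W = W"
  by (simp add: Y.W_def W_def)

lemma left_with_inverses [simp]: "Y.left = left"
  by (intro ext) (simp add: Y.left_def left_def)

lemma same_len_with_inverses [simp]: "Y.same_len = same_len"
  by (intro ext) (simp add: Y.same_len_def same_len_def)

section \<open>The relations defining 2-cells under the operators\<close>

lemma paths_iff: "(u, fs) \<in> paths X \<longleftrightarrow> composable (with_inverses X) u fs"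
  by (simp add: paths_def)

lemma path_tgt_eq: "path_tgt X p = Y.end_word (fst p) (snd p)"
  by (simp add: path_tgt_def Y.end_word_def)

lemma path_op_eq:
  assumes "u \<in> W"
  shows "path_op X k (u, fs) = map_option (\<lambda>u'. (u', Y.steps_op k fs)) (op k u)"
  using words_op[OF assms] by (simp add: Y.steps_op_def)

lemma inv_signed:
  assumes "a \<in> Y.A"
  shows "inv_signed a \<in> Y.A" "src (with_inverses X) (inv_signed a) = tgt (with_inverses X) a"
    "tgt (with_inverses X) (inv_signed a) = src (with_inverses X) a"
    "kash (gen2 (with_inverses X)) k (inv_signed a) =
      map_option inv_signed (kash (gen2 (with_inverses X)) k a)"
  using assms by (cases a; auto simp: option.map_comp o_def)+

text \<open>Source and target of \<open>a\<close>, and likewise of \<open>b\<close>, have equal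
  string lengths, so all four steps are hit in the same one of the factors belonging to
  \<open>a\<close>, \<open>w\<close> and \<open>b\<close>. The transformed pair is the exchange
  relation with that factor replaced.\<close>

lemma path_eq_exchange_op:
  assumes a: "a \<in> Y.A" and b: "b \<in> Y.A" and w: "w \<in> W"
    and u: "u = src (with_inverses X) a" and u': "u' = tgt (with_inverses X) a"
    and v: "v = src (with_inverses X) b" and v': "v' = tgt (with_inverses X) b"
    and z: "op k (u @ w @ v) = Some z"
  shows "path_eq X (z, Y.steps_op k [([], a, w @ v), (u' @ w, b, [])])
    (z, Y.steps_op k [(u @ w, b, []), ([], a, w @ v')])" (is "path_eq X (z, ?fs) (z, ?gs)")
proof -
  note st = Y.src_tgt[OF a, simplified, folded u u'] Y.src_tgt[OF b, simplified, folded v v']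
  have W: "u \<in> W" "u' \<in> W" "v \<in> W" "v' \<in> W" using st by auto
  have su: "same_len u u'" and sv: "same_len v v'" using st by auto
  have swv: "same_len (w @ v) (w @ v')" using same_len_append sv w W by auto
  have suw: "same_len (u @ w) (u' @ w)" using same_len_append su w W by auto
  \<comment> \<open>As \<open>k\<close> does not vanish on the source, it never lands on the outer
    empty whisker. This removes the first case from the action on the steps starting with
    \<open>[]\<close>.\<close>
  have n0: "\<not> left k [] (u @ w @ v)" using left_Nil(1)[of "u @ w @ v" k] z w W by auto
  have n1: "\<not> left k [] (u @ w @ v')"
    using n0 same_len_left[of "[]" "[]" "u @ w @ v" "u @ w @ v'" k]
      same_len_append[of u u "w @ v" "w @ v'"] swv w W by auto
  have in1: "([], a, w @ v) \<in> steps (with_inverses X)" "([], a, w @ v') \<in> steps (with_inverses X)"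
    "(u @ w, b, []) \<in> steps (with_inverses X)" "(u' @ w, b, []) \<in> steps (with_inverses X)"
    using Y.steps_iff a b w W by auto
  have L: "left k u (w @ v') \<longleftrightarrow> left k u (w @ v)" "left k (u' @ w) v \<longleftrightarrow> left k (u @ w) v"
    "left k w v' \<longleftrightarrow> left k w v" "left k u' w \<longleftrightarrow> left k u w"
    using same_len_left[OF same_len_refl swv] same_len_left[OF suw same_len_refl]
      same_len_left[OF same_len_refl sv] same_len_left[OF su same_len_refl] by blast+
  note A1 = left_append_right[OF W(1) w W(3), of k] and A2 = left_append_left[OF W(1) w W(3), of k]
  note s1 = Y.step_op_eq[OF in1(1), of k, simplified, folded u, simplified n0 if_False]
    and s2 = Y.step_op_eq[OF in1(4), of k, simplified, folded v]
    and s3 = Y.step_op_eq[OF in1(3), of k, simplified, folded v]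
    and s4 = Y.step_op_eq[OF in1(2), of k, simplified, folded u, simplified n1 if_False]
  have opuw: "op k (u @ w) = (if left k u w then map_option (\<lambda>u1. u1 @ w) (op k u)
      else map_option (\<lambda>w1. u @ w1) (op k w))"
    and opuw': "op k (u' @ w) = (if left k u w then map_option (\<lambda>u1. u1 @ w) (op k u')
      else map_option (\<lambda>w1. u' @ w1) (op k w))"
    and opwv: "op k (w @ v) = (if left k w v then map_option (\<lambda>w1. w1 @ v) (op k w)
      else map_option (\<lambda>v1. w @ v1) (op k v))"
    and opwv': "op k (w @ v') = (if left k w v then map_option (\<lambda>w1. w1 @ v') (op k w)
      else map_option (\<lambda>v1. w @ v1) (op k v'))"
    using op_append w W L by auto
  have z': "(if left k u (w @ v) then map_option (\<lambda>u1. u1 @ w @ v) (op k u)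
      else map_option (\<lambda>x. u @ x) (op k (w @ v))) = Some z"
    using z op_append[of u "w @ v" k] w W by simp
  have ex: "path_eq X (src (with_inverses X) a1 @ w1 @ src (with_inverses X) b1,
        [([], a1, w1 @ src (with_inverses X) b1), (tgt (with_inverses X) a1 @ w1, b1, [])])
      (src (with_inverses X) a1 @ w1 @ src (with_inverses X) b1,
        [(src (with_inverses X) a1 @ w1, b1, []), ([], a1, w1 @ tgt (with_inverses X) b1)])"
    if "a1 \<in> Y.A" "b1 \<in> Y.A" "w1 \<in> W" for a1 b1 w1
    using path_eq.exchange[OF that(1,2) _ HOL.refl HOL.refl HOL.refl HOL.refl] that(3) free_words_eq
    by simp
  have "path_eq X (z, ?fs) (z, ?gs)" if 1: "left k u (w @ v)"
  proof -
    from 1 have l: "left k (u @ w) v" "left k u w" using A1 by blast+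
    obtain u1 where u1: "op k u = Some u1" "z = u1 @ w @ v" using z' 1 by auto
    have "map_option (src (with_inverses X)) (kash (gen2 (with_inverses X)) k a) = Some u1"
      by (rule HOL.trans[OF HOL.sym[OF Y.src_tgt(3)[OF a, of k, folded u, unfolded with_inverses_simps(1)]] u1(1)])
    then obtain a1 where a1: "kash (gen2 (with_inverses X)) k a = Some a1" "src (with_inverses X) a1 = u1"
      by auto
    have a1A: "a1 \<in> Y.A" by (rule Y.kash_closed[OF a a1(1)])
    have t1: "op k u' = Some (tgt (with_inverses X) a1)"
      using Y.src_tgt(4)[OF a, of k] a1(1) u' by simp
    have m1: "Y.steps_op k [([], a, w @ v), (u' @ w, b, [])] =
        [([], a1, w @ v), (tgt (with_inverses X) a1 @ w, b, [])]"
      using 1 l L a1(1)[simplified] t1 s1 s2 opuw' by (simp add: Y.steps_op_def)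
    have m2: "Y.steps_op k [(u @ w, b, []), ([], a, w @ v')] = [(u1 @ w, b, []), ([], a1, w @ v')]"
      using 1 l L a1(1)[simplified] u1 s3 s4 opuw by (simp add: Y.steps_op_def)
    show ?thesis
      unfolding m1 m2 u1(2) by (rule ex[OF a1A b w, unfolded a1(2), folded v v'])
  qed
  moreover have "path_eq X (z, ?fs) (z, ?gs)" if 2: "\<not> left k u (w @ v)" "left k w v"
  proof -
    from 2 have l: "left k (u @ w) v" "\<not> left k u w" using A1 A2 by blast+
    obtain w1 where w1: "op k w = Some w1" "z = u @ w1 @ v" using z' 2 opwv by auto
    have m1: "Y.steps_op k [([], a, w @ v), (u' @ w, b, [])] = [([], a, w1 @ v), (u' @ w1, b, [])]"
      using 2 l L w1 s1 s2 opuw' opwv by (simp add: Y.steps_op_def)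
    have m2: "Y.steps_op k [(u @ w, b, []), ([], a, w @ v')] = [(u @ w1, b, []), ([], a, w1 @ v')]"
      using 2 l L w1 s3 s4 opuw opwv' by (simp add: Y.steps_op_def)
    show ?thesis
      using ex[OF a b op_closed[OF w w1(1)], folded u u' v v'] by (simp only: m1 m2 w1(2))
  qed
  moreover have "path_eq X (z, ?fs) (z, ?gs)" if 3: "\<not> left k u (w @ v)" "\<not> left k w v"
  proof -
    from 3 have l: "\<not> left k (u @ w) v" using A2 by blast
    obtain v1 where v1: "op k v = Some v1" "z = u @ w @ v1" using z' 3 opwv by auto
    have "map_option (src (with_inverses X)) (kash (gen2 (with_inverses X)) k b) = Some v1"
      by (rule HOL.trans[OF HOL.sym[OF Y.src_tgt(3)[OF b, of k, folded v, unfolded with_inverses_simps(1)]] v1(1)])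
    then obtain b1 where b1: "kash (gen2 (with_inverses X)) k b = Some b1" "src (with_inverses X) b1 = v1"
      by auto
    have b1A: "b1 \<in> Y.A" by (rule Y.kash_closed[OF b b1(1)])
    have t1: "op k v' = Some (tgt (with_inverses X) b1)"
      using Y.src_tgt(4)[OF b, of k] b1(1) v' by simp
    have lv: "left k v []" using left_Nil(2)[OF W(3), of k] v1 by auto
    have m1: "Y.steps_op k [([], a, w @ v), (u' @ w, b, [])] = [([], a, w @ v1), (u' @ w, b1, [])]"
      using 3 l lv L b1(1)[simplified] v1 s1 s2 opwv by (simp add: Y.steps_op_def)
    have m2: "Y.steps_op k [(u @ w, b, []), ([], a, w @ v')] =
        [(u @ w, b1, []), ([], a, w @ tgt (with_inverses X) b1)]"
      using 3 l lv L b1(1)[simplified] t1 s3 s4 opwv' by (simp add: Y.steps_op_def)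
    show ?thesis using ex[OF a b1A w, unfolded b1(2), folded u u'] by (simp only: m1 m2 v1(2))
  qed
  ultimately show ?thesis by blast
qed

lemma path_eq_inverse_op:
  assumes a: "a \<in> Y.A" and uv: "u \<in> W" "v \<in> W"
    and z: "op k (u @ src (with_inverses X) a @ v) = Some z"
  shows "path_eq X (z, Y.steps_op k [(u, a, v), (u, inv_signed a, v)]) (z, Y.steps_op k [])"
proof -
  let ?s = "src (with_inverses X) a" and ?t = "tgt (with_inverses X) a"
  note st = Y.src_tgt[OF a, simplified]
  note i = inv_signed[OF a]
  have in1: "(u, a, v) \<in> steps (with_inverses X)" "(u, inv_signed a, v) \<in> steps (with_inverses X)"
    using Y.steps_iff a i uv by auto
  have s1: "same_len ?s ?t" by (rule st)
  have L: "left k u (?t @ v) \<longleftrightarrow> left k u (?s @ v)" "left k ?t v \<longleftrightarrow> left k ?s v"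
    using same_len_left[OF same_len_refl[of u] same_len_append[OF s1 same_len_refl[of v]]]
      same_len_left[OF s1 same_len_refl[of v]] st(1,2) uv by auto
  note o1 = Y.step_op_eq[OF in1(1), of k, unfolded left_with_inverses]
    and o2 = Y.step_op_eq[OF in1(2), of k, unfolded i left_with_inverses L]
  have z': "(if left k u (?s @ v) then map_option (\<lambda>u1. u1 @ ?s @ v) (op k u)
      else if left k ?s v then map_option (\<lambda>s1. u @ s1 @ v) (op k ?s)
      else map_option (\<lambda>v1. u @ ?s @ v1) (op k v)) = Some z"
    using z op_append[of u "?s @ v" k] op_append[of ?s v k] uv st(1)
    by (auto simp: option.map_comp o_def split: if_splits)
  have inv: "path_eq X (u1 @ src (with_inverses X) a1 @ v1, [(u1, a1, v1), (u1, inv_signed a1, v1)])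
      (u1 @ src (with_inverses X) a1 @ v1, [])" if "a1 \<in> Y.A" "u1 \<in> W" "v1 \<in> W" for a1 u1 v1
    using path_eq.inverse[OF that(1), of u1 v1] that free_words_eq by simp
  consider "left k u (?s @ v)" | "\<not> left k u (?s @ v)" "left k ?s v"
    | "\<not> left k u (?s @ v)" "\<not> left k ?s v" by blast
  then show ?thesis
  proof cases
    case 1
    then obtain u1 where u1: "op k u = Some u1" "z = u1 @ ?s @ v" using z' by auto
    show ?thesis
      using inv[OF a op_closed[OF uv(1) u1(1)] uv(2)] u1 o1 o2 1
      by (simp add: Y.steps_op_def)
  next
    case 2
    then obtain s1 where s1: "op k ?s = Some s1" "z = u @ s1 @ v" using z' by auto
    have "map_option (src (with_inverses X)) (kash (gen2 (with_inverses X)) k a) = Some s1"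
      by (rule HOL.trans[OF HOL.sym[OF Y.src_tgt(3)[OF a, of k, unfolded with_inverses_simps(1)]] s1(1)])
    then obtain a1 where a1: "kash (gen2 (with_inverses X)) k a = Some a1"
        "z = u @ src (with_inverses X) a1 @ v"
      using s1(2) by auto
    then show ?thesis
      using inv[OF Y.kash_closed[OF a a1(1)] uv] o1 o2 2
      by (simp add: Y.steps_op_def del: signed_crystal_simps with_inverses_simps(2))
  next
    case 3
    then obtain v1 where v1: "op k v = Some v1" "z = u @ ?s @ v1" using z' by auto
    show ?thesis
      using inv[OF a uv(1) op_closed[OF uv(2) v1(1)]] v1 o1 o2 3
      by (simp add: Y.steps_op_def)
  qed
qed

text \<open>Induction on the congruence. Endpoints and composability are carried along because they
  locate the operator: the second factor of a vertical composite is transformed from the end word of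
  the first, and a whiskered path is hit according to its source.\<close>

lemma path_eq_compat:
  assumes "path_eq X p p'"
  shows "composable (with_inverses X) (fst p) (snd p) \<and> composable (with_inverses X) (fst p') (snd p') \<and>
    fst p = fst p' \<and> Y.end_word (fst p) (snd p) = Y.end_word (fst p') (snd p') \<and>
    (\<forall>k u. op k (fst p) = Some u \<longrightarrow> path_eq X (u, Y.steps_op k (snd p)) (u, Y.steps_op k (snd p')))"
  using assms
proof induction
  case (exchange a b w u u' v v')
  note st = Y.src_tgt[OF exchange(1), simplified, folded exchange(4,5)]
    Y.src_tgt[OF exchange(2), simplified, folded exchange(6,7)]
  have w: "w \<in> W" using exchange(3) free_words_eq by simp
  have c: "composable (with_inverses X) (u @ w @ v) [([], a, w @ v), (u' @ w, b, [])]"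
    "composable (with_inverses X) (u @ w @ v) [(u @ w, b, []), ([], a, w @ v')]"
    using exchange(1,2) st w Y.steps_iff Y.free_words_eq exchange(4-7)[symmetric]
    by (auto simp: step_src.simps step_tgt.simps)
  show ?case
    using c path_eq_exchange_op[OF exchange(1,2) w exchange(4-7)] exchange(4-7)[symmetric]
    by (simp add: Y.end_word_def step_tgt.simps)
next
  case (inverse a u v)
  have uv: "u \<in> W" "v \<in> W" using inverse free_words_eq by auto
  note i = inv_signed[OF inverse(1)] and st = Y.src_tgt[OF inverse(1), simplified]
  have "composable (with_inverses X) (u @ src (with_inverses X) a @ v) [(u, a, v), (u, inv_signed a, v)]"
    using inverse(1) i(1-3) uv st(1,2) Y.steps_iff Y.free_words_eq
    by (simp add: step_src.simps step_tgt.simps del: with_inverses_simps(2))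
  then show ?case
    using path_eq_inverse_op[OF inverse(1) uv] uv st(1) Y.free_words_eq i(3)
    by (simp add: Y.end_word_def step_tgt.simps)
next
  case (refl p)
  then have c: "composable (with_inverses X) (fst p) (snd p)" by (simp add: paths_def case_prod_beta)
  show ?case
    using c Y.composable_steps_op(1)[OF c] by (simp add: path_eq.refl paths_iff)
next
  case (sym p p')
  have "path_eq X (z, Y.steps_op k (snd p')) (z, Y.steps_op k (snd p))" if "op k (fst p') = Some z" for k z
    by (rule path_eq.sym) (use sym.IH that in auto)
  then show ?case using sym.IH by (elim conjE) simp
next
  case (trans p p' p'')
  have "path_eq X (z, Y.steps_op k (snd p)) (z, Y.steps_op k (snd p''))" if "op k (fst p) = Some z" for k z
    by (rule path_eq.trans[where p' = "(z, Y.steps_op k (snd p'))"]) (use trans.IH that in auto)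
  then show ?case using trans.IH by (elim conjE) simp
next
  case (vcomp p p' q q')
  have t: "Y.end_word (fst p) (snd p) = fst q"
    using vcomp(3) by (simp add: path_tgt_eq path_src_def)
  have c: "composable (with_inverses X) (fst p) (snd p)" using vcomp.IH(1) by blast
  have "path_eq X (u, Y.steps_op k (snd p @ snd q)) (u, Y.steps_op k (snd p' @ snd q'))"
    if u: "op k (fst p) = Some u" for k u
  proof -
    \<comment> \<open>The middle word is moved by \<open>k\<close> to the end word of the
      transformed first path, so the transformed paths compose again.\<close>
    have e: "op k (fst q) = Some (Y.end_word u (Y.steps_op k (snd p)))"
      using Y.composable_steps_op(2)[OF c] u t by simp
    have "path_eq X (path_comp (u, Y.steps_op k (snd p)) (Y.end_word u (Y.steps_op k (snd p)), Y.steps_op k (snd q)))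
      (path_comp (u, Y.steps_op k (snd p')) (Y.end_word u (Y.steps_op k (snd p)), Y.steps_op k (snd q')))"
      using vcomp.IH u e by (intro path_eq.vcomp) (auto simp: path_tgt_eq path_src_def)
    then show ?thesis by (simp add: path_comp_def Y.steps_op_def)
  qed
  with vcomp.IH t show ?case
    by (elim conjE) (simp add: path_comp_def Y.composable_append Y.end_word_append)
next
  case (whisker p p' u v)
  have uv: "u \<in> W" "v \<in> W" using whisker free_words_eq by auto
  have c: "composable (with_inverses X) (fst p) (snd p)" "composable (with_inverses X) (fst p) (snd p')"
    and e: "Y.end_word (fst p) (snd p) = Y.end_word (fst p) (snd p')" "fst p' = fst p"
    using whisker.IH by auto
  have w: "fst p \<in> W" using Y.composable_W[OF c(1)] by simp
  have "path_eq X (z, Y.steps_op k (map (\<lambda>f. whisker_step u f v) (snd p)))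
      (z, Y.steps_op k (map (\<lambda>f. whisker_step u f v) (snd p')))"
    if z: "op k (u @ fst p @ v) = Some z" for k z
  proof -
    have z': "(if left k u (fst p @ v) then map_option (\<lambda>u1. u1 @ fst p @ v) (op k u)
      else if left k (fst p) v then map_option (\<lambda>s1. u @ s1 @ v) (op k (fst p))
      else map_option (\<lambda>v1. u @ fst p @ v1) (op k v)) = Some z"
      using z op_append[of u "fst p @ v" k] op_append[of "fst p" v k] uv w
      by (auto simp: option.map_comp o_def split: if_splits)
    have uv': "u \<in> Y.W" "v \<in> Y.W" using uv by simp_all
    have ne: "word_op (gen1 (with_inverses X)) k (u @ fst p @ v) \<noteq> None" using z by simp
    note s = Y.steps_op_whisker[OF c(1) uv' ne, unfolded left_with_inverses with_inverses_simps]
      Y.steps_op_whisker[OF c(2) uv' ne, unfolded left_with_inverses with_inverses_simps]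
    have wh: "path_eq X (u1 @ x @ v1, map (\<lambda>f. whisker_step u1 f v1) fs)
        (u1 @ x @ v1, map (\<lambda>f. whisker_step u1 f v1) gs)"
      if "path_eq X (x, fs) (x, gs)" "u1 \<in> W" "v1 \<in> W" for x fs gs u1 v1
      using path_eq.whisker[OF that(1), of u1 v1] that(2,3) free_words_eq by (simp add: whisker_path_def)
    have pp: "path_eq X (fst p, snd p) (fst p, snd p')"
      using whisker.hyps(1) e(2) by (metis prod.collapse)
    consider "left k u (fst p @ v)" | "\<not> left k u (fst p @ v)" "left k (fst p) v"
      | "\<not> left k u (fst p @ v)" "\<not> left k (fst p) v" by blast
    then show ?thesis
    proof cases
      case 1
      then obtain u1 where u1: "op k u = Some u1" "z = u1 @ fst p @ v" using z' by auto
      then show ?thesis using s(1)[OF 1] s(4)[OF 1] wh[OF pp op_closed[OF uv(1) u1(1)] uv(2)] by simp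
    next
      case 2
      then obtain x where x: "op k (fst p) = Some x" "z = u @ x @ v" using z' by auto
      then have "path_eq X (x, Y.steps_op k (snd p)) (x, Y.steps_op k (snd p'))"
        using whisker.IH by blast
      then show ?thesis using s(2)[OF 2] s(5)[OF 2] wh[OF _ uv] x by simp
    next
      case 3
      then obtain v1 where v1: "op k v = Some v1" "z = u @ fst p @ v1" using z' by auto
      then show ?thesis using s(3)[OF 3] s(6)[OF 3] wh[OF pp uv(1) op_closed[OF uv(2) v1(1)]] by simp
    qed
  qed
  then show ?case
    using Y.composable_whisker[OF c(1)] Y.composable_whisker[OF c(2)] uv e
    by (simp add: whisker_path_def)
qed

end

lemma kash_seq_snoc: "kash_seq \<Gamma> (ks @ [k]) x = Option.bind (kash_seq \<Gamma> ks x) (kash \<Gamma> k)"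
  by (simp add: kash_seq_def)

lemma kash_seq_component: "kash_seq \<Gamma> ks x = Some y \<Longrightarrow> y \<in> component \<Gamma> x"
proof (induction ks arbitrary: y rule: rev_induct)
  case Nil
  then show ?case by (simp add: kash_seq_def component.base)
next
  case (snoc k ks)
  then obtain z where "kash_seq \<Gamma> ks x = Some z" "kash \<Gamma> k z = Some y"
    by (auto simp: kash_seq_snoc bind_eq_Some_conv)
  then show ?case using snoc.IH component.step by metis
qed

context kash_polygraph
begin

interpretation Y: kash_polygraph D "with_inverses X"
  by (rule with_inverses)

section \<open>Cells as classes of paths: endpoints, composition and operators\<close>

lemma path_eq_paths:
  assumes "path_eq X p p'"
  shows "p \<in> paths X" "p' \<in> paths X" "fst p = fst p'" "path_tgt X p = path_tgt X p'"
  using path_eq_compat[OF assms] by (auto simp: paths_def path_tgt_eq)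

lemma cell_of_eqI: "path_eq X p p' \<Longrightarrow> cell_of X p = cell_of X p'"
  using path_eq.sym path_eq.trans unfolding cell_of_def by blast

lemma rep_cell_of:
  assumes "p \<in> paths X"
  shows "path_eq X p (rep (cell_of X p))"
proof -
  have "p \<in> cell_of X p" using path_eq.refl[OF assms] by (simp add: cell_of_def)
  then have "rep (cell_of X p) \<in> cell_of X p" unfolding rep_def by (rule someI)
  then show ?thesis by (simp add: cell_of_def)
qed

lemma cell_src_cell_of: "p \<in> paths X \<Longrightarrow> cell_src (cell_of X p) = fst p"
  using path_eq_paths(3)[OF rep_cell_of] by (simp add: cell_src_def path_src_def)

lemma cell_tgt_cell_of: "p \<in> paths X \<Longrightarrow> cell_tgt X (cell_of X p) = path_tgt X p"
  using path_eq_paths(4)[OF rep_cell_of] by (simp add: cell_tgt_def)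

lemma path_W: "p \<in> paths X \<Longrightarrow> fst p \<in> W"
  using Y.composable_W[of "fst p" "snd p"] by (simp add: paths_def case_prod_beta)

lemma path_op_Some:
  assumes "p \<in> paths X" "op k (fst p) = Some u"
  shows "path_op X k p = Some (u, Y.steps_op k (snd p))"
  using path_op_eq[OF path_W[OF assms(1)], of k "snd p"] assms(2) by simp

text \<open>The chosen representative of the class may be replaced by any path in it, because
  operators respect the congruence.\<close>

lemma cell_op_cell_of:
  assumes p: "p \<in> paths X" and u: "op k (fst p) = Some u"
  shows "cell_op X k (cell_of X p) = Some (cell_of X (u, Y.steps_op k (snd p)))"
proof -
  let ?q = "rep (cell_of X p)"
  have e: "path_eq X p ?q" by (rule rep_cell_of[OF p])
  have q: "?q \<in> paths X" "fst ?q = fst p" using path_eq_paths[OF e] by auto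
  have "path_eq X (u, Y.steps_op k (snd p)) (u, Y.steps_op k (snd ?q))"
    using path_eq_compat[OF e] u by blast
  from cell_of_eqI[OF this] show ?thesis
    using path_op_Some[OF q(1), of k u] q(2) u by (simp add: cell_op_def)
qed

lemma path_comp_paths:
  assumes "p \<in> paths X" "q \<in> paths X" "path_tgt X p = fst q"
  shows "path_comp p q \<in> paths X" "path_tgt X (path_comp p q) = path_tgt X q"
  using assms
  by (auto simp: path_comp_def paths_def path_tgt_eq Y.composable_append Y.end_word_append case_prod_beta)

lemma cell_comp_cell_of:
  assumes "p \<in> paths X" "q \<in> paths X" "path_tgt X p = fst q"
  shows "cell_comp X (cell_of X p) (cell_of X q) = cell_of X (path_comp p q)"
proof -
  have "path_eq X (path_comp p q) (path_comp (rep (cell_of X p)) (rep (cell_of X q)))"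
    using rep_cell_of assms by (intro path_eq.vcomp) (auto simp: path_src_def)
  from cell_of_eqI[OF this] show ?thesis by (simp add: cell_comp_def)
qed

lemma cells_cases:
  assumes "c \<in> cells X"
  obtains p where "p \<in> paths X" "c = cell_of X p"
  using assms by (auto simp: cells_def)

lemma cell_op_comp:
  assumes "c \<in> cells X" "c' \<in> cells X" "cell_tgt X c = cell_src c'" "op k (cell_src c) = Some u"
  shows "cell_op X k (cell_comp X c c') =
    Some (cell_comp X (the (cell_op X k c)) (the (cell_op X k c')))"
proof -
  obtain p q where p: "p \<in> paths X" "c = cell_of X p" and q: "q \<in> paths X" "c' = cell_of X q"
    using cells_cases assms(1,2) by metis
  have t: "path_tgt X p = fst q" using assms(3) p q by (simp add: cell_src_cell_of cell_tgt_cell_of)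
  have u: "op k (fst p) = Some u" using assms(4) p by (simp add: cell_src_cell_of)
  have cp: "composable (with_inverses X) (fst p) (snd p)" and cq: "composable (with_inverses X) (fst q) (snd q)"
    using p q by (auto simp: paths_def case_prod_beta)
  define u' where "u' = Y.end_word u (Y.steps_op k (snd p))"
  have u': "op k (fst q) = Some u'"
    using Y.composable_steps_op(2)[OF cp] u t by (simp add: path_tgt_eq u'_def)
  have P: "(u, Y.steps_op k (snd p)) \<in> paths X" "(u', Y.steps_op k (snd q)) \<in> paths X"
    using Y.composable_steps_op(1)[OF cp] Y.composable_steps_op(1)[OF cq] u u' by (auto simp: paths_iff)
  have "cell_op X k (cell_comp X c c') = Some (cell_of X (u, Y.steps_op k (snd (path_comp p q))))"
    unfolding p(2) q(2) cell_comp_cell_of[OF p(1) q(1) t]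
    by (rule cell_op_cell_of) (use path_comp_paths(1)[OF p(1) q(1) t] u in \<open>auto simp: path_comp_def\<close>)
  also have "(u, Y.steps_op k (snd (path_comp p q))) = path_comp (u, Y.steps_op k (snd p)) (u', Y.steps_op k (snd q))"
    by (simp add: path_comp_def Y.steps_op_def)
  also have "cell_of X \<dots> = cell_comp X (cell_of X (u, Y.steps_op k (snd p))) (cell_of X (u', Y.steps_op k (snd q)))"
    by (rule cell_comp_cell_of[OF P, symmetric]) (simp add: path_tgt_eq u'_def)
  finally show ?thesis
    using cell_op_cell_of[OF p(1) u] cell_op_cell_of[OF q(1) u'] p(2) q(2) by simp
qed

lemma cell_comp_cells:
  assumes "c \<in> cells X" "c' \<in> cells X" "cell_tgt X c = cell_src c'"
  shows "cell_comp X c c' \<in> cells X" "cell_src (cell_comp X c c') = cell_src c"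
    "cell_tgt X (cell_comp X c c') = cell_tgt X c'"
proof -
  obtain p q where p: "p \<in> paths X" "c = cell_of X p" and q: "q \<in> paths X" "c' = cell_of X q"
    using cells_cases assms(1,2) by metis
  have t: "path_tgt X p = fst q" using assms(3) p q by (simp add: cell_src_cell_of cell_tgt_cell_of)
  note c = path_comp_paths[OF p(1) q(1) t]
  show "cell_comp X c c' \<in> cells X" "cell_src (cell_comp X c c') = cell_src c"
    "cell_tgt X (cell_comp X c c') = cell_tgt X c'"
    using c cell_comp_cell_of[OF p(1) q(1) t] p q
    by (auto simp: cells_def cell_src_cell_of cell_tgt_cell_of) (simp add: path_comp_def)
qed

lemma step_cell_path:
  assumes "(t, \<alpha>, v) \<in> steps X"
  shows "(step_src X (t, \<alpha>, v), [(t, Fwd \<alpha>, v)]) \<in> paths X"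
    "step_cell X (t, \<alpha>, v) = cell_of X (step_src X (t, \<alpha>, v), [(t, Fwd \<alpha>, v)])"
    "path_tgt X (step_src X (t, \<alpha>, v), [(t, Fwd \<alpha>, v)]) = step_tgt X (t, \<alpha>, v)"
  using assms src_tgt(2)
  by (auto simp: paths_iff steps_iff Y.steps_iff Y.free_words_eq step_src.simps step_tgt.simps
      path_tgt_eq Y.end_word_def)

lemma step_cell_cell:
  assumes "f \<in> steps X"
  shows "step_cell X f \<in> cells X" "cell_src (step_cell X f) = step_src X f"
    "cell_tgt X (step_cell X f) = step_tgt X f"
proof -
  obtain t \<alpha> v where f: "f = (t, \<alpha>, v)" by (cases f)
  note s = step_cell_path[OF assms[unfolded f]]
  show "step_cell X f \<in> cells X" "cell_src (step_cell X f) = step_src X f"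
    "cell_tgt X (step_cell X f) = step_tgt X f"
    unfolding f s(2) using s(1,3) by (auto simp: cells_def cell_src_cell_of cell_tgt_cell_of)
qed

lemma cell_op_step_cell:
  assumes "f \<in> steps X" "step_op X k f = Some f'"
  shows "cell_op X k (step_cell X f) = Some (step_cell X f')"
proof -
  obtain t \<alpha> v where f: "f = (t, \<alpha>, v)" by (cases f)
  obtain t' \<alpha>' v' where f': "f' = (t', \<alpha>', v')" by (cases f')
  have in1: "(t, \<alpha>, v) \<in> steps X" using assms f by simp
  have in2: "(t, Fwd \<alpha>, v) \<in> steps (with_inverses X)"
    using in1 by (simp add: steps_iff Y.steps_iff)
  have f'S: "(t', \<alpha>', v') \<in> steps X" using step_op_closed[OF assms] f' by simp
  have u: "op k (step_src X (t, \<alpha>, v)) = Some (step_src X (t', \<alpha>', v'))"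
    using step_op_src[OF in1, of k] assms(2) f f' by simp
  have "step_op (with_inverses X) k (t, Fwd \<alpha>, v) = Some (t', Fwd \<alpha>', v')"
    using assms(2) unfolding f f' step_op_eq[OF in1] Y.step_op_eq[OF in2]
    by (auto split: if_splits)
  then show ?thesis
    using cell_op_cell_of[OF step_cell_path(1)[OF in1], of k] u
      step_cell_path(2)[OF in1] step_cell_path(2)[OF f'S] f f'
    by (simp add: Y.steps_op_def)
qed

section \<open>Generating confluences\<close>

lemma presented_eq_step:
  assumes "f \<in> steps X"
  shows "presented_eq X (step_src X f) (step_tgt X f)"
proof -
  obtain t \<alpha> v where f: "f = (t, \<alpha>, v)" by (cases f)
  then have a: "t \<in> W" "\<alpha> \<in> A" "v \<in> W" using assms by (auto simp: steps_iff)
  show ?thesis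
    unfolding f step_src.simps step_tgt.simps
    using a by (intro presented_eq.mult presented_eq.gen presented_eq.refl) (simp_all add: free_words_eq)
qed

lemma word_class_step: "f \<in> steps X \<Longrightarrow> word_class X (step_tgt X f) = word_class X (step_src X f)"
  using presented_eq_step presented_eq.sym presented_eq.trans unfolding word_class_def by blast

text \<open>Each arm is a composite of a step cell and a value of \<sigma>. Operators respect
  composition and step cells, and they send the target of a step to the target of the transformed
  step, where the equivariance of \<sigma> applies.\<close>

lemma generating_confluence_op:
  assumes \<sigma>: "crystal_normalization_strategy X r \<sigma>"
    and b: "b \<in> local_branchings X" "branching_op X k b = Some b'"
  shows "sphere_op X k (generating_confluence X \<sigma> b) = Some (generating_confluence X \<sigma> b')"
proof -
  obtain f g where fg: "b = (f, g)" by (cases b)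
  then have S: "f \<in> steps X" "g \<in> steps X" "step_src X f = step_src X g"
    using b(1) by (auto simp: local_branchings_iff)
  obtain f' g' where o: "step_op X k f = Some f'" "step_op X k g = Some g'" "b' = (f', g')"
    using b branching_op_Some[of f g k b'] fg by blast
  have *: "cell_op X k (cell_comp X (step_cell X h) (\<sigma> (step_tgt X h))) =
      Some (cell_comp X (step_cell X h') (\<sigma> (step_tgt X h')))"
    "cell_src (cell_comp X (step_cell X h) (\<sigma> (step_tgt X h))) = step_src X h"
    if h: "h \<in> steps X" "step_op X k h = Some h'" for h h'
  proof -
    have t: "op k (step_tgt X h) = Some (step_tgt X h')" "op k (step_src X h) = Some (step_src X h')"
      using step_op_tgt[OF h(1), of k] step_op_src[OF h(1), of k] h(2) by simp_all
    have n: "\<sigma> (step_tgt X h) \<in> cells X" "cell_src (\<sigma> (step_tgt X h)) = step_tgt X h"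
      and n': "cell_op X k (\<sigma> (step_tgt X h)) = Some (\<sigma> (step_tgt X h'))"
      using \<sigma> step_tgt_W[OF h(1)] t words_op
      by (auto simp: crystal_normalization_strategy_def normalization_strategy_def free_words_eq)
    have "cell_tgt X (step_cell X h) = cell_src (\<sigma> (step_tgt X h))"
      using step_cell_cell[OF h(1)] n by simp
    note c = step_cell_cell(1)[OF h(1)] n(1) this
    show "cell_op X k (cell_comp X (step_cell X h) (\<sigma> (step_tgt X h))) =
        Some (cell_comp X (step_cell X h') (\<sigma> (step_tgt X h')))"
      using cell_op_comp[OF c, of k] t(2) step_cell_cell(2)[OF h(1)] cell_op_step_cell[OF h] n' by simp
    show "cell_src (cell_comp X (step_cell X h) (\<sigma> (step_tgt X h))) = step_src X h"
      using cell_comp_cells(2)[OF c] step_cell_cell(2)[OF h(1)] by simp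
  qed
  have "kash (words (gen1 X)) k (step_src X f) \<noteq> None"
    using words_op[OF step_src_W[OF S(1)]] step_op_src[OF S(1), of k] o(1) by simp
  then show ?thesis using *[OF S(1) o(1)] *[OF S(2) o(2)] fg o(3) by simp
qed

text \<open>A rewriting step does not change the class in the presented monoid, so both arms end in
  the chosen representative of the class of their common source and are parallel.\<close>

lemma generating_confluence_Sph:
  assumes \<sigma>: "crystal_normalization_strategy X r \<sigma>" and b: "b \<in> local_branchings X"
  shows "generating_confluence X \<sigma> b \<in> elems (Sph X)"
    "cell_src (fst (generating_confluence X \<sigma> b)) = step_src X (fst b)"
proof -
  obtain f g where fg: "b = (f, g)" by (cases b)
  then have S: "f \<in> steps X" "g \<in> steps X" "step_src X f = step_src X g"
    using b by (auto simp: local_branchings_iff)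
  have *: "cell_comp X (step_cell X h) (\<sigma> (step_tgt X h)) \<in> cells X"
    "cell_src (cell_comp X (step_cell X h) (\<sigma> (step_tgt X h))) = step_src X h"
    "cell_tgt X (cell_comp X (step_cell X h) (\<sigma> (step_tgt X h))) = r (word_class X (step_src X h))"
    if h: "h \<in> steps X" for h
  proof -
    have n: "\<sigma> (step_tgt X h) \<in> cells X" "cell_src (\<sigma> (step_tgt X h)) = step_tgt X h"
      and n': "cell_tgt X (\<sigma> (step_tgt X h)) = r (word_class X (step_src X h))"
      using \<sigma> step_tgt_W[OF h] word_class_step[OF h]
      by (auto simp: crystal_normalization_strategy_def normalization_strategy_def free_words_eq nform_def)
    have "cell_tgt X (step_cell X h) = cell_src (\<sigma> (step_tgt X h))"
      using step_cell_cell[OF h] n by simp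
    note c = cell_comp_cells[OF step_cell_cell(1)[OF h] n(1) this]
    show "cell_comp X (step_cell X h) (\<sigma> (step_tgt X h)) \<in> cells X"
      "cell_src (cell_comp X (step_cell X h) (\<sigma> (step_tgt X h))) = step_src X h"
      "cell_tgt X (cell_comp X (step_cell X h) (\<sigma> (step_tgt X h))) = r (word_class X (step_src X h))"
      using c step_cell_cell(2)[OF h] n' by simp_all
  qed
  show "generating_confluence X \<sigma> b \<in> elems (Sph X)"
    using *[OF S(1)] *[OF S(2)] S(3) fg by (simp add: Sph_def mk_crystal_def)
  show "cell_src (fst (generating_confluence X \<sigma> b)) = step_src X (fst b)"
    using *(2)[OF S(1)] fg by simp
qed

lemma kash_Sph: "kash (Sph X) = sphere_op X"
  and kash_crit_crystal: "kash (crit_crystal X) = branching_op X"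
  and elems_crit_crystal: "elems (crit_crystal X) = Crit X"
  by (simp_all add: Sph_def crit_crystal_def mk_crystal_def)

lemma kash_Sph_generating_confluence:
  assumes "crystal_normalization_strategy X r \<sigma>" "b \<in> Crit X"
  shows "kash (Sph X) k (generating_confluence X \<sigma> b) =
    map_option (generating_confluence X \<sigma>) (branching_op X k b)"
proof (cases "branching_op X k b")
  case None
  note loc = Crit_local[OF assms(2)]
  have b: "fst b \<in> steps X" using loc by (metis local_branchings_iff prod.collapse)
  have "op k (step_src X (fst b)) = None" using None branching_op_None[OF loc, of k] by simp
  then have "kash (words (gen1 X)) k (cell_src (fst (generating_confluence X \<sigma> b))) = None"
    using generating_confluence_Sph(2)[OF assms(1) loc] words_op[OF step_src_W[OF b]] by simp
  then show ?thesis using None by (cases "generating_confluence X \<sigma> b") (simp add: kash_Sph)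
next
  case (Some b')
  then show ?thesis
    using generating_confluence_op[OF assms(1) Crit_local[OF assms(2)] Some] by (simp add: kash_Sph)
qed

lemma generating_confluences_subcrystal:
  assumes \<sigma>: "crystal_normalization_strategy X r \<sigma>"
  shows "crystal_cellular_extension D X (generating_confluences X \<sigma>)"
  unfolding crystal_cellular_extension_def subcrystal_def
proof
  let ?\<Omega> = "generating_confluences X \<sigma>"
  let ?m = "generating_confluence X \<sigma>"
  show "?\<Omega> \<subseteq> elems (Sph X)"
    using generating_confluence_Sph(1)[OF \<sigma> Crit_local] by (auto simp: generating_confluences_def)
  have src: "cell_src (fst (?m b)) = step_src X (fst b)" "step_src X (fst b) \<in> W"
    if "b \<in> Crit X" for b
    using generating_confluence_Sph(2)[OF \<sigma> Crit_local[OF that]] Crit_local[OF that]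
    by (simp, metis local_branchings_iff prod.collapse step_src_W)
  have "strings D ?\<Omega> (wt (Sph X)) (kash (Sph X))
      (\<lambda>i s. word_eps (gen1 X) i (cell_src (fst s))) (\<lambda>i s. word_phi (gen1 X) i (cell_src (fst s)))"
    unfolding generating_confluences_def
    by (rule strings_image[OF Crit_strings])
      (simp_all add: src kash_Sph_generating_confluence[OF \<sigma>],
        simp add: Sph_def mk_crystal_def case_prod_beta src words_eq_W)
  then have "normal_crystal D (mk_crystal ?\<Omega> (wt (Sph X)) (kash (Sph X)))"
    by (rule strings_mk_crystal_normal)
  \<comment> \<open>In \<open>Sph X\<close> the string lengths are computed from the operators
    alone, so restricting the set of elements gives the same structure as \<open>mk_crystal\<close>
    on the smaller set.\<close>
  then show "normal_crystal D (restrict_to (Sph X) ?\<Omega>)"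
    by (simp add: Sph_def mk_crystal_def restrict_to_def)
qed

lemma kash_seq_generating_confluence:
  assumes \<sigma>: "crystal_normalization_strategy X r \<sigma>" and "b\<^sub>0 \<in> Crit X"
    and "kash_seq (crit_crystal X) ks b\<^sub>0 = Some b"
  shows "b \<in> Crit X \<and>
    kash_seq (Sph X) ks (generating_confluence X \<sigma> b\<^sub>0) = Some (generating_confluence X \<sigma> b)"
  using assms(3)
proof (induction ks arbitrary: b rule: rev_induct)
  case Nil
  then show ?case using assms(2) by (simp add: kash_seq_def)
next
  case (snoc k ks)
  then obtain c where c: "kash_seq (crit_crystal X) ks b\<^sub>0 = Some c" "branching_op X k c = Some b"
    by (auto simp: kash_seq_snoc bind_eq_Some_conv kash_crit_crystal)
  then have IH: "c \<in> Crit X"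
      "kash_seq (Sph X) ks (generating_confluence X \<sigma> b\<^sub>0) = Some (generating_confluence X \<sigma> c)"
    using snoc.IH by auto
  then have "kash (Sph X) k (generating_confluence X \<sigma> c) = Some (generating_confluence X \<sigma> b)"
    using kash_Sph_generating_confluence[OF \<sigma> IH(1), of k] c(2) by simp
  then show ?case using IH Crit_op[OF IH(1) c(2)] by (simp add: kash_seq_snoc)
qed

lemma component_generating_confluence:
  assumes \<sigma>: "crystal_normalization_strategy X r \<sigma>" and "b\<^sub>0 \<in> Crit X"
    and "s \<in> component (Sph X) (generating_confluence X \<sigma> b\<^sub>0)"
  shows "s \<in> generating_confluences X \<sigma>"
  using assms(3)
proof induction
  case base
  then show ?case using assms(2) by (simp add: generating_confluences_def)
next
  case (step s k s')
  then obtain c where c: "c \<in> Crit X" "s = generating_confluence X \<sigma> c"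
    by (auto simp: generating_confluences_def)
  then obtain c' where "branching_op X k c = Some c'" "s' = generating_confluence X \<sigma> c'"
    using step(2) kash_Sph_generating_confluence[OF \<sigma> c(1), of k] by auto
  then show ?case using Crit_op[OF c(1)] by (auto simp: generating_confluences_def)
qed

end

section \<open>Termination of the raising operators\<close>

lemma crystal_lattice_zero: "0 \<in> crystal_lattice D M v"
  unfolding crystal_lattice_def by (rule CollectI, rule exI[of _ "{}"]) simp

lemma regular_at_0_zero: "0 \<in> regular_at_0"
  unfolding regular_at_0_def
  by (rule CollectI, rule exI[of _ 0], rule exI[of _ 1]) (simp add: Fract_of_int_eq Zero_fract_def)

lemma regular_at_0_add: "a \<in> regular_at_0 \<Longrightarrow> b \<in> regular_at_0 \<Longrightarrow> a + b \<in> regular_at_0"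
proof -
  assume "a \<in> regular_at_0" "b \<in> regular_at_0"
  then obtain p q r s where "a = Fract p q" "coeff q 0 \<noteq> 0" "b = Fract r s" "coeff s 0 \<noteq> 0"
    unfolding regular_at_0_def by blast
  moreover from this have "q \<noteq> 0" "s \<noteq> 0" by auto
  ultimately show ?thesis
    unfolding regular_at_0_def
    by (intro CollectI exI[of _ "p * s + r * q"] exI[of _ "q * s"]) (simp add: coeff_mult_0)
qed

lemma regular_at_0_minus: "a \<in> regular_at_0 \<Longrightarrow> - a \<in> regular_at_0"
proof -
  assume "a \<in> regular_at_0"
  then obtain p q where "a = Fract p q" "coeff q 0 \<noteq> 0"
    unfolding regular_at_0_def by blast
  then show ?thesis
    unfolding regular_at_0_def by (intro CollectI exI[of _ "- p"] exI[of _ q]) simp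
qed

lemma crystal_lattice_minus:
  assumes "x \<in> crystal_lattice D M v"
  shows "- x \<in> crystal_lattice D M v"
proof -
  obtain T c where T: "finite T" "T \<subseteq> f_monomials D M v" "\<forall>x\<in>T. c x \<in> regular_at_0"
      "x = (\<Sum>y\<in>T. smult (c y) y)"
    using assms by (auto simp: crystal_lattice_def)
  then have "- x = (\<Sum>y\<in>T. smult (- c y) y)" by (simp add: sum_negf)
  with T show ?thesis
    unfolding crystal_lattice_def using regular_at_0_minus
    by (intro CollectI exI[of _ T] exI[of _ "\<lambda>y. - c y"]) simp
qed

lemma crystal_lattice_add:
  assumes "x \<in> crystal_lattice D M v" "y \<in> crystal_lattice D M v"
  shows "x + y \<in> crystal_lattice D M v"
proof -
  obtain T c where T: "finite T" "T \<subseteq> f_monomials D M v" "\<forall>x\<in>T. c x \<in> regular_at_0"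
      "x = (\<Sum>z\<in>T. smult (c z) z)"
    using assms(1) by (auto simp: crystal_lattice_def)
  obtain S d where S: "finite S" "S \<subseteq> f_monomials D M v" "\<forall>x\<in>S. d x \<in> regular_at_0"
      "y = (\<Sum>z\<in>S. smult (d z) z)"
    using assms(2) by (auto simp: crystal_lattice_def)
  \<comment> \<open>Extending the coefficients by 0 brings both combinations to the common support
    \<open>T \<union> S\<close>.\<close>
  define c' where "c' z = (if z \<in> T then c z else 0)" for z
  define d' where "d' z = (if z \<in> S then d z else 0)" for z
  have "x = (\<Sum>z\<in>T \<union> S. smult (c' z) z)" "y = (\<Sum>z\<in>T \<union> S. smult (d' z) z)"
    using T(1,4) S(1,4) by (auto simp: c'_def d'_def intro!: sum.mono_neutral_cong_left)
  then have "x + y = (\<Sum>z\<in>T \<union> S. smult (c' z + d' z) z)"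
    by (simp add: sum.distrib smult_add_left)
  moreover have "c' z + d' z \<in> regular_at_0" for z
    using T(3) S(3) by (auto simp: c'_def d'_def intro!: regular_at_0_add regular_at_0_zero)
  ultimately show ?thesis
    unfolding crystal_lattice_def using T S
    by (intro CollectI exI[of _ "T \<union> S"] exI[of _ "\<lambda>z. c' z + d' z"]) simp
qed

lemma residue_eq_zero_iff:
  fixes D :: "('i::finite, 'd::finite) km_datum" and M :: "('i, 'd) qmodule" and v x :: vect
  defines "L \<equiv> crystal_lattice D M v"
  shows "residue L x = residue L 0 \<longleftrightarrow> (\<exists>y\<in>L. x = smult q_var y)"
proof
  assume "residue L x = residue L 0"
  moreover have "x \<in> residue L x"
    unfolding residue_def L_def using crystal_lattice_zero by force
  ultimately show "\<exists>y\<in>L. x = smult q_var y" by (auto simp: residue_def)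
next
  assume "\<exists>y\<in>L. x = smult q_var y"
  then obtain y where y: "y \<in> L" "x = smult q_var y" by blast
  show "residue L x = residue L 0"
  proof (intro equalityI subsetI)
    fix z assume "z \<in> residue L x"
    then obtain w where "w \<in> L" "z = smult q_var (y + w)"
      using y(2) by (auto simp: residue_def smult_add_right)
    moreover have "y + w \<in> L"
      using y(1) \<open>w \<in> L\<close> crystal_lattice_add unfolding L_def by blast
    ultimately show "z \<in> residue L 0" by (auto simp: residue_def)
  next
    fix z assume "z \<in> residue L 0"
    then obtain w where "w \<in> L" "z = smult q_var w" by (auto simp: residue_def)
    moreover from this have "z = x + smult q_var (w + - y)"
      by (simp add: y(2) flip: smult_add_right)
    moreover have "w + - y \<in> L"
      using \<open>w \<in> L\<close> y(1) crystal_lattice_add crystal_lattice_minus unfolding L_def by blast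
    ultimately show "z \<in> residue L x" unfolding residue_def by blast
  qed
qed

lemma smult_sum_right: "smult c (sum f S) = (\<Sum>i\<in>S. smult c (f i))"
  by (induction S rule: infinite_finite_induct) (simp_all add: smult_add_right)

text \<open>A string decomposition can be scaled termwise, and a nonzero factor keeps its support.
  The factor of interest is the inverse of q, which carries vectors of \<open>q L\<close> back into
  \<open>L\<close>.\<close>

lemma tilde_op_smult:
  assumes M: "is_qmodule D M" and "c \<noteq> 0" and t: "tilde_op D M (F i) x y"
  shows "tilde_op D M (F i) (smult c x) (smult c y)"
proof -
  have V: "is_subspace (space M)" and f: "endo_on (space M) (act_f M i)"
    and e: "endo_on (space M) (act_e M i)" and K: "\<And>h. endo_on (space M) (act_q M h)"
    using M by (auto simp: is_qmodule_def Let_def)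
  obtain us \<mu> where us: "x \<in> weight_space M \<mu>"
      "\<And>n. us n \<in> weight_space M (\<mu> + int n *s root D i)" "\<And>n. act_e M i (us n) = 0"
      "\<And>n. us n \<noteq> 0 \<Longrightarrow> int n \<le> pairing (\<mu> + int n *s root D i) (coroot D i)"
      "finite {n. us n \<noteq> 0}"
      "x = (\<Sum>n | us n \<noteq> 0. divided_power D i (act_f M i) n (us n))"
    and y: "y = (\<Sum>n | us n \<noteq> 0. divided_power D i (act_f M i) (n + 1) (us n))"
    using t by (auto simp: string_decomp_def)
  have ws: "smult c u \<in> weight_space M \<nu>" if "u \<in> weight_space M \<nu>" for u \<nu>
    using that V K by (auto simp: weight_space_def is_subspace_def endo_on_def mult.commute)
  have usV: "us n \<in> space M" for n using us(2)[of n] by (simp add: weight_space_def)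
  have pow: "(act_f M i ^^ n) u \<in> space M \<and> (act_f M i ^^ n) (smult c u) = smult c ((act_f M i ^^ n) u)"
    if "u \<in> space M" for u n
    using that f by (induction n) (auto simp: endo_on_def)
  have dp: "divided_power D i (act_f M i) n (smult c (us m)) = smult c (divided_power D i (act_f M i) n (us m))"
    for n m
    using pow[OF usV] by (simp add: divided_power_def mult.commute)
  have "string_decomp D M i (smult c x) (\<lambda>n. smult c (us n))"
    unfolding string_decomp_def
  proof (intro exI[of _ \<mu>] conjI allI impI)
    show "smult c x \<in> weight_space M \<mu>" using ws us(1) .
    show "smult c (us n) \<in> weight_space M (\<mu> + int n *s root D i)" for n using ws us(2) .
    show "act_e M i (smult c (us n)) = 0" for n
      using e usV us(3) by (simp add: endo_on_def)
    show "int n \<le> pairing (\<mu> + int n *s root D i) (coroot D i)" if "smult c (us n) \<noteq> 0" for n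
      using us(4) that by auto
    show "finite {n. smult c (us n) \<noteq> 0}" using us(5) \<open>c \<noteq> 0\<close> by simp
    show "smult c x = (\<Sum>n | smult c (us n) \<noteq> 0. divided_power D i (act_f M i) n (smult c (us n)))"
      using us(6) \<open>c \<noteq> 0\<close> by (simp add: dp smult_sum_right)
  qed
  moreover have "smult c y =
      (\<Sum>n | smult c (us n) \<noteq> 0. divided_power D i (act_f M i) (n + 1) (smult c (us n)))"
    using y \<open>c \<noteq> 0\<close> by (simp add: dp smult_sum_right del: One_nat_def)
  ultimately show ?thesis by auto
qed

text \<open>A path of operators on vectors induces one on residues, since once a vector lies in
  \<open>q L\<close> so do its successors.\<close>

lemma crystal_of_qmodule_lowering:
  assumes M: "is_qmodule D M" and B: "crystal_of_qmodule D M v B"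
    and "x \<in> f_monomials D M v"
  defines "L \<equiv> crystal_lattice D M v"
  assumes "residue L x \<noteq> residue L 0"
  shows "residue L v \<in> elems B \<and> (\<exists>ls. kash_seq B (map F ls) (residue L v) = Some (residue L x))"
proof -
  have stable: "\<forall>x\<in>L. \<forall>k y. tilde_op D M k x y \<longrightarrow> y \<in> L"
    using B unfolding crystal_of_qmodule_def Let_def L_def by (elim conjE)
  have kash: "\<forall>b\<in>elems B. \<forall>x\<in>b. \<forall>k y. tilde_op D M k x y \<longrightarrow>
      kash B k b = (if residue L y = residue L 0 then None else Some (residue L y))"
    using B unfolding crystal_of_qmodule_def Let_def L_def by (elim conjE)
  have elems_eq: "elems B = {residue L x | x. x \<in> f_monomials D M v \<and> residue L x \<noteq> residue L 0}"
    using B by (simp add: crystal_of_qmodule_def Let_def L_def)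
  show ?thesis
    using assms(3,5)
  proof induction
    case base
    have "residue L v \<in> elems B"
      unfolding elems_eq using base f_monomials.base[of v D M] by blast
    then show ?case by (auto simp: kash_seq_def intro: exI[of _ "[]"])
  next
    case (step x i y)
    have q: "q_var \<noteq> 0" by (simp add: q_var_def Zero_fract_def eq_fract)
    have nz: "residue L x \<noteq> residue L 0"
    proof
      assume "residue L x = residue L 0"
      then obtain x' where x': "x' \<in> L" "x = smult q_var x'"
        unfolding L_def residue_eq_zero_iff by blast
      \<comment> \<open>If \<open>x\<close> were in \<open>q L\<close>, dividing by q would put it
        into the stable lattice \<open>L\<close>; its successor, divided by q, would then lie in
        \<open>L\<close> too, making the residue of \<open>y\<close> zero.\<close>
      have "tilde_op D M (F i) (smult (inverse q_var) x) (smult (inverse q_var) y)"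
        using tilde_op_smult[OF M _ step(2)] q by simp
      then have "tilde_op D M (F i) x' (smult (inverse q_var) y)" using x'(2) q by simp
      then have "smult (inverse q_var) y \<in> L" using stable x'(1) by blast
      moreover have "y = smult q_var (smult (inverse q_var) y)" using q by simp
      ultimately have "residue L y = residue L 0"
        unfolding L_def residue_eq_zero_iff by blast
      then show False using step.prems by simp
    qed
    then obtain ls where ls: "residue L v \<in> elems B" "kash_seq B (map F ls) (residue L v) = Some (residue L x)"
      using step.IH by blast
    have "residue L x \<in> elems B"
      unfolding elems_eq using step(1) nz by blast
    moreover have "x \<in> residue L x"
      unfolding residue_def L_def using crystal_lattice_zero by force
    ultimately have "kash B (F i) (residue L x) = Some (residue L y)"
      using kash[rule_format, OF _ _ step(2)] step.prems by simp
    then have "kash_seq B (map F (ls @ [i])) (residue L v) = Some (residue L y)"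
      using ls(2) by (simp add: kash_seq_snoc)
    then show ?case using ls(1) by blast
  qed
qed

text \<open>The generator is the residue of the highest weight vector. Some element of
  \<open>B\<close> must exist to see that this residue is nonzero: all vectors on the way to a
  nonzero residue have nonzero residues.\<close>

lemma is_B_lowering:
  assumes "is_B D \<mu> B" "elems B \<noteq> {}"
  obtains b\<^sub>0 where "b\<^sub>0 \<in> elems B" "\<And>b. b \<in> elems B \<Longrightarrow> \<exists>ls. kash_seq B (map F ls) b\<^sub>0 = Some b"
proof -
  obtain M v where "irreducible_qmodule D M" and B: "crystal_of_qmodule D M v B"
    using assms(1) by (auto simp: is_B_def)
  then have M: "is_qmodule D M" by (simp add: irreducible_qmodule_def)
  define L where "L = crystal_lattice D M v"
  have el: "elems B = {residue L x | x. x \<in> f_monomials D M v \<and> residue L x \<noteq> residue L 0}"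
    using B by (simp add: crystal_of_qmodule_def Let_def L_def)
  have "residue L v \<in> elems B \<and> (\<exists>ls. kash_seq B (map F ls) (residue L v) = Some b)" if "b \<in> elems B" for b
    using that crystal_of_qmodule_lowering[OF M B] unfolding el L_def by blast
  then show thesis using that assms(2) by blast
qed

section \<open>Weights along lowering and raising sequences\<close>

definition root_sum :: "('i::finite, 'd::finite) km_datum \<Rightarrow> 'i list \<Rightarrow> int ^ 'd" where
  "root_sum D ls = sum_list (map (root D) ls)"

lemma root_sum_count: "root_sum D ls = (\<Sum>i\<in>UNIV. int (count_list ls i) *s root D i)"
proof (induction ls)
  case Nil
  then show ?case by (simp add: root_sum_def)
next
  case (Cons j ls)
  have "(\<Sum>i\<in>UNIV. int (count_list (j # ls) i) *s root D i) =
      (\<Sum>i\<in>UNIV. (if i = j then root D i else 0) + int (count_list ls i) *s root D i)"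
    by (intro sum.cong) (auto simp: vector_sadd_rdistrib)
  also have "\<dots> = root D j + root_sum D ls"
    by (simp add: sum.distrib Cons.IH)
  finally show ?case by (simp add: root_sum_def)
qed

lemma root_sum_length:
  assumes "km_datum D" "root_sum D ls = root_sum D ls'"
  shows "length ls = length ls'"
proof -
  have "(\<Sum>i\<in>UNIV. (int (count_list ls i) - int (count_list ls' i)) *s root D i) = 0"
    using assms(2) by (simp add: root_sum_count vector_sub_rdistrib sum_subtractf)
  then have "int (count_list ls i) - int (count_list ls' i) = 0" for i
    using assms(1) by (auto simp: km_datum_def)
  then have "count_list ls i = count_list ls' i" for i by (metis eq_iff_diff_eq_0 of_nat_eq_iff)
  then show ?thesis using sum_count_set[of ls UNIV] sum_count_set[of ls' UNIV] by simp
qed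

lemma kash_seq_closed:
  assumes "normal_crystal D \<Gamma>" "x \<in> elems \<Gamma>"
  shows "kash_seq \<Gamma> ks x = Some y \<Longrightarrow> y \<in> elems \<Gamma>"
proof (induction ks arbitrary: y rule: rev_induct)
  case (snoc k ks)
  then show ?case using assms by (auto simp: kash_seq_snoc bind_eq_Some_conv normal_crystal_def)
qed (use assms in \<open>simp add: kash_seq_def\<close>)

lemma wt_lowering:
  assumes "normal_crystal D \<Gamma>" "x \<in> elems \<Gamma>"
  shows "kash_seq \<Gamma> (map F ls) x = Some y \<Longrightarrow> wt \<Gamma> y = wt \<Gamma> x - root_sum D ls"
proof (induction ls arbitrary: y rule: rev_induct)
  case Nil
  then show ?case by (simp add: kash_seq_def root_sum_def)
next
  case (snoc i ls)
  then obtain z where z: "kash_seq \<Gamma> (map F ls) x = Some z" "kash \<Gamma> (F i) z = Some y"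
    by (auto simp: kash_seq_snoc bind_eq_Some_conv)
  have "wt \<Gamma> y = wt \<Gamma> z - root D i"
    using assms(1) kash_seq_closed[OF assms z(1)] z(2) by (auto simp: normal_crystal_def)
  then show ?case using snoc.IH[OF z(1)] by (simp add: root_sum_def algebra_simps)
qed

lemma wt_raising:
  assumes "normal_crystal D \<Gamma>" "x \<in> elems \<Gamma>"
  shows "kash_seq \<Gamma> (map E ls) x = Some y \<Longrightarrow> wt \<Gamma> y = wt \<Gamma> x + root_sum D ls"
proof (induction ls arbitrary: y rule: rev_induct)
  case Nil
  then show ?case by (simp add: kash_seq_def root_sum_def)
next
  case (snoc i ls)
  then obtain z where z: "kash_seq \<Gamma> (map E ls) x = Some z" "kash \<Gamma> (E i) z = Some y"
    by (auto simp: kash_seq_snoc bind_eq_Some_conv)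
  have "wt \<Gamma> y = wt \<Gamma> z + root D i"
    using assms(1) kash_seq_closed[OF assms z(1)] z(2) by (auto simp: normal_crystal_def)
  then show ?case using snoc.IH[OF z(1)] by (simp add: root_sum_def algebra_simps)
qed

lemma component_closed:
  assumes "normal_crystal D \<Gamma>" "x \<in> elems \<Gamma>"
  shows "y \<in> component \<Gamma> x \<Longrightarrow> y \<in> elems \<Gamma>"
  by (induction rule: component.induct) (use assms in \<open>auto simp: normal_crystal_def\<close>)

text \<open>The generator of B(lambda) is pulled back along the isomorphism. Lowering sequences lift
  one operator at a time and stay in the component, where injectivity identifies the end of the
  lift.\<close>

lemma component_lowering:
  assumes "crystal D \<Gamma>" "x \<in> elems \<Gamma>"
  obtains x\<^sub>0 where "x\<^sub>0 \<in> elems \<Gamma>"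
    "\<And>y. y \<in> component \<Gamma> x \<Longrightarrow> \<exists>ls. kash_seq \<Gamma> (map F ls) x\<^sub>0 = Some y"
proof -
  let ?C = "component \<Gamma> x"
  have N: "normal_crystal D \<Gamma>" using assms(1) by (simp add: crystal_def)
  obtain \<mu> B m where B: "is_B D \<mu> B" and m: "morphism (restrict_to \<Gamma> ?C) B m" "bij_betw m ?C (elems B)"
    using assms by (fastforce simp: crystal_def isomorphic_def restrict_to_def)
  have "m x \<in> elems B" using m(2) component.base[of x \<Gamma>] by (auto simp: bij_betw_def)
  then obtain b\<^sub>0 where b0: "b\<^sub>0 \<in> elems B" "\<And>b. b \<in> elems B \<Longrightarrow> \<exists>ls. kash_seq B (map F ls) b\<^sub>0 = Some b"
    using is_B_lowering[OF B] by blast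
  then have "b\<^sub>0 \<in> m ` ?C" using m(2) by (simp add: bij_betw_def)
  then obtain x\<^sub>0 where x0: "x\<^sub>0 \<in> ?C" "m x\<^sub>0 = b\<^sub>0" by auto
  have kash: "kash B k (m y) = map_option m (kash \<Gamma> k y)" if "y \<in> ?C" for k y
    using m(1) that by (simp add: morphism_def restrict_to_def)
  have lift: "\<exists>y\<in>?C. m y = b \<and> kash_seq \<Gamma> (map F ls) x\<^sub>0 = Some y"
    if "kash_seq B (map F ls) b\<^sub>0 = Some b" for ls b
    using that
  proof (induction ls arbitrary: b rule: rev_induct)
    case Nil
    then show ?case using x0 by (simp add: kash_seq_def)
  next
    case (snoc i ls)
    then obtain c where c: "kash_seq B (map F ls) b\<^sub>0 = Some c" "kash B (F i) c = Some b"
      by (auto simp: kash_seq_snoc bind_eq_Some_conv)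
    then obtain z where z: "z \<in> ?C" "m z = c" "kash_seq \<Gamma> (map F ls) x\<^sub>0 = Some z"
      using snoc.IH by blast
    have "map_option m (kash \<Gamma> (F i) z) = Some b" using kash[OF z(1), of "F i"] c(2) z(2) by simp
    then obtain y where y: "kash \<Gamma> (F i) z = Some y" "m y = b" by auto
    moreover have "y \<in> ?C" using component.step[OF z(1) y(1)] .
    ultimately show ?case using z(3) by (auto simp: kash_seq_snoc)
  qed
  have "\<exists>ls. kash_seq \<Gamma> (map F ls) x\<^sub>0 = Some y" if y: "y \<in> ?C" for y
  proof -
    have "m y \<in> elems B" using m(2) y by (auto simp: bij_betw_def)
    then obtain ls where "kash_seq B (map F ls) b\<^sub>0 = Some (m y)" using b0(2) by blast
    from lift[OF this] obtain y' where "y' \<in> ?C" "m y' = m y" "kash_seq \<Gamma> (map F ls) x\<^sub>0 = Some y'" by blast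
    moreover from this have "y' = y" using m(2) y by (auto simp: bij_betw_def dest: inj_onD)
    ultimately show ?thesis by blast
  qed
  then show thesis using that component_closed[OF N assms(2) x0(1)] by blast
qed

text \<open>The bound is the depth of \<open>x\<close> below the generator of its component. A
  raised element is itself reached from the generator by lowering, so comparing the two expressions
  for its weight gives the depth of \<open>x\<close> as the sum of its own depth and the number of
  raisings.\<close>

lemma raising_bounded:
  assumes "km_datum D" "crystal D \<Gamma>" "x \<in> elems \<Gamma>"
  shows "\<exists>n. \<forall>ls y. kash_seq \<Gamma> (map E ls) x = Some y \<longrightarrow> length ls \<le> n"
proof -
  have N: "normal_crystal D \<Gamma>" using assms(2) by (simp add: crystal_def)
  obtain x\<^sub>0 where x0: "x\<^sub>0 \<in> elems \<Gamma>"
    and low: "\<And>y. y \<in> component \<Gamma> x \<Longrightarrow> \<exists>ls. kash_seq \<Gamma> (map F ls) x\<^sub>0 = Some y"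
    using component_lowering[OF assms(2,3)] by blast
  obtain ks where ks: "kash_seq \<Gamma> (map F ks) x\<^sub>0 = Some x" using low[OF component.base] by blast
  have "length ls \<le> length ks" if y: "kash_seq \<Gamma> (map E ls) x = Some y" for ls y
  proof -
    obtain ks' where ks': "kash_seq \<Gamma> (map F ks') x\<^sub>0 = Some y"
      using low[OF kash_seq_component[OF y]] by blast
    have "wt \<Gamma> x\<^sub>0 - root_sum D ks' = wt \<Gamma> x\<^sub>0 - root_sum D ks + root_sum D ls"
      using wt_lowering[OF N x0 ks] wt_lowering[OF N x0 ks'] wt_raising[OF N assms(3) y] by simp
    then have "root_sum D ks = root_sum D ls + root_sum D ks'"
      by (simp add: diff_eq_eq)
    then have "root_sum D ks = root_sum D (ls @ ks')" by (simp add: root_sum_def)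
    from root_sum_length[OF assms(1) this] show ?thesis by simp
  qed
  then show ?thesis by blast
qed

text \<open>The height of \<open>x\<close> is the least bound for the lengths of raising sequences
  from \<open>x\<close>. Prepending \<open>i\<close> turns a sequence from \<open>y\<close> into one
  from \<open>x\<close>, so the bound at \<open>y\<close> is smaller by at least one.\<close>

lemma crystal_height:
  assumes "km_datum D" "crystal D \<Gamma>"
  obtains h :: "'x \<Rightarrow> nat" where "\<And>x i y. x \<in> elems (\<Gamma> :: ('x, 'i::finite, 'd::finite) crystal) \<Longrightarrow>
    kash \<Gamma> (E i) x = Some y \<Longrightarrow> h y < h x"
proof
  let ?P = "\<lambda>x n. \<forall>ls y. kash_seq \<Gamma> (map E ls) x = Some y \<longrightarrow> length ls \<le> n"
  fix x i y assume x: "x \<in> elems \<Gamma>" and y: "kash \<Gamma> (E i) x = Some y"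
  have P: "?P x (LEAST n. ?P x n)"
    using LeastI_ex[OF raising_bounded[OF assms x]] .
  have seq: "kash_seq \<Gamma> (map E (i # ls)) x = kash_seq \<Gamma> (map E ls) y" for ls
    using y by (simp add: kash_seq_def)
  \<comment> \<open>The sequence \<open>[i]\<close> can be applied to \<open>x\<close>, so the
    truncated subtraction of 1 below is a genuine one.\<close>
  have pos: "(LEAST n. ?P x n) \<ge> 1"
    using P[rule_format, of "[i]" y] y by (simp add: kash_seq_def)
  have "?P y ((LEAST n. ?P x n) - 1)"
  proof (intro allI impI)
    fix ls z assume "kash_seq \<Gamma> (map E ls) y = Some z"
    then show "length ls \<le> (LEAST n. ?P x n) - 1" using P[rule_format, of "i # ls" z] seq[of ls] by simp
  qed
  then have "(LEAST n. ?P y n) \<le> (LEAST n. ?P x n) - 1" by (rule Least_le)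
  then show "(LEAST n. ?P y n) < (LEAST n. ?P x n)" using pos by linarith
qed

section \<open>Descent to critical branchings of highest weight\<close>

lemma word_op_height:
  assumes "\<And>x i y. x \<in> elems G \<Longrightarrow> kash G (E i) x = Some y \<Longrightarrow> h y < (h x :: nat)"
  shows "set w \<subseteq> elems G \<Longrightarrow> word_op G (E i) w = Some w' \<Longrightarrow>
    sum_list (map h w') < sum_list (map h w)"
proof (induction w arbitrary: w')
  case (Cons x w)
  then show ?case using assms by (auto split: if_splits)
qed simp

lemma (in kash_polygraph) Crit_highest_weight:
  assumes "km_datum D" "crystal D (gen1 X)" "b \<in> Crit X"
  shows "\<exists>b\<^sub>0 ks. highest_weight (crit_crystal X) b\<^sub>0 \<and> kash_seq (crit_crystal X) ks b\<^sub>0 = Some b"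
proof -
  obtain h where h: "\<And>x i y. x \<in> elems (gen1 X) \<Longrightarrow> kash (gen1 X) (E i) x = Some y \<Longrightarrow> h y < (h x :: nat)"
    using crystal_height[OF assms(1,2)] by blast
  show ?thesis
    using assms(3)
  proof (induction "sum_list (map h (step_src X (fst b)))" arbitrary: b rule: less_induct)
    case less
    show ?case
    proof (cases "highest_weight (crit_crystal X) b")
      case True
      then show ?thesis by (intro exI[of _ b] exI[of _ "[]"]) (simp add: kash_seq_def)
    next
      case False
      then obtain i b' where b': "branching_op X (E i) b = Some b'"
        using less.prems by (auto simp: highest_weight_def elems_crit_crystal kash_crit_crystal)
      note loc = branching_op_local[OF Crit_local[OF less.prems] b']
      have "fst b \<in> steps X" using Crit_local[OF less.prems] by (metis local_branchings_iff prod.collapse)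
      then have "sum_list (map h (step_src X (fst b'))) < sum_list (map h (step_src X (fst b)))"
        using word_op_height[of "gen1 X" h] h loc(3) step_src_W W_subset by blast
      then obtain b\<^sub>0 ks where "highest_weight (crit_crystal X) b\<^sub>0" "kash_seq (crit_crystal X) ks b\<^sub>0 = Some b'"
        using less.hyps[OF _ Crit_op[OF less.prems b']] by blast
      \<comment> \<open>The final \<open>F i\<close> undoes the raising of \<open>b\<close> to
        \<open>b'\<close>.\<close>
      then show ?thesis
        using loc(2) by (intro exI[of _ b\<^sub>0] exI[of _ "ks @ [F i]"]) (simp add: kash_seq_snoc kash_crit_crystal)
    qed
  qed
qed

text \<open>Being determined by the critical branchings of highest weight is made precise by the
  last three clauses: such branchings generate all critical branchings, the same sequence of
  operators carries the associated spheres into one another, and the extension is therefore the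
  union of the components of the spheres of highest weight branchings.\<close>

theorem theorem4p2p4:
  fixes D :: "('i::finite, 'd::finite) km_datum"
    and X :: "('a, 'b, 'i, 'd) polygraph"
    and r :: "'a list set \<Rightarrow> 'a list"
    and \<sigma> :: "'a list \<Rightarrow> ('a, 'b) cell"
  assumes "km_datum D"
    and "crystal_polygraph D X"
    and "convergent_polygraph X"
    and "crystal_section X r"
    and "crystal_normalization_strategy X r \<sigma>"
  shows "crystal_cellular_extension D X (generating_confluences X \<sigma>) \<and>
    (\<forall>b\<in>Crit X. \<exists>b\<^sub>0 ks.
       highest_weight (crit_crystal X) b\<^sub>0 \<and> kash_seq (crit_crystal X) ks b\<^sub>0 = Some b) \<and>
    (\<forall>b\<^sub>0 ks b.
       highest_weight (crit_crystal X) b\<^sub>0 \<and> kash_seq (crit_crystal X) ks b\<^sub>0 = Some b \<longrightarrow>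
       kash_seq (Sph X) ks (generating_confluence X \<sigma> b\<^sub>0) = Some (generating_confluence X \<sigma> b)) \<and>
    generating_confluences X \<sigma> =
      (\<Union>b\<^sub>0\<in>{b. highest_weight (crit_crystal X) b}. component (Sph X) (generating_confluence X \<sigma> b\<^sub>0))"
proof -
  interpret kash_polygraph D X
    using assms(2) by unfold_locales (auto simp: crystal_polygraph_def crystal_def)
  note \<sigma> = assms(5)
  have hw: "\<exists>b\<^sub>0 ks. highest_weight (crit_crystal X) b\<^sub>0 \<and> kash_seq (crit_crystal X) ks b\<^sub>0 = Some b"
    if "b \<in> Crit X" for b
    using Crit_highest_weight[OF assms(1) _ that] assms(2) by (simp add: crystal_polygraph_def)
  have hw_Crit: "b\<^sub>0 \<in> Crit X" if "highest_weight (crit_crystal X) b\<^sub>0" for b\<^sub>0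
    using that by (simp add: highest_weight_def elems_crit_crystal)
  note seq = kash_seq_generating_confluence[OF \<sigma> hw_Crit]
  have "generating_confluences X \<sigma> =
      (\<Union>b\<^sub>0\<in>{b. highest_weight (crit_crystal X) b}. component (Sph X) (generating_confluence X \<sigma> b\<^sub>0))"
  proof (intro equalityI subsetI)
    fix s assume "s \<in> generating_confluences X \<sigma>"
    then obtain b where b: "b \<in> Crit X" "s = generating_confluence X \<sigma> b"
      by (auto simp: generating_confluences_def)
    obtain b\<^sub>0 ks where b\<^sub>0: "highest_weight (crit_crystal X) b\<^sub>0" "kash_seq (crit_crystal X) ks b\<^sub>0 = Some b"
      using hw[OF b(1)] by blast
    have "s \<in> component (Sph X) (generating_confluence X \<sigma> b\<^sub>0)"
      unfolding b(2) by (rule kash_seq_component[OF conjunct2[OF seq[OF b\<^sub>0]]])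
    with b\<^sub>0(1) show
      "s \<in> (\<Union>b\<^sub>0\<in>{b. highest_weight (crit_crystal X) b}. component (Sph X) (generating_confluence X \<sigma> b\<^sub>0))"
      by blast
  next
    fix s assume "s \<in> (\<Union>b\<^sub>0\<in>{b. highest_weight (crit_crystal X) b}.
        component (Sph X) (generating_confluence X \<sigma> b\<^sub>0))"
    then obtain b\<^sub>0 where "highest_weight (crit_crystal X) b\<^sub>0"
        "s \<in> component (Sph X) (generating_confluence X \<sigma> b\<^sub>0)" by blast
    then show "s \<in> generating_confluences X \<sigma>"
      using component_generating_confluence[OF \<sigma> hw_Crit] by simp
  qed
  moreover have "\<forall>b\<in>Crit X. \<exists>b\<^sub>0 ks.
      highest_weight (crit_crystal X) b\<^sub>0 \<and> kash_seq (crit_crystal X) ks b\<^sub>0 = Some b"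
    using hw by simp
  moreover have "\<forall>b\<^sub>0 ks b.
      highest_weight (crit_crystal X) b\<^sub>0 \<and> kash_seq (crit_crystal X) ks b\<^sub>0 = Some b \<longrightarrow>
      kash_seq (Sph X) ks (generating_confluence X \<sigma> b\<^sub>0) = Some (generating_confluence X \<sigma> b)"
    using seq by simp
  ultimately show ?thesis
    using generating_confluences_subcrystal[OF \<sigma>] by (intro conjI)
qed

end
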